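(* Let $(R,B)$ be a fusion ring with $|B/G_R|=2$. Assume $G:=G_R$ is abelian and denote $H:=H_R$. If $R$ is uniform and the elements of $B\setminus G$ are self-dual (i.e. $x=x^\ast$ for all $x\in B\setminus G$), then there is a bijection between $\mathrm{Irr}(R)$ and the disjoint union $\mathrm{Irr}_H(G)\cup\mathrm{Irr}((G/H)\rtimes_{\theta_R}C_2)$.
   Context: A fusion ring $(R,B)$ is an associative unital ring $R$, free of finite rank as a $\mathbb{Z}$-module, with a distinguished basis $B=\{b_i\}_{i\in I}\ni b_0=1_R$ such that $b_ib_j=\sum_kc_{i,j}^kb_k$ with $c_{i,j}^k\in\mathbb{Z}_{\geq0}$, and an involution $i\mapsto i^\ast$ of $I$ such that $b_i\mapsto b_i^\ast:=b_{i^\ast}$ extends linearly to an anti-involution of $R$ and $c_{i,j}^0=\delta_{i,j^\ast}$. $G_R\subset B$ is the finite group of invertible basis elements (those $x\in B$ with $xx^\ast=x^\ast x=1_R$), acting on $B$ by left multiplication; $B/G_R$ is the set of orbits. When $|B/G_R|=2$, the stabilizer in $G_R$ of $x\in B\setminus G_R$ does not depend on $x$ and is a normal subgroup of $G_R$, denoted $H_R$. For $x\in B\setminus G_R$, $\theta_x:G_R/H_R\to G_R/H_R$ is the map $gH_R\mapsto g'H_R$ where $g'x=xg$; it is a well-defined automorphism. A fusion ring with $|B/G_R|=2$ is uniform if $G_R/H_R$ is abelian and there exists $k\in\mathbb{Z}_{\geq0}$ such that $xx^\ast=\sum_{g\in H_R}g+k\sum_{y\in B\setminus G_R}y$ for all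 $x\in B\setminus G_R$. When $G_R/H_R$ is abelian, $\theta_x$ is independent of $x$ and satisfies $\theta_x^2=\mathrm{id}$; it is denoted $\theta_R$, and $(G_R/H_R)\rtimes_{\theta_R}C_2$ is the semidirect product in which the generator of $C_2$ acts by $\theta_R$. $\mathrm{Irr}(R)$ is the set of isomorphism classes of irreducible finite-dimensional representations of $R\otimes_{\mathbb{Z}}\mathbb{C}$; for a finite group $\Gamma$, $\mathrm{Irr}(\Gamma)$ is the set of isomorphism classes of irreducible complex representations of $\Gamma$; for a subgroup $H\subset G$, $\mathrm{Irr}_H(G)\subset\mathrm{Irr}(G)$ is the subset of those $\psi$ such that $\psi|_H$ is a sum of nontrivial irreducible representations of $H$. *)

theory Defs
  imports
    "HOL-Algebra.Group_Action"
    "HOL-Algebra.Elementary_Groups"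
    "Jordan_Normal_Form.VS_Connect"
begin

section \<open>Fusion rings\<close>

text \<open>The integral coordinates of \<open>r\<close> with respect to the \<open>\<int>\<close>-basis \<open>B\<close>. They are made total by
  the value \<open>0\<close> outside \<open>B\<close>. The structure constant \<open>c\<^sub>i\<^sub>j\<^sup>k\<close> is \<open>zcoord R B (i \<otimes> j) k\<close>; the index set
  \<open>I\<close> is identified with \<open>B\<close> and the index \<open>0\<close> with \<open>\<one>\<close>.\<close>

definition is_zcoord :: "('a, 'm) ring_scheme \<Rightarrow> 'a set \<Rightarrow> 'a \<Rightarrow> ('a \<Rightarrow> int) \<Rightarrow> bool" where
  "is_zcoord R B r f \<longleftrightarrow>
     (\<forall>b. b \<notin> B \<longrightarrow> f b = 0) \<and> r = (\<Oplus>\<^bsub>R\<^esub>b\<in>B. add_pow R (f b) b)"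

definition zcoord :: "('a, 'm) ring_scheme \<Rightarrow> 'a set \<Rightarrow> 'a \<Rightarrow> 'a \<Rightarrow> int" where
  "zcoord R B r = (THE f. is_zcoord R B r f)"

definition star_lin :: "('a, 'm) ring_scheme \<Rightarrow> 'a set \<Rightarrow> ('a \<Rightarrow> 'a) \<Rightarrow> 'a \<Rightarrow> 'a" where
  "star_lin R B star r = (\<Oplus>\<^bsub>R\<^esub>b\<in>B. add_pow R (zcoord R B r b) (star b))"

locale fusion_ring = ring R for R (structure) +
  fixes B :: "'a set" and star :: "'a \<Rightarrow> 'a"
  assumes finite_basis: "finite B"
    and basis_subset: "B \<subseteq> carrier R"
    and basis: "r \<in> carrier R \<Longrightarrow> \<exists>!f. is_zcoord R B r f"
    and one_in_basis: "\<one> \<in> B"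
    and structure_nonneg: "\<lbrakk>i \<in> B; j \<in> B; k \<in> B\<rbrakk> \<Longrightarrow> zcoord R B (i \<otimes> j) k \<ge> 0"
    and star_closed: "i \<in> B \<Longrightarrow> star i \<in> B"
    and star_star: "i \<in> B \<Longrightarrow> star (star i) = i"
    and star_anti: "\<lbrakk>r \<in> carrier R; s \<in> carrier R\<rbrakk> \<Longrightarrow>
          star_lin R B star (r \<otimes> s) = star_lin R B star s \<otimes> star_lin R B star r"
    and structure_one: "\<lbrakk>i \<in> B; j \<in> B\<rbrakk> \<Longrightarrow>
          zcoord R B (i \<otimes> j) \<one> = (if i = star j then 1 else 0)"

definition inv_basis :: "('a, 'm) ring_scheme \<Rightarrow> 'a set \<Rightarrow> ('a \<Rightarrow> 'a) \<Rightarrow> 'a set" where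
  "inv_basis R B star = {x \<in> B. x \<otimes>\<^bsub>R\<^esub> star x = \<one>\<^bsub>R\<^esub> \<and> star x \<otimes>\<^bsub>R\<^esub> x = \<one>\<^bsub>R\<^esub>}"

definition inv_group :: "('a, 'm) ring_scheme \<Rightarrow> 'a set \<Rightarrow> ('a \<Rightarrow> 'a) \<Rightarrow> 'a monoid" where
  "inv_group R B star =
     \<lparr>carrier = inv_basis R B star, monoid.mult = mult R, one = one R\<rparr>"

definition noninv_basis :: "('a, 'm) ring_scheme \<Rightarrow> 'a set \<Rightarrow> ('a \<Rightarrow> 'a) \<Rightarrow> 'a set" where
  "noninv_basis R B star = B - inv_basis R B star"

definition left_action :: "('a, 'm) ring_scheme \<Rightarrow> 'a set \<Rightarrow> 'a \<Rightarrow> 'a \<Rightarrow> 'a" where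
  "left_action R B g = (\<lambda>x\<in>B. g \<otimes>\<^bsub>R\<^esub> x)"

definition basis_orbits :: "('a, 'm) ring_scheme \<Rightarrow> 'a set \<Rightarrow> ('a \<Rightarrow> 'a) \<Rightarrow> 'a set set" where
  "basis_orbits R B star = orbits (inv_group R B star) B (left_action R B)"

text \<open>The following three notions are meant for fusion rings with exactly two orbits; the last one
  also needs \<open>G\<^sub>R/H\<^sub>R\<close> to be abelian. The definite descriptions are then determined.\<close>

definition stab_group :: "('a, 'm) ring_scheme \<Rightarrow> 'a set \<Rightarrow> ('a \<Rightarrow> 'a) \<Rightarrow> 'a set" where
  "stab_group R B star =
     (THE H. \<forall>x \<in> noninv_basis R B star. H = stabilizer (inv_group R B star) (left_action R B) x)"

definition quot_group :: "('a, 'm) ring_scheme \<Rightarrow> 'a set \<Rightarrow> ('a \<Rightarrow> 'a) \<Rightarrow> 'a set monoid" where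
  "quot_group R B star = inv_group R B star Mod stab_group R B star"

definition theta_at ::
  "('a, 'm) ring_scheme \<Rightarrow> 'a set \<Rightarrow> ('a \<Rightarrow> 'a) \<Rightarrow> 'a \<Rightarrow> 'a set \<Rightarrow> 'a set" where
  "theta_at R B star x =
     (\<lambda>C \<in> carrier (quot_group R B star). THE D.
        \<exists>g \<in> inv_basis R B star. \<exists>g' \<in> inv_basis R B star.
          C = g <#\<^bsub>inv_group R B star\<^esub> stab_group R B star \<and>
          D = g' <#\<^bsub>inv_group R B star\<^esub> stab_group R B star \<and>
          g' \<otimes>\<^bsub>R\<^esub> x = x \<otimes>\<^bsub>R\<^esub> g)"

definition theta :: "('a, 'm) ring_scheme \<Rightarrow> 'a set \<Rightarrow> ('a \<Rightarrow> 'a) \<Rightarrow> 'a set \<Rightarrow> 'a set" where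
  "theta R B star = (THE t. \<forall>x \<in> noninv_basis R B star. t = theta_at R B star x)"

definition uniform :: "('a, 'm) ring_scheme \<Rightarrow> 'a set \<Rightarrow> ('a \<Rightarrow> 'a) \<Rightarrow> bool" where
  "uniform R B star \<longleftrightarrow>
     comm_group (quot_group R B star) \<and>
     (\<exists>k::nat. \<forall>x \<in> noninv_basis R B star.
        x \<otimes>\<^bsub>R\<^esub> star x =
          (\<Oplus>\<^bsub>R\<^esub>g\<in>stab_group R B star. g)
            \<oplus>\<^bsub>R\<^esub> add_pow R k (\<Oplus>\<^bsub>R\<^esub>y\<in>noninv_basis R B star. y))"

section \<open>Extension of scalars\<close>

text \<open>\<open>R \<otimes>\<^sub>\<int> \<complex>\<close>, realised on the \<open>\<complex>\<close>-vector space with basis \<open>B\<close>; elements are coordinate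
  functions vanishing outside \<open>B\<close>. The lemmas on \<open>ptensor\<close> below show that this is the tensor
  product, with the multiplication determined by \<open>(r \<otimes> c)(s \<otimes> d) = rs \<otimes> cd\<close>.\<close>

definition complexification ::
  "('a, 'm) ring_scheme \<Rightarrow> 'a set \<Rightarrow> (complex, 'a \<Rightarrow> complex) module" where
  "complexification R B =
     \<lparr>carrier = {f. \<forall>b. b \<notin> B \<longrightarrow> f b = 0},
      monoid.mult = (\<lambda>f g b. \<Sum>x\<in>B. \<Sum>y\<in>B. f x * g y * of_int (zcoord R B (x \<otimes>\<^bsub>R\<^esub> y) b)),
      one = (\<lambda>b. of_int (zcoord R B \<one>\<^bsub>R\<^esub> b)),
      zero = (\<lambda>b. 0),
      add = (\<lambda>f g b. f b + g b),
      smult = (\<lambda>c f b. c * f b)\<rparr>"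

definition ptensor :: "('a, 'm) ring_scheme \<Rightarrow> 'a set \<Rightarrow> 'a \<Rightarrow> complex \<Rightarrow> 'a \<Rightarrow> complex" where
  "ptensor R B r c = (\<lambda>b. of_int (zcoord R B r b) * c)"

section \<open>Finite-dimensional complex representations\<close>

text \<open>A representation on \<open>\<complex>\<^sup>n\<close> is a pair of the dimension \<open>n\<close> and a matrix-valued map on the
  carrier \<open>X\<close> of the represented object; its values outside \<open>X\<close> are irrelevant, and are ignored by
  \<open>rep_iso\<close>.\<close>

type_synonym 'x rep = "nat \<times> ('x \<Rightarrow> complex mat)"

definition rep_iso :: "'x set \<Rightarrow> 'x rep \<Rightarrow> 'x rep \<Rightarrow> bool" where
  "rep_iso X \<rho> \<sigma> \<longleftrightarrow>
     fst \<rho> = fst \<sigma> \<and>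
     (\<exists>P \<in> Units (ring_mat TYPE(complex) (fst \<rho>) ()). \<forall>x\<in>X. P * snd \<rho> x = snd \<sigma> x * P)"

definition irreducible_rep :: "'x set \<Rightarrow> 'x rep \<Rightarrow> bool" where
  "irreducible_rep X \<rho> \<longleftrightarrow>
     fst \<rho> \<noteq> 0 \<and>
     (\<forall>W. subspace class_ring W (module_vec TYPE(complex) (fst \<rho>)) \<and>
          (\<forall>x\<in>X. \<forall>w\<in>W. snd \<rho> x *\<^sub>v w \<in> W) \<longrightarrow>
        W = {0\<^sub>v (fst \<rho>)} \<or> W = carrier_vec (fst \<rho>))"

definition iso_classes :: "'x set \<Rightarrow> 'x rep set \<Rightarrow> 'x rep set set" where
  "iso_classes X S = S // {(\<rho>, \<sigma>). \<rho> \<in> S \<and> \<sigma> \<in> S \<and> rep_iso X \<rho> \<sigma>}"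

definition alg_rep :: "(complex, 'x, 'n) module_scheme \<Rightarrow> 'x rep \<Rightarrow> bool" where
  "alg_rep A \<rho> \<longleftrightarrow>
     snd \<rho> \<in> Ring.ring_hom A (ring_mat TYPE(complex) (fst \<rho>) ()) \<and>
     (\<forall>c. \<forall>a\<in>carrier A. snd \<rho> (c \<odot>\<^bsub>A\<^esub> a) = c \<cdot>\<^sub>m snd \<rho> a)"

definition group_rep :: "('x, 'n) monoid_scheme \<Rightarrow> 'x rep \<Rightarrow> bool" where
  "group_rep \<Gamma> \<rho> \<longleftrightarrow> snd \<rho> \<in> hom \<Gamma> (units_of (ring_mat TYPE(complex) (fst \<rho>) ()))"

definition Irr_alg :: "(complex, 'x, 'n) module_scheme \<Rightarrow> 'x rep set set" where
  "Irr_alg A = iso_classes (carrier A) {\<rho>. alg_rep A \<rho> \<and> irreducible_rep (carrier A) \<rho>}"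

definition Irr_group :: "('x, 'n) monoid_scheme \<Rightarrow> 'x rep set set" where
  "Irr_group \<Gamma> = iso_classes (carrier \<Gamma>) {\<rho>. group_rep \<Gamma> \<rho> \<and> irreducible_rep (carrier \<Gamma>) \<rho>}"

definition Irr_fusion :: "('a, 'm) ring_scheme \<Rightarrow> 'a set \<Rightarrow> ('a \<Rightarrow> complex) rep set set" where
  "Irr_fusion R B = Irr_alg (complexification R B)"

definition trivial_rep :: "'x rep" where
  "trivial_rep = (1, \<lambda>_. 1\<^sub>m 1)"

definition rep_sum :: "'x rep list \<Rightarrow> 'x rep" where
  "rep_sum \<rho>s = (sum_list (map fst \<rho>s), \<lambda>x. diag_block_mat (map (\<lambda>\<rho>. snd \<rho> x) \<rho>s))"

definition sum_of_nontrivial :: "('x, 'n) monoid_scheme \<Rightarrow> 'x set \<Rightarrow> 'x rep \<Rightarrow> bool" where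
  "sum_of_nontrivial G H \<psi> \<longleftrightarrow>
     (\<exists>\<rho>s. (\<forall>\<rho> \<in> set \<rho>s. group_rep (G\<lparr>carrier := H\<rparr>) \<rho> \<and> irreducible_rep H \<rho> \<and>
                          \<not> rep_iso H \<rho> trivial_rep) \<and>
           rep_iso H \<psi> (rep_sum \<rho>s))"

definition Irr_rel :: "('x, 'n) monoid_scheme \<Rightarrow> 'x set \<Rightarrow> 'x rep set set" where
  "Irr_rel G H = {\<Psi> \<in> Irr_group G. \<forall>\<psi>\<in>\<Psi>. sum_of_nontrivial G H \<psi>}"

section \<open>Semidirect products\<close>

definition semidirect ::
  "('n, 'u) monoid_scheme \<Rightarrow> ('k, 'v) monoid_scheme \<Rightarrow> ('k \<Rightarrow> 'n \<Rightarrow> 'n) \<Rightarrow> ('n \<times> 'k) monoid" where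
  "semidirect N K \<phi> =
     \<lparr>carrier = carrier N \<times> carrier K,
      monoid.mult = (\<lambda>(n, k) (n', k'). (n \<otimes>\<^bsub>N\<^esub> \<phi> k n', k \<otimes>\<^bsub>K\<^esub> k')),
      one = (\<one>\<^bsub>N\<^esub>, \<one>\<^bsub>K\<^esub>)\<rparr>"

text \<open>\<open>C\<^sub>2\<close> is the additive group \<open>{0, 1}\<close> of integers modulo 2.\<close>

definition semidirect_C2 :: "('n, 'u) monoid_scheme \<Rightarrow> ('n \<Rightarrow> 'n) \<Rightarrow> ('n \<times> int) monoid" where
  "semidirect_C2 N t = semidirect N (integer_mod_group 2) (\<lambda>k. t ^^ nat k)"

section \<open>The complexification is the tensor product\<close>

context fusion_ring
begin

lemma zcoord_is: "r \<in> carrier R \<Longrightarrow> is_zcoord R B r (zcoord R B r)"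
  unfolding zcoord_def by (rule theI'[OF basis])

lemma zcoord_eqI: "\<lbrakk>r \<in> carrier R; is_zcoord R B r f\<rbrakk> \<Longrightarrow> zcoord R B r = f"
  using basis zcoord_is by blast

lemma zcoord_outside: "\<lbrakk>r \<in> carrier R; b \<notin> B\<rbrakk> \<Longrightarrow> zcoord R B r b = 0"
  using zcoord_is unfolding is_zcoord_def by blast

lemma zcoord_expand: "r \<in> carrier R \<Longrightarrow> r = (\<Oplus>b\<in>B. add_pow R (zcoord R B r b) b)"
  using zcoord_is unfolding is_zcoord_def by blast

lemma zcoord_add:
  assumes "r \<in> carrier R" "s \<in> carrier R"
  shows "zcoord R B (r \<oplus> s) = (\<lambda>b. zcoord R B r b + zcoord R B s b)"
proof (rule zcoord_eqI)
  have c: "(\<lambda>b. add_pow R (f b :: int) b) \<in> B \<rightarrow> carrier R" for f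
    using basis_subset by auto
  have "r \<oplus> s = (\<Oplus>b\<in>B. add_pow R (zcoord R B r b) b) \<oplus> (\<Oplus>b\<in>B. add_pow R (zcoord R B s b) b)"
    using zcoord_expand assms by metis
  also have "\<dots> = (\<Oplus>b\<in>B. add_pow R (zcoord R B r b) b \<oplus> add_pow R (zcoord R B s b) b)"
    by (rule finsum_addf[symmetric]) (use c in auto)
  also have "\<dots> = (\<Oplus>b\<in>B. add_pow R (zcoord R B r b + zcoord R B s b) b)"
    by (rule finsum_cong') (use basis_subset in \<open>auto simp: add.int_pow_mult[symmetric]\<close>)
  finally show "is_zcoord R B (r \<oplus> s) (\<lambda>b. zcoord R B r b + zcoord R B s b)"
    using assms by (auto simp: is_zcoord_def zcoord_outside)
qed (use assms in auto)

lemma zcoord_hom: "(\<lambda>r. zcoord R B r b) \<in> hom (add_monoid R) integer_group"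
  by (auto simp: hom_def integer_group_def zcoord_add)

lemma zcoord_add_pow:
  assumes "r \<in> carrier R"
  shows "zcoord R B (add_pow R (k::int) r) b = k * zcoord R B r b"
  using hom_int_pow[OF zcoord_hom, of r k b] assms
  by (simp add: add_pow_def add.is_group mult.commute)

lemma zcoord_finsum:
  assumes "finite S" "f \<in> S \<rightarrow> carrier R"
  shows "zcoord R B (\<Oplus>i\<in>S. f i) b = (\<Sum>i\<in>S. zcoord R B (f i) b)"
  using assms
proof (induction S rule: finite_induct)
  case empty
  have "zcoord R B (\<zero> \<oplus> \<zero>) b = zcoord R B \<zero> b + zcoord R B \<zero> b"
    by (subst zcoord_add) auto
  then show ?case by simp
next
  case (insert i S)
  then have "f i \<in> carrier R" "f \<in> S \<rightarrow> carrier R" by auto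
  with insert show ?case by (simp add: zcoord_add)
qed

lemma zcoord_mult:
  assumes r: "r \<in> carrier R" and s: "s \<in> carrier R"
  shows "zcoord R B (r \<otimes> s) b =
    (\<Sum>x\<in>B. \<Sum>y\<in>B. zcoord R B r x * zcoord R B s y * zcoord R B (x \<otimes> y) b)"
proof -
  let ?r = "\<lambda>x. add_pow R (zcoord R B r x) x" and ?s = "\<lambda>y. add_pow R (zcoord R B s y) y"
  have cr: "?r x \<in> carrier R" "?s x \<in> carrier R" "x \<in> carrier R" if "x \<in> B" for x
    using that basis_subset by auto
  have "r \<otimes> s = (\<Oplus>x\<in>B. ?r x) \<otimes> s" using zcoord_expand[OF r] by simp
  also have "\<dots> = (\<Oplus>x\<in>B. ?r x \<otimes> s)"
    by (rule finsum_ldistr) (use cr finite_basis s in auto)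
  finally have 1: "r \<otimes> s = (\<Oplus>x\<in>B. ?r x \<otimes> s)" .
  have 2: "?r x \<otimes> s = (\<Oplus>y\<in>B. ?r x \<otimes> ?s y)" if x: "x \<in> B" for x
  proof -
    have "?r x \<otimes> s = ?r x \<otimes> (\<Oplus>y\<in>B. ?s y)" using zcoord_expand[OF s] by simp
    also have "\<dots> = (\<Oplus>y\<in>B. ?r x \<otimes> ?s y)"
      by (rule finsum_rdistr) (use cr x finite_basis in auto)
    finally show ?thesis .
  qed
  have 3: "zcoord R B (?r x \<otimes> ?s y) b =
      zcoord R B r x * zcoord R B s y * zcoord R B (x \<otimes> y) b" if "x \<in> B" "y \<in> B" for x y
    using cr[OF that(1)] cr[OF that(2)]
    by (simp add: add_pow_ldistr_int add_pow_rdistr_int zcoord_add_pow)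
  have "zcoord R B (r \<otimes> s) b = (\<Sum>x\<in>B. zcoord R B (?r x \<otimes> s) b)"
    unfolding 1 by (rule zcoord_finsum) (use cr s finite_basis in auto)
  also have "\<dots> = (\<Sum>x\<in>B. \<Sum>y\<in>B. zcoord R B (?r x \<otimes> ?s y) b)"
  proof (rule sum.cong[OF refl])
    fix x assume x: "x \<in> B"
    show "zcoord R B (?r x \<otimes> s) b = (\<Sum>y\<in>B. zcoord R B (?r x \<otimes> ?s y) b)"
      unfolding 2[OF x] by (rule zcoord_finsum) (use cr x finite_basis in auto)
  qed
  finally show ?thesis by (simp add: 3)
qed

lemma ptensor_closed: "r \<in> carrier R \<Longrightarrow> ptensor R B r c \<in> carrier (complexification R B)"
  by (simp add: ptensor_def complexification_def zcoord_outside)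

lemma ptensor_add_left:
  assumes "r \<in> carrier R" "s \<in> carrier R"
  shows "ptensor R B (r \<oplus> s) c = ptensor R B r c \<oplus>\<^bsub>complexification R B\<^esub> ptensor R B s c"
  using assms by (simp add: ptensor_def complexification_def zcoord_add distrib_right)

lemma ptensor_add_right:
  "ptensor R B r (c + d) = ptensor R B r c \<oplus>\<^bsub>complexification R B\<^esub> ptensor R B r d"
  by (simp add: ptensor_def complexification_def distrib_left)

lemma ptensor_smult:
  "d \<odot>\<^bsub>complexification R B\<^esub> ptensor R B r c = ptensor R B r (d * c)"
  by (simp add: ptensor_def complexification_def mult_ac)

lemma ptensor_one: "\<one>\<^bsub>complexification R B\<^esub> = ptensor R B \<one> 1"
  by (simp add: ptensor_def complexification_def)

lemma ptensor_mult:
  assumes "r \<in> carrier R" "s \<in> carrier R"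
  shows "ptensor R B r c \<otimes>\<^bsub>complexification R B\<^esub> ptensor R B s d = ptensor R B (r \<otimes> s) (c * d)"
  by (rule ext)
    (simp add: ptensor_def complexification_def zcoord_mult[OF assms] sum_distrib_left sum_distrib_right mult_ac)

lemma zcoord_basis:
  assumes "b \<in> B"
  shows "zcoord R B b = (\<lambda>x. if x = b then 1 else 0)"
proof (rule zcoord_eqI)
  have b: "b \<in> carrier R" using assms basis_subset by auto
  have "(\<Oplus>x\<in>B. add_pow R (if x = b then 1 else 0 :: int) x) = (\<Oplus>x\<in>B. if b = x then b else \<zero>)"
    by (rule finsum_cong') (use b basis_subset in \<open>auto simp: add_pow_def int_pow_def2\<close>)
  also have "\<dots> = b"
    by (rule add.finprod_singleton) (use assms b finite_basis in auto)
  finally show "is_zcoord R B b (\<lambda>x. if x = b then 1 else 0)"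
    using assms by (auto simp: is_zcoord_def)
qed (use assms basis_subset in auto)

theorem ptensor_universal:
  fixes M (structure) and \<beta> :: "'a \<Rightarrow> complex \<Rightarrow> 'c"
  assumes M: "abelian_group M"
    and closed: "\<And>r c. r \<in> carrier R \<Longrightarrow> \<beta> r c \<in> carrier M"
    and left: "\<And>r s c. \<lbrakk>r \<in> carrier R; s \<in> carrier R\<rbrakk> \<Longrightarrow>
            \<beta> (r \<oplus>\<^bsub>R\<^esub> s) c = \<beta> r c \<oplus>\<^bsub>M\<^esub> \<beta> s c"
    and right: "\<And>r c d. r \<in> carrier R \<Longrightarrow> \<beta> r (c + d) = \<beta> r c \<oplus>\<^bsub>M\<^esub> \<beta> r d"
  shows "\<exists>!h. h \<in> extensional (carrier (complexification R B)) \<and>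
            h \<in> hom (add_monoid (complexification R B)) (add_monoid M) \<and>
            (\<forall>r\<in>carrier R. \<forall>c. h (ptensor R B r c) = \<beta> r c)"
proof -
  interpret M: abelian_group M by (rule M)
  let ?C = "complexification R B"
  let ?Cadd = "\<lparr>carrier = UNIV :: complex set, monoid.mult = (+), one = 0\<rparr>"
  have Cgrp: "group ?Cadd"
    by (rule groupI) (auto intro: exI[of _ "- _"])
  have Cpow: "c [^]\<^bsub>?Cadd\<^esub> (n::int) = of_int n * c" for c n
  proof -
    have nat: "c [^]\<^bsub>?Cadd\<^esub> (m::nat) = of_nat m * c" for m
      by (induction m) (auto simp: distrib_right)
    have inv: "inv\<^bsub>?Cadd\<^esub> d = - d" for d
      by (rule group.inv_equality[OF Cgrp]) auto
    show ?thesis by (simp add: int_pow_def2 nat inv)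
  qed
  have lhom: "(\<lambda>r. \<beta> r c) \<in> hom (add_monoid R) (add_monoid M)" for c
    by (auto simp: hom_def closed left)
  have rhom: "\<beta> r \<in> hom ?Cadd (add_monoid M)" if "r \<in> carrier R" for r
    using that by (auto simp: hom_def closed right)
  have balance: "\<beta> r (of_int n * c) = \<beta> (add_pow R n r) c" if r: "r \<in> carrier R" for r n c
    using hom_int_pow[OF rhom[OF r] _ Cgrp M.add.is_group, of c n]
      hom_int_pow[OF lhom _ add.is_group M.add.is_group, of r n c] r
    by (simp add: Cpow add_pow_def)
  have zero: "\<beta> \<zero>\<^bsub>R\<^esub> c = \<zero>\<^bsub>M\<^esub>" for c
    using hom_one[OF lhom add.is_group M.add.is_group] by simp
  have fin: "\<beta> (\<Oplus>\<^bsub>R\<^esub>i\<in>S. f i) c = (\<Oplus>\<^bsub>M\<^esub>i\<in>S. \<beta> (f i) c)"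
    if "finite S" "f \<in> S \<rightarrow> carrier R" for S f c
    using that
  proof (induction S rule: finite_induct)
    case (insert i S)
    then have "f i \<in> carrier R" "f \<in> S \<rightarrow> carrier R" by auto
    with insert show ?case by (simp add: left closed Pi_iff)
  qed (simp add: zero)
  have bc: "\<beta> b c \<in> carrier M" if "b \<in> B" for b c
    using that closed basis_subset by auto
  define h where "h = (\<lambda>f\<in>carrier ?C. \<Oplus>\<^bsub>M\<^esub>b\<in>B. \<beta> b (f b))"
  have addC: "f \<oplus>\<^bsub>?C\<^esub> g \<in> carrier ?C" if "f \<in> carrier ?C" "g \<in> carrier ?C" for f g
    using that by (simp add: complexification_def)
  have h_hom: "h \<in> hom (add_monoid ?C) (add_monoid M)"
  proof (rule homI)
    fix f g assume fg: "f \<in> carrier (add_monoid ?C)" "g \<in> carrier (add_monoid ?C)"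
    have "h (f \<oplus>\<^bsub>?C\<^esub> g) = (\<Oplus>\<^bsub>M\<^esub>b\<in>B. \<beta> b (f b + g b))"
      using fg addC unfolding h_def by (simp add: complexification_def)
    also have "\<dots> = (\<Oplus>\<^bsub>M\<^esub>b\<in>B. \<beta> b (f b) \<oplus>\<^bsub>M\<^esub> \<beta> b (g b))"
      by (rule M.finsum_cong') (use basis_subset bc in \<open>auto simp: right\<close>)
    also have "\<dots> = h f \<oplus>\<^bsub>M\<^esub> h g"
      using fg bc by (simp add: h_def M.finsum_addf Pi_iff)
    finally show "h (f \<otimes>\<^bsub>add_monoid ?C\<^esub> g) = h f \<otimes>\<^bsub>add_monoid M\<^esub> h g" by simp
  qed (use bc in \<open>auto simp: h_def\<close>)
  have h_pt: "h (ptensor R B r c) = \<beta> r c" if r: "r \<in> carrier R" for r c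
  proof -
    have "h (ptensor R B r c) = (\<Oplus>\<^bsub>M\<^esub>b\<in>B. \<beta> b (of_int (zcoord R B r b) * c))"
      using ptensor_closed[OF r] by (simp add: h_def ptensor_def)
    also have "\<dots> = (\<Oplus>\<^bsub>M\<^esub>b\<in>B. \<beta> (add_pow R (zcoord R B r b) b) c)"
      by (rule M.finsum_cong') (use basis_subset closed in \<open>auto simp: balance\<close>)
    also have "\<dots> = \<beta> (\<Oplus>\<^bsub>R\<^esub>b\<in>B. add_pow R (zcoord R B r b) b) c"
      by (rule fin[symmetric]) (use finite_basis basis_subset in auto)
    finally show ?thesis using zcoord_expand[OF r] by simp
  qed
  have uniq: "k f = (\<Oplus>\<^bsub>M\<^esub>b\<in>S. \<beta> b (f b))"
    if S: "finite S" "S \<subseteq> B" and f: "\<forall>b. b \<notin> S \<longrightarrow> f b = 0"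
      and k: "k \<in> hom (add_monoid ?C) (add_monoid M)"
        "\<forall>r\<in>carrier R. \<forall>c. k (ptensor R B r c) = \<beta> r c" for k S f
    using S f
  proof (induction S arbitrary: f rule: finite_induct)
    case empty
    then have "f = ptensor R B \<one>\<^bsub>R\<^esub> 0" by (auto simp: ptensor_def)
    then have "k f = \<beta> \<one>\<^bsub>R\<^esub> 0" using k(2) by simp
    also have "\<dots> = \<zero>\<^bsub>M\<^esub>"
      using hom_one[OF rhom[OF one_closed] Cgrp M.add.is_group] by simp
    finally show ?case by simp
  next
    case (insert b S)
    let ?g = "f(b := 0)"
    have b: "b \<in> B" "b \<in> carrier R" using insert.prems basis_subset by auto
    have "f = ptensor R B b (f b) \<oplus>\<^bsub>?C\<^esub> ?g"
      by (auto simp: ptensor_def complexification_def zcoord_basis b)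
    moreover have "?g \<in> carrier ?C" "ptensor R B b (f b) \<in> carrier ?C"
      using insert.prems ptensor_closed b by (auto simp: complexification_def)
    ultimately have "k f = k (ptensor R B b (f b)) \<oplus>\<^bsub>M\<^esub> k ?g"
      using hom_mult[OF k(1), of "ptensor R B b (f b)" ?g] by simp
    also have "k ?g = (\<Oplus>\<^bsub>M\<^esub>b\<in>S. \<beta> b (?g b))"
      by (rule insert.IH) (use insert.prems in auto)
    also have "\<dots> = (\<Oplus>\<^bsub>M\<^esub>b\<in>S. \<beta> b (f b))"
      by (rule M.finsum_cong') (use insert bc in auto)
    finally show ?case
      using insert k(2) b bc by (subst M.finsum_insert) auto
  qed
  show ?thesis
  proof (rule ex1I[of _ h])
    show "h \<in> extensional (carrier ?C) \<and> h \<in> hom (add_monoid ?C) (add_monoid M) \<and>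
        (\<forall>r\<in>carrier R. \<forall>c. h (ptensor R B r c) = \<beta> r c)"
      using h_hom h_pt by (simp add: h_def)
  next
    fix k assume k: "k \<in> extensional (carrier ?C) \<and> k \<in> hom (add_monoid ?C) (add_monoid M) \<and>
        (\<forall>r\<in>carrier R. \<forall>c. k (ptensor R B r c) = \<beta> r c)"
    show "k = h"
    proof (rule extensionalityI)
      fix f assume f: "f \<in> carrier ?C"
      show "k f = h f"
        using uniq[OF finite_basis subset_refl, of f k] k f
        by (simp add: h_def complexification_def)
    qed (use k in \<open>auto simp: h_def\<close>)
  qed
qed

end

end

theory Submission
  imports Defs "Jordan_Normal_Form.Spectral_Radius"
begin

text \<open>Write \<open>X = B - G\<close> and fix \<open>x\<^sub>0 \<in> X\<close>, so that \<open>X = G x\<^sub>0\<close>. Since \<open>x\<^sub>0\<close> and \<open>g\<^sup>-\<^sup>1 x\<^sub>0\<close> are both self-dual,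
  \<open>x\<^sub>0 g = g\<^sup>-\<^sup>1 x\<^sub>0\<close> (\<open>X_mult_G\<close>). Hence \<open>\<theta>\<close> is inversion on \<open>G/H\<close> (\<open>theta_coset\<close>), and the
  semidirect product \<open>\<Gamma>\<close> is the generalized dihedral group of \<open>G/H\<close>.

  A representation of \<open>R \<otimes> \<complex>\<close> is the same as matrices \<open>D g\<close> for \<open>g \<in> G\<close> and one matrix \<open>Y\<close> for \<open>x\<^sub>0\<close>,
  where \<open>D\<close> is multiplicative, \<open>Y D g = D g\<^sup>-\<^sup>1 Y\<close>, \<open>D h Y = Y\<close> for \<open>h \<in> H\<close>, and
  \<open>Y\<^sup>2 = \<Sum>\<^sub>h D h + k |H|\<^sup>-\<^sup>1 (\<Sum>\<^sub>g D g) Y\<close> (\<open>orbit_rep_of_basis_rep\<close>, \<open>basis_rep_glue\<close>). Let it be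
  irreducible. Then every \<open>D h\<close> commutes with everything, so it is a scalar by Schur's lemma.

  If some \<open>D h\<close> is not the identity, \<open>D h Y = Y\<close> forces \<open>Y = 0\<close> (\<open>x0_zero\<close>), and what remains is an
  irreducible representation of \<open>G\<close> that is nontrivial on \<open>H\<close>. As \<open>G\<close> is abelian this representation
  is one-dimensional, and being nontrivial on \<open>H\<close> is the same as restricting to a sum of nontrivial
  irreducible representations of \<open>H\<close>. Conversely every such representation extends by \<open>Y = 0\<close>, because then
  \<open>\<Sum>\<^sub>h D h = 0\<close> (\<open>group_part_surj\<close>).

  If all \<open>D h\<close> are the identity, \<open>D\<close> lives on \<open>G/H\<close>. The matrix \<open>\<Sum>\<^sub>g D g\<close> is again a scalar, and it vanishes
  unless \<open>D\<close> is trivial on all of \<open>G\<close>. So the quadratic relation becomes \<open>Y\<^sup>2 = |H| + \<mu> Y\<close> for a number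
  \<open>\<mu> \<ge> 0\<close> that depends only on \<open>D\<close>. Its two roots are distinct, whence the involution
  \<open>S = (Y - \<mu>/2) / sqrt (|H| + \<mu>\<^sup>2/4)\<close>. It still satisfies \<open>S D g = D g\<^sup>-\<^sup>1 S\<close>, since \<open>\<mu> \<noteq> 0\<close> only happens
  when \<open>D\<close> is trivial. Thus \<open>D\<close> and \<open>S\<close> form a representation of \<open>\<Gamma>\<close>, and \<open>Y\<close> is recovered from \<open>S\<close>
  (\<open>dihedral_rep_reflection\<close>, \<open>orbit_rep_unreflection\<close>).

  In both cases the old and the new matrices generate the same algebra, so irreducibility and isomorphism
  are preserved in both directions; \<open>subalgebra_rel\<close> makes this precise.\<close>

section \<open>Maps out of a quotient\<close>

lemma bij_betw_quotient_image:
  assumes r: "equiv A r" and f: "\<And>x y. x \<in> A \<Longrightarrow> y \<in> A \<Longrightarrow> f x = f y \<longleftrightarrow> (x, y) \<in> r"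
  shows "\<exists>F. bij_betw F (A // r) (f ` A)"
proof -
  have im: "f ` (r `` {x}) = {f x}" if "x \<in> A" for x
    using that f[OF that] equiv_class_self[OF r that] equiv_class_subset[OF r] equiv_type[OF r]
    by (auto simp: image_iff) (metis SigmaD2 f subsetD)
  have F: "the_elem (f ` (r `` {x})) = f x" if "x \<in> A" for x
    using im[OF that] by simp
  have "bij_betw (\<lambda>C. the_elem (f ` C)) (A // r) (f ` A)"
  proof (rule bij_betw_imageI)
    show "inj_on (\<lambda>C. the_elem (f ` C)) (A // r)"
    proof (rule inj_onI)
      fix C C' assume "C \<in> A // r" "C' \<in> A // r" "the_elem (f ` C) = the_elem (f ` C')"
      then show "C = C'" by (elim quotientE) (use f in \<open>simp add: F equiv_class_eq[OF r]\<close>)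
    qed
    have "A // r = (\<lambda>x. r `` {x}) ` A" by (auto simp: quotient_def)
    then show "(\<lambda>C. the_elem (f ` C)) ` (A // r) = f ` A"
      by (simp add: image_image F)
  qed
  then show ?thesis by blast
qed

section \<open>Sums of square matrices\<close>

text \<open>For a fixed size \<open>n\<close> this is a sum with values in all of the type of matrices, which is not an additive
  monoid because the zero matrix depends on the dimensions. Working entrywise also makes the empty sum the
  \<open>n \<times> n\<close> zero matrix.\<close>

definition msum :: "nat \<Rightarrow> ('b \<Rightarrow> complex mat) \<Rightarrow> 'b set \<Rightarrow> complex mat" where
  "msum n F S = mat n n (\<lambda>ij. \<Sum>a\<in>S. F a $$ ij)"

lemma msum_carrier [simp]: "msum n F S \<in> carrier_mat n n"
  and msum_dim [simp]: "dim_row (msum n F S) = n" "dim_col (msum n F S) = n"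
  by (simp_all add: msum_def)

lemma msum_index: "i < n \<Longrightarrow> j < n \<Longrightarrow> msum n F S $$ (i, j) = (\<Sum>a\<in>S. F a $$ (i, j))"
  by (simp add: msum_def)

lemma msum_cong: "S = T \<Longrightarrow> (\<And>a. a \<in> T \<Longrightarrow> F a = F' a) \<Longrightarrow> msum n F S = msum n F' T"
  by (simp add: msum_def cong: sum.cong)

lemma msum_empty [simp]: "msum n F {} = 0\<^sub>m n n"
  by (rule eq_matI) (simp_all add: msum_index)

lemma msum_insert:
  "finite S \<Longrightarrow> a \<notin> S \<Longrightarrow> F a \<in> carrier_mat n n \<Longrightarrow> msum n F (insert a S) = F a + msum n F S"
  by (rule eq_matI) (auto simp: msum_index)

lemma msum_reindex: "bij_betw h S T \<Longrightarrow> msum n (\<lambda>a. F (h a)) S = msum n F T"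
  by (rule eq_matI) (auto simp: msum_index intro: sum.reindex_bij_betw)

lemma msum_const: "A \<in> carrier_mat n n \<Longrightarrow> msum n (\<lambda>_. A) S = of_nat (card S) \<cdot>\<^sub>m A"
  by (rule eq_matI) (auto simp: msum_index)

lemma msum_add:
  assumes "\<And>a. a \<in> S \<Longrightarrow> F a \<in> carrier_mat n n" "\<And>a. a \<in> S \<Longrightarrow> F' a \<in> carrier_mat n n"
  shows "msum n (\<lambda>a. F a + F' a) S = msum n F S + msum n F' S"
proof (rule eq_matI)
  fix i j assume "i < dim_row (msum n F S + msum n F' S)" "j < dim_col (msum n F S + msum n F' S)"
  then have ij: "i < n" "j < n" by auto
  have "msum n (\<lambda>a. F a + F' a) S $$ (i, j) = (\<Sum>a\<in>S. F a $$ (i, j) + F' a $$ (i, j))"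
    unfolding msum_index[OF ij]
    by (rule sum.cong) (use ij in \<open>simp_all add: assms[THEN carrier_matD(1)] assms[THEN carrier_matD(2)]\<close>)
  then show "msum n (\<lambda>a. F a + F' a) S $$ (i, j) = (msum n F S + msum n F' S) $$ (i, j)"
    using ij by (simp add: msum_index sum.distrib)
qed auto

lemma msum_smult:
  assumes "\<And>a. a \<in> S \<Longrightarrow> F a \<in> carrier_mat n n"
  shows "msum n (\<lambda>a. c \<cdot>\<^sub>m F a) S = c \<cdot>\<^sub>m msum n F S"
  by (rule eq_matI) (auto simp: msum_index sum_distrib_left assms[THEN carrier_matD(1)] assms[THEN carrier_matD(2)] intro!: sum.cong)

lemma msum_single:
  assumes "finite S" "b \<in> S" "F b \<in> carrier_mat n n" "\<And>a. a \<in> S \<Longrightarrow> a \<noteq> b \<Longrightarrow> F a = 0\<^sub>m n n"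
  shows "msum n F S = F b"
proof (rule eq_matI)
  fix i j assume "i < dim_row (F b)" "j < dim_col (F b)"
  then have ij: "i < n" "j < n" using assms by auto
  then have "msum n F S $$ (i, j) = (\<Sum>a\<in>S. if a = b then F b $$ (i, j) else 0)"
    unfolding msum_index[OF ij] using assms(4) by (intro sum.cong) auto
  with assms show "msum n F S $$ (i, j) = F b $$ (i, j)" by simp
qed (use assms in auto)

lemma mult_msum:
  assumes "A \<in> carrier_mat n n" "\<And>a. a \<in> S \<Longrightarrow> F a \<in> carrier_mat n n"
  shows "A * msum n F S = msum n (\<lambda>a. A * F a) S"
proof (rule eq_matI)
  fix i j assume "i < dim_row (msum n (\<lambda>a. A * F a) S)" "j < dim_col (msum n (\<lambda>a. A * F a) S)"
  then have ij: "i < n" "j < n" by auto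
  have "(A * msum n F S) $$ (i, j) = (\<Sum>l<n. A $$ (i, l) * (\<Sum>a\<in>S. F a $$ (l, j)))"
    using assms(1) ij by (simp add: scalar_prod_def msum_index atLeast0LessThan)
  also have "\<dots> = (\<Sum>a\<in>S. \<Sum>l<n. A $$ (i, l) * F a $$ (l, j))"
    by (simp add: sum_distrib_left sum.swap[of _ S])
  also have "\<dots> = msum n (\<lambda>a. A * F a) S $$ (i, j)"
    unfolding msum_index[OF ij] using assms ij
    by (intro sum.cong) (auto simp: scalar_prod_def atLeast0LessThan assms(2)[THEN carrier_matD(1)] assms(2)[THEN carrier_matD(2)])
  finally show "(A * msum n F S) $$ (i, j) = msum n (\<lambda>a. A * F a) S $$ (i, j)" .
qed (use assms in auto)

lemma msum_mult:
  assumes "A \<in> carrier_mat n n" "\<And>a. a \<in> S \<Longrightarrow> F a \<in> carrier_mat n n"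
  shows "msum n F S * A = msum n (\<lambda>a. F a * A) S"
proof (rule eq_matI)
  fix i j assume "i < dim_row (msum n (\<lambda>a. F a * A) S)" "j < dim_col (msum n (\<lambda>a. F a * A) S)"
  then have ij: "i < n" "j < n" by auto
  have "(msum n F S * A) $$ (i, j) = (\<Sum>l<n. (\<Sum>a\<in>S. F a $$ (i, l)) * A $$ (l, j))"
    using assms(1) ij by (simp add: scalar_prod_def msum_index atLeast0LessThan)
  also have "\<dots> = (\<Sum>a\<in>S. \<Sum>l<n. F a $$ (i, l) * A $$ (l, j))"
    by (simp add: sum_distrib_right sum.swap[of _ S])
  also have "\<dots> = msum n (\<lambda>a. F a * A) S $$ (i, j)"
    unfolding msum_index[OF ij] using assms ij
    by (intro sum.cong) (auto simp: scalar_prod_def atLeast0LessThan assms(2)[THEN carrier_matD(1)] assms(2)[THEN carrier_matD(2)])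
  finally show "(msum n F S * A) $$ (i, j) = msum n (\<lambda>a. F a * A) S $$ (i, j)" .
qed (use assms in auto)

lemma smult_one_mult [simp]:
  assumes "(A :: complex mat) \<in> carrier_mat n n"
  shows "(c \<cdot>\<^sub>m 1\<^sub>m n) * A = c \<cdot>\<^sub>m A" "A * (c \<cdot>\<^sub>m 1\<^sub>m n) = c \<cdot>\<^sub>m A"
  using assms mult_smult_distrib[of A n n "1\<^sub>m n" n c] mult_smult_assoc_mat[of "1\<^sub>m n" n n A n c] by auto

lemma smult_eq_cancel:
  fixes A :: "complex mat"
  assumes "A \<in> carrier_mat n n" "c \<cdot>\<^sub>m A = d \<cdot>\<^sub>m A" "c \<noteq> d"
  shows "A = 0\<^sub>m n n"
proof (rule eq_matI)
  fix i j assume ij: "i < dim_row (0\<^sub>m n n :: complex mat)" "j < dim_col (0\<^sub>m n n :: complex mat)"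
  have "(c \<cdot>\<^sub>m A) $$ (i, j) = (d \<cdot>\<^sub>m A) $$ (i, j)" using assms by simp
  then have "c * A $$ (i, j) = d * A $$ (i, j)" using ij assms(1) by simp
  then show "A $$ (i, j) = 0\<^sub>m n n $$ (i, j)" using ij assms(3) by simp
qed (use assms in auto)

lemma sq_assoc:
  "A \<in> carrier_mat n n \<Longrightarrow> C \<in> carrier_mat n n \<Longrightarrow> E \<in> carrier_mat n n \<Longrightarrow> A * C * E = A * (C * E)"
  by (rule assoc_mult_mat)

lemma sq_mult_carrier [simp]: "A \<in> carrier_mat n n \<Longrightarrow> C \<in> carrier_mat n n \<Longrightarrow> A * C \<in> carrier_mat n n"
  by (rule mult_carrier_mat)

lemma smult_smult_mat: "a \<cdot>\<^sub>m (b \<cdot>\<^sub>m A) = (a * b) \<cdot>\<^sub>m (A :: complex mat)"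
  by (rule eq_matI) auto

lemma smult_diff_one:
  fixes A :: "complex mat"
  assumes "A \<in> carrier_mat n n" "c \<cdot>\<^sub>m A = c \<cdot>\<^sub>m 1\<^sub>m n" "c \<noteq> 0"
  shows "A = 1\<^sub>m n"
proof -
  have "A = (1 / c) \<cdot>\<^sub>m (c \<cdot>\<^sub>m A)" using assms(1,3) by (intro eq_matI) auto
  also have "\<dots> = 1\<^sub>m n" unfolding assms(2) using assms(3) by (intro eq_matI) auto
  finally show ?thesis .
qed

lemma smult_mult_mat_vec:
  fixes A :: "complex mat"
  assumes "A \<in> carrier_mat n m" "v \<in> carrier_vec m"
  shows "(c \<cdot>\<^sub>m A) *\<^sub>v v = c \<cdot>\<^sub>v (A *\<^sub>v v)"
  by (rule eq_vecI) (use assms in auto)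

section \<open>Representations\<close>

text \<open>A map into square matrices of the stated dimension. Isomorphism of such maps is an equivalence relation whether
  or not they are representations.\<close>

definition square_rep :: "'x set \<Rightarrow> 'x rep \<Rightarrow> bool" where
  "square_rep X \<rho> \<longleftrightarrow> (\<forall>x\<in>X. snd \<rho> x \<in> carrier_mat (fst \<rho>) (fst \<rho>))"

lemma Units_ring_mat:
  "P \<in> Units (ring_mat TYPE(complex) n ()) \<longleftrightarrow>
     P \<in> carrier_mat n n \<and> (\<exists>Q \<in> carrier_mat n n. Q * P = 1\<^sub>m n \<and> P * Q = 1\<^sub>m n)"
  by (auto simp: Units_def ring_mat_def)

lemma rep_iso_refl: "square_rep X \<rho> \<Longrightarrow> rep_iso X \<rho> \<rho>"
  by (auto simp: rep_iso_def square_rep_def Units_ring_mat intro!: bexI[of _ "1\<^sub>m (fst \<rho>)"])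

lemma rep_iso_sym:
  assumes "square_rep X \<rho>" "square_rep X \<sigma>" "rep_iso X \<rho> \<sigma>"
  shows "rep_iso X \<sigma> \<rho>"
proof -
  let ?n = "fst \<rho>"
  from assms(3) obtain P where n: "?n = fst \<sigma>" and PU: "P \<in> Units (ring_mat TYPE(complex) ?n ())"
    and eq: "\<forall>x\<in>X. P * snd \<rho> x = snd \<sigma> x * P"
    unfolding rep_iso_def by blast
  from PU obtain Q where P: "P \<in> carrier_mat ?n ?n" and Q: "Q \<in> carrier_mat ?n ?n"
    and inv: "Q * P = 1\<^sub>m ?n" "P * Q = 1\<^sub>m ?n"
    unfolding Units_ring_mat by blast
  have QU: "Q \<in> Units (ring_mat TYPE(complex) ?n ())" unfolding Units_ring_mat using P Q inv by blast
  have "Q * snd \<sigma> x = snd \<rho> x * Q" if x: "x \<in> X" for x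
  proof -
    have c: "snd \<rho> x \<in> carrier_mat ?n ?n" "snd \<sigma> x \<in> carrier_mat ?n ?n"
      using assms(1,2) x unfolding square_rep_def n by blast+
    have "Q * snd \<sigma> x = Q * (snd \<sigma> x * P) * Q"
      using c P Q inv by (simp add: assoc_mult_mat[of _ ?n ?n _ ?n _ ?n])
    also have "\<dots> = (Q * P) * snd \<rho> x * Q"
      using c P Q by (simp add: bspec[OF eq x, symmetric] assoc_mult_mat[of _ ?n ?n _ ?n _ ?n])
    finally show ?thesis using c inv by simp
  qed
  then show ?thesis using QU n unfolding rep_iso_def by auto
qed

lemma rep_iso_trans:
  assumes "square_rep X \<rho>" "square_rep X \<sigma>" "square_rep X \<tau>" "rep_iso X \<rho> \<sigma>" "rep_iso X \<sigma> \<tau>"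
  shows "rep_iso X \<rho> \<tau>"
proof -
  let ?n = "fst \<rho>"
  have n: "fst \<sigma> = ?n" "fst \<tau> = ?n" using assms(4,5) by (auto simp: rep_iso_def)
  from assms(4,5) n obtain P P' where
    P: "P \<in> Units (ring_mat TYPE(complex) ?n ())" and P': "P' \<in> Units (ring_mat TYPE(complex) ?n ())"
    and eq: "\<And>x. x \<in> X \<Longrightarrow> P * snd \<rho> x = snd \<sigma> x * P" "\<And>x. x \<in> X \<Longrightarrow> P' * snd \<sigma> x = snd \<tau> x * P'"
    unfolding rep_iso_def by metis
  interpret M: ring "ring_mat TYPE(complex) ?n ()" by (rule ring_mat)
  have U: "P' * P \<in> Units (ring_mat TYPE(complex) ?n ())"
    using M.Units_m_closed[OF P' P] by (simp add: ring_mat_def)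
  have c: "P \<in> carrier_mat ?n ?n" "P' \<in> carrier_mat ?n ?n" using P P' by (auto simp: Units_ring_mat)
  have "P' * P * snd \<rho> x = snd \<tau> x * (P' * P)" if x: "x \<in> X" for x
  proof -
    have d: "snd \<rho> x \<in> carrier_mat ?n ?n" "snd \<sigma> x \<in> carrier_mat ?n ?n" "snd \<tau> x \<in> carrier_mat ?n ?n"
      using assms(1-3) x n unfolding square_rep_def by metis+
    have "P' * P * snd \<rho> x = P' * snd \<sigma> x * P"
      using c d by (simp add: eq(1)[OF x] assoc_mult_mat[of _ ?n ?n _ ?n _ ?n])
    then show ?thesis using c d by (simp add: eq(2)[OF x] assoc_mult_mat[of _ ?n ?n _ ?n _ ?n])
  qed
  then show ?thesis using U n unfolding rep_iso_def by metis
qed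

lemma rep_iso_trivial_iff:
  assumes "rep_iso X \<rho> \<sigma>" "x \<in> X" "square_rep X \<rho>" "square_rep X \<sigma>"
  shows "snd \<rho> x = 1\<^sub>m (fst \<rho>) \<longleftrightarrow> snd \<sigma> x = 1\<^sub>m (fst \<sigma>)"
proof -
  have imp: "snd \<sigma> x = 1\<^sub>m (fst \<sigma>)"
    if iso: "rep_iso X \<rho> \<sigma>" and \<sigma>: "square_rep X \<sigma>" and one: "snd \<rho> x = 1\<^sub>m (fst \<rho>)" for \<rho> \<sigma> :: "'a rep"
  proof -
    have n: "fst \<sigma> = fst \<rho>" using iso by (simp add: rep_iso_def)
    obtain P where P: "P \<in> Units (ring_mat TYPE(complex) (fst \<rho>) ())" "P * snd \<rho> x = snd \<sigma> x * P"
      using iso assms(2) unfolding rep_iso_def by blast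
    obtain Q where Q: "P \<in> carrier_mat (fst \<rho>) (fst \<rho>)" "Q \<in> carrier_mat (fst \<rho>) (fst \<rho>)" "P * Q = 1\<^sub>m (fst \<rho>)"
      using P(1) unfolding Units_ring_mat by blast
    have c: "snd \<sigma> x \<in> carrier_mat (fst \<rho>) (fst \<rho>)" using \<sigma> assms(2) n by (simp add: square_rep_def)
    have "snd \<sigma> x = (snd \<sigma> x * P) * Q" using c Q by (simp add: sq_assoc[of _ "fst \<rho>"])
    also have "\<dots> = P * Q" unfolding P(2)[symmetric] one using Q by simp
    finally show ?thesis using Q n by simp
  qed
  show ?thesis
    using imp[OF assms(1,4)] imp[OF rep_iso_sym[OF assms(3,4,1)] assms(3)] by blast
qed

lemma equiv_rep_iso:
  assumes "\<And>\<rho>. \<rho> \<in> S \<Longrightarrow> square_rep X \<rho>"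
  shows "equiv S {(\<rho>, \<sigma>). \<rho> \<in> S \<and> \<sigma> \<in> S \<and> rep_iso X \<rho> \<sigma>}"
proof (rule equivI)
  show "sym {(\<rho>, \<sigma>). \<rho> \<in> S \<and> \<sigma> \<in> S \<and> rep_iso X \<rho> \<sigma>}"
    by (rule symI) (use rep_iso_sym assms in blast)
  show "trans {(\<rho>, \<sigma>). \<rho> \<in> S \<and> \<sigma> \<in> S \<and> rep_iso X \<rho> \<sigma>}"
    by (rule transI) (use rep_iso_trans assms in blast)
qed (auto simp: refl_on_def intro!: rep_iso_refl assms)

text \<open>Both the statement that a subspace is invariant under a matrix and the statement that a fixed
  matrix intertwines two matrices say that a pair of matrices lies in some subalgebra of
  \<open>Mat\<^sub>n \<times> Mat\<^sub>n\<close>. Two families of matrices that generate the same algebras are therefore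
  interchangeable as far as irreducibility and isomorphism are concerned.\<close>

definition subalgebra_rel :: "nat \<Rightarrow> (complex mat \<Rightarrow> complex mat \<Rightarrow> bool) \<Rightarrow> bool" where
  "subalgebra_rel n Q \<longleftrightarrow> Q (1\<^sub>m n) (1\<^sub>m n) \<and>
     (\<forall>A \<in> carrier_mat n n. \<forall>A' \<in> carrier_mat n n. Q A A' \<longrightarrow>
        (\<forall>c. Q (c \<cdot>\<^sub>m A) (c \<cdot>\<^sub>m A')) \<and>
        (\<forall>C \<in> carrier_mat n n. \<forall>C' \<in> carrier_mat n n. Q C C' \<longrightarrow> Q (A + C) (A' + C') \<and> Q (A * C) (A' * C')))"

lemma subalgebra_rel_one: "subalgebra_rel n Q \<Longrightarrow> Q (1\<^sub>m n) (1\<^sub>m n)"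
  and subalgebra_rel_smult: "subalgebra_rel n Q \<Longrightarrow> A \<in> carrier_mat n n \<Longrightarrow> A' \<in> carrier_mat n n \<Longrightarrow>
    Q A A' \<Longrightarrow> Q (c \<cdot>\<^sub>m A) (c \<cdot>\<^sub>m A')"
  and subalgebra_rel_add: "subalgebra_rel n Q \<Longrightarrow> A \<in> carrier_mat n n \<Longrightarrow> A' \<in> carrier_mat n n \<Longrightarrow>
    C \<in> carrier_mat n n \<Longrightarrow> C' \<in> carrier_mat n n \<Longrightarrow> Q A A' \<Longrightarrow> Q C C' \<Longrightarrow> Q (A + C) (A' + C')"
  and subalgebra_rel_mult: "subalgebra_rel n Q \<Longrightarrow> A \<in> carrier_mat n n \<Longrightarrow> A' \<in> carrier_mat n n \<Longrightarrow>
    C \<in> carrier_mat n n \<Longrightarrow> C' \<in> carrier_mat n n \<Longrightarrow> Q A A' \<Longrightarrow> Q C C' \<Longrightarrow> Q (A * C) (A' * C')"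
  unfolding subalgebra_rel_def by blast+

lemma subalgebra_rel_zero:
  assumes "subalgebra_rel n Q"
  shows "Q (0\<^sub>m n n) (0\<^sub>m n n)"
proof -
  have "0 \<cdot>\<^sub>m 1\<^sub>m n = (0\<^sub>m n n :: complex mat)" by (rule eq_matI) auto
  then show ?thesis
    using subalgebra_rel_smult[OF assms, of "1\<^sub>m n" "1\<^sub>m n" 0] subalgebra_rel_one[OF assms] by simp
qed

lemma subalgebra_rel_msum:
  assumes "subalgebra_rel n Q" "finite S"
    and "\<And>a. a \<in> S \<Longrightarrow> F a \<in> carrier_mat n n" "\<And>a. a \<in> S \<Longrightarrow> F' a \<in> carrier_mat n n"
    and "\<And>a. a \<in> S \<Longrightarrow> Q (F a) (F' a)"
  shows "Q (msum n F S) (msum n F' S)"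
  using assms(2-)
proof (induction S rule: finite_induct)
  case (insert a S)
  then show ?case by (simp add: msum_insert subalgebra_rel_add[OF assms(1)])
qed (simp add: subalgebra_rel_zero[OF assms(1)])

lemma subalgebra_rel_intertwiner:
  assumes P: "P \<in> carrier_mat n n"
  shows "subalgebra_rel n (\<lambda>A A'. P * A = A' * P)"
  unfolding subalgebra_rel_def
proof (intro conjI ballI impI allI)
  fix A A' :: "complex mat" assume A: "A \<in> carrier_mat n n" "A' \<in> carrier_mat n n" "P * A = A' * P"
  show "P * (c \<cdot>\<^sub>m A) = c \<cdot>\<^sub>m A' * P" for c
    using A P by (simp add: mult_smult_distrib[of _ n n _ n] mult_smult_assoc_mat[of _ n n _ n])
  fix C C' :: "complex mat" assume C: "C \<in> carrier_mat n n" "C' \<in> carrier_mat n n" "P * C = C' * P"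
  show "P * (A + C) = (A' + C') * P"
    using A C P by (simp add: mult_add_distrib_mat[of _ n n _ n] add_mult_distrib_mat[of _ n n _ _ n])
  have "P * (A * C) = (P * A) * C" using P A(1) C(1) by (rule assoc_mult_mat[symmetric])
  also have "\<dots> = A' * (P * C)" unfolding A(3) using A(2) P C(1) by (rule assoc_mult_mat)
  also have "\<dots> = A' * C' * P" unfolding C(3) using A(2) C(2) P by (rule assoc_mult_mat[symmetric])
  finally show "P * (A * C) = A' * C' * P" .
qed (use P in simp)

lemma subspace_vec_iff:
  "VectorSpace.subspace class_ring W (module_vec TYPE(complex) n) \<longleftrightarrow>
     W \<subseteq> carrier_vec n \<and> 0\<^sub>v n \<in> W \<and> (\<forall>v\<in>W. \<forall>w\<in>W. v + w \<in> W) \<and> (\<forall>c. \<forall>v\<in>W. c \<cdot>\<^sub>v v \<in> W)"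
proof -
  have v: "vectorspace class_ring (module_vec TYPE(complex) n)" by (rule vec_vs)
  have m: "Module.module class_ring (module_vec TYPE(complex) n)" by (rule vec_module)
  show ?thesis
    unfolding VectorSpace.subspace_def submodule_def
    by (simp only: v m module_vec_simps class_ring_simps) blast
qed

lemma subalgebra_rel_invariant:
  assumes W: "VectorSpace.subspace class_ring W (module_vec TYPE(complex) n)"
  shows "subalgebra_rel n (\<lambda>A A'. \<forall>w\<in>W. A *\<^sub>v w \<in> W)"
proof -
  from W have sub: "\<And>w. w \<in> W \<Longrightarrow> w \<in> carrier_vec n" and add: "\<And>v w. v \<in> W \<Longrightarrow> w \<in> W \<Longrightarrow> v + w \<in> W"
    and smult: "\<And>c v. v \<in> W \<Longrightarrow> c \<cdot>\<^sub>v v \<in> W"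
    unfolding subspace_vec_iff by blast+
  show ?thesis
    unfolding subalgebra_rel_def
  proof (intro conjI ballI impI allI)
    fix A C :: "complex mat" and w assume A: "A \<in> carrier_mat n n" "\<forall>w\<in>W. A *\<^sub>v w \<in> W" and w: "w \<in> W"
    show "(c \<cdot>\<^sub>m A) *\<^sub>v w \<in> W" for c
      using A w sub smult by (simp add: smult_mult_mat_vec[of _ n n])
    assume C: "C \<in> carrier_mat n n" "\<forall>w\<in>W. C *\<^sub>v w \<in> W"
    show "(A + C) *\<^sub>v w \<in> W"
      using A C w sub add by (simp add: add_mult_distrib_mat_vec[of _ n n])
    show "A * C *\<^sub>v w \<in> W"
      using A C w sub by (simp add: assoc_mult_mat_vec[of _ n n _ n])
  qed (use sub in simp)
qed

lemma irreducible_rep_transfer: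
  assumes "\<And>Q. subalgebra_rel n Q \<Longrightarrow> (\<forall>x\<in>X. Q (\<rho> x) (\<rho> x)) \<longleftrightarrow> (\<forall>y\<in>Y. Q (\<sigma> y) (\<sigma> y))"
  shows "irreducible_rep X (n, \<rho>) \<longleftrightarrow> irreducible_rep Y (n, \<sigma>)"
proof -
  have "(\<forall>x\<in>X. \<forall>w\<in>W. \<rho> x *\<^sub>v w \<in> W) \<longleftrightarrow> (\<forall>y\<in>Y. \<forall>w\<in>W. \<sigma> y *\<^sub>v w \<in> W)"
    if "VectorSpace.subspace class_ring W (module_vec TYPE(complex) n)" for W
    by (rule assms[OF subalgebra_rel_invariant[OF that]])
  then show ?thesis unfolding irreducible_rep_def fst_conv snd_conv by meson
qed

lemma rep_iso_transfer:
  assumes "\<And>Q. subalgebra_rel n Q \<Longrightarrow> (\<forall>x\<in>X. Q (\<rho> x) (\<rho>' x)) \<longleftrightarrow> (\<forall>y\<in>Y. Q (\<sigma> y) (\<sigma>' y))"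
  shows "rep_iso X (n, \<rho>) (n, \<rho>') \<longleftrightarrow> rep_iso Y (n, \<sigma>) (n, \<sigma>')"
proof -
  have "(\<forall>x\<in>X. P * \<rho> x = \<rho>' x * P) \<longleftrightarrow> (\<forall>y\<in>Y. P * \<sigma> y = \<sigma>' y * P)"
    if "P \<in> Units (ring_mat TYPE(complex) n ())" for P
    by (rule assms[OF subalgebra_rel_intertwiner]) (use that in \<open>simp add: Units_ring_mat\<close>)
  then show ?thesis unfolding rep_iso_def fst_conv snd_conv by meson
qed

text \<open>Schur's lemma: an eigenspace of a matrix commuting with the representation is invariant.\<close>

lemma schur:
  assumes irr: "irreducible_rep X (n, \<rho>)" and \<rho>: "square_rep X (n, \<rho>)"
    and Z: "Z \<in> carrier_mat n n" and comm: "\<And>x. x \<in> X \<Longrightarrow> Z * \<rho> x = \<rho> x * Z"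
  obtains c where "Z = c \<cdot>\<^sub>m 1\<^sub>m n"
proof -
  have n: "n > 0" using irr by (simp add: irreducible_rep_def)
  obtain c v where v: "v \<in> carrier_vec n" "v \<noteq> 0\<^sub>v n" "Z *\<^sub>v v = c \<cdot>\<^sub>v v"
    using spectrum_non_empty[OF Z n] Z unfolding spectrum_def eigenvalue_def eigenvector_def by auto
  define W where "W = {v \<in> carrier_vec n. Z *\<^sub>v v = c \<cdot>\<^sub>v v}"
  have sub: "VectorSpace.subspace class_ring W (module_vec TYPE(complex) n)"
    unfolding subspace_vec_iff
  proof (intro conjI ballI allI)
    show "W \<subseteq> carrier_vec n" by (auto simp: W_def)
    have "Z *\<^sub>v 0\<^sub>v n = c \<cdot>\<^sub>v 0\<^sub>v n" by (rule eq_vecI) (use Z in auto)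
    then show "0\<^sub>v n \<in> W" by (simp add: W_def)
    show "v + w \<in> W" if "v \<in> W" "w \<in> W" for v w
      using that Z by (simp add: W_def mult_add_distrib_mat_vec[of _ n n] smult_add_distrib_vec[of _ n])
    show "d \<cdot>\<^sub>v v \<in> W" if "v \<in> W" for d v
      using that Z by (simp add: W_def mult_mat_vec[of _ n n] smult_smult_assoc mult.commute)
  qed
  have "\<rho> x *\<^sub>v w \<in> W" if "x \<in> X" "w \<in> W" for x w
  proof -
    have x: "\<rho> x \<in> carrier_mat n n" using \<rho> that by (simp add: square_rep_def)
    have w: "w \<in> carrier_vec n" "Z *\<^sub>v w = c \<cdot>\<^sub>v w" using that by (auto simp: W_def)
    have "Z *\<^sub>v (\<rho> x *\<^sub>v w) = \<rho> x *\<^sub>v (Z *\<^sub>v w)"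
      using assoc_mult_mat_vec[OF Z x w(1)] assoc_mult_mat_vec[OF x Z w(1)] comm[OF that(1)] by simp
    then show ?thesis using x w by (simp add: W_def mult_mat_vec[of _ n n])
  qed
  with irr sub have "W = {0\<^sub>v n} \<or> W = carrier_vec n" by (simp add: irreducible_rep_def)
  with v have W: "W = carrier_vec n" by (auto simp: W_def)
  have "Z = c \<cdot>\<^sub>m 1\<^sub>m n"
  proof (rule eq_matI)
    fix i j assume "i < dim_row (c \<cdot>\<^sub>m 1\<^sub>m n)" "j < dim_col (c \<cdot>\<^sub>m 1\<^sub>m n)"
    then have ij: "i < n" "j < n" by auto
    have "unit_vec n j \<in> W" unfolding W by simp
    then have eq: "Z *\<^sub>v unit_vec n j = c \<cdot>\<^sub>v unit_vec n j" unfolding W_def by blast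
    have "Z $$ (i, j) = (Z *\<^sub>v unit_vec n j) $ i" using ij Z by simp
    also have "\<dots> = (c \<cdot>\<^sub>m 1\<^sub>m n) $$ (i, j)" unfolding eq using ij by simp
    finally show "Z $$ (i, j) = (c \<cdot>\<^sub>m 1\<^sub>m n) $$ (i, j)" .
  qed (use Z in auto)
  then show thesis by (rule that)
qed

text \<open>By Schur's lemma all matrices are scalars, so every line is invariant.\<close>

lemma irreducible_rep_commuting_dim:
  assumes irr: "irreducible_rep X (n, \<rho>)" and \<rho>: "square_rep X (n, \<rho>)"
    and comm: "\<And>x y. x \<in> X \<Longrightarrow> y \<in> X \<Longrightarrow> \<rho> x * \<rho> y = \<rho> y * \<rho> x"
  shows "n = 1"
proof -
  have n: "n > 0" using irr by (simp add: irreducible_rep_def)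
  have scalar: "\<exists>c. \<rho> x = c \<cdot>\<^sub>m 1\<^sub>m n" if x: "x \<in> X" for x
    by (rule schur[OF irr \<rho>, of "\<rho> x"]) (use \<rho> comm x in \<open>auto simp: square_rep_def\<close>)
  define W where "W = {c \<cdot>\<^sub>v unit_vec n 0 | c :: complex. True}"
  have sub: "VectorSpace.subspace class_ring W (module_vec TYPE(complex) n)"
    unfolding subspace_vec_iff
  proof (intro conjI ballI allI)
    show "W \<subseteq> carrier_vec n" by (auto simp: W_def)
    show "0\<^sub>v n \<in> W" by (auto simp: W_def intro!: exI[of _ 0])
    show "v + w \<in> W" if "v \<in> W" "w \<in> W" for v w
      using that by (auto simp: W_def add_smult_distrib_vec[symmetric])
    show "c \<cdot>\<^sub>v v \<in> W" if "v \<in> W" for c v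
      using that by (auto simp: W_def smult_smult_assoc)
  qed
  have "\<rho> x *\<^sub>v w \<in> W" if xw: "x \<in> X" "w \<in> W" for x w
  proof -
    obtain c where c: "\<rho> x = c \<cdot>\<^sub>m 1\<^sub>m n" using scalar xw by blast
    obtain d where d: "w = d \<cdot>\<^sub>v unit_vec n 0" using xw by (auto simp: W_def)
    have "\<rho> x *\<^sub>v w = (c * d) \<cdot>\<^sub>v unit_vec n 0"
      by (simp add: c d smult_mult_mat_vec[of _ n n] smult_smult_assoc)
    then show ?thesis by (auto simp: W_def)
  qed
  with irr sub have W: "W = {0\<^sub>v n} \<or> W = carrier_vec n" by (simp add: irreducible_rep_def)
  have u: "unit_vec n 0 \<in> W" by (auto simp: W_def intro!: exI[of _ 1])
  have "(unit_vec n 0 :: complex vec) \<noteq> 0\<^sub>v n" using n by (metis index_unit_vec(1) index_zero_vec(1) zero_neq_one)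
  with W u have W: "W = carrier_vec n" by auto
  show "n = 1"
  proof (rule ccontr)
    assume "n \<noteq> 1"
    with n have 1: "1 < n" by simp
    have "(unit_vec n 1 :: complex vec) \<in> W" unfolding W by simp
    then obtain c :: complex where c: "(unit_vec n 1 :: complex vec) = c \<cdot>\<^sub>v unit_vec n 0" by (auto simp: W_def)
    have "(unit_vec n 1 :: complex vec) $ 1 = (c \<cdot>\<^sub>v unit_vec n 0) $ 1" by (simp only: c)
    with 1 show False by simp
  qed
qed

lemma irreducible_rep_dim_one: "irreducible_rep X (1, \<rho>)"
proof -
  have "W = {0\<^sub>v 1} \<or> W = carrier_vec 1" if W: "VectorSpace.subspace class_ring W (module_vec TYPE(complex) 1)" for W
  proof (cases "W \<subseteq> {0\<^sub>v 1}")
    case False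
    then obtain w where w: "w \<in> W" "w \<noteq> 0\<^sub>v 1" "w \<in> carrier_vec 1"
      using W by (auto simp: subspace_vec_iff)
    have w0: "w $ 0 \<noteq> 0" using w(2,3) by (auto simp: vec_eq_iff)
    have "v \<in> W" if v: "v \<in> carrier_vec 1" for v
    proof -
      have "v = (v $ 0 / w $ 0) \<cdot>\<^sub>v w" using w v w0 by (auto simp: vec_eq_iff)
      then show ?thesis using W w(1) unfolding subspace_vec_iff by metis
    qed
    then show ?thesis using W by (auto simp: subspace_vec_iff)
  qed (use W in \<open>auto simp: subspace_vec_iff\<close>)
  then show ?thesis by (simp add: irreducible_rep_def)
qed

section \<open>Representations of groups\<close>

lemma group_repI:
  assumes \<rho>: "\<And>x. x \<in> carrier \<Gamma> \<Longrightarrow> \<rho> x \<in> carrier_mat n n" and one: "\<rho> \<one>\<^bsub>\<Gamma>\<^esub> = 1\<^sub>m n"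
    and mult: "\<And>x y. x \<in> carrier \<Gamma> \<Longrightarrow> y \<in> carrier \<Gamma> \<Longrightarrow> \<rho> (x \<otimes>\<^bsub>\<Gamma>\<^esub> y) = \<rho> x * \<rho> y"
    and inv: "\<And>x. x \<in> carrier \<Gamma> \<Longrightarrow> \<exists>y\<in>carrier \<Gamma>. y \<otimes>\<^bsub>\<Gamma>\<^esub> x = \<one>\<^bsub>\<Gamma>\<^esub> \<and> x \<otimes>\<^bsub>\<Gamma>\<^esub> y = \<one>\<^bsub>\<Gamma>\<^esub>"
  shows "group_rep \<Gamma> (n, \<rho>)"
proof -
  have "\<rho> x \<in> Units (ring_mat TYPE(complex) n ())" if x: "x \<in> carrier \<Gamma>" for x
    using inv[OF x] \<rho> one mult x unfolding Units_ring_mat by metis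
  then show ?thesis
    by (auto simp: group_rep_def hom_def units_of_def mult ring_mat_def)
qed

lemma group_rep_square: "group_rep \<Gamma> \<rho> \<Longrightarrow> square_rep (carrier \<Gamma>) \<rho>"
  by (auto simp: group_rep_def square_rep_def hom_def units_of_def Units_ring_mat)

lemma group_rep_mult:
  "group_rep \<Gamma> \<rho> \<Longrightarrow> x \<in> carrier \<Gamma> \<Longrightarrow> y \<in> carrier \<Gamma> \<Longrightarrow> snd \<rho> (x \<otimes>\<^bsub>\<Gamma>\<^esub> y) = snd \<rho> x * snd \<rho> y"
  by (auto simp: group_rep_def hom_def units_of_def ring_mat_def)

lemma group_rep_one:
  assumes \<rho>: "group_rep \<Gamma> \<rho>" and one: "\<one>\<^bsub>\<Gamma>\<^esub> \<in> carrier \<Gamma>" "\<one>\<^bsub>\<Gamma>\<^esub> \<otimes>\<^bsub>\<Gamma>\<^esub> \<one>\<^bsub>\<Gamma>\<^esub> = \<one>\<^bsub>\<Gamma>\<^esub>"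
  shows "snd \<rho> \<one>\<^bsub>\<Gamma>\<^esub> = 1\<^sub>m (fst \<rho>)"
proof -
  let ?n = "fst \<rho>" and ?A = "snd \<rho> \<one>\<^bsub>\<Gamma>\<^esub>"
  have A: "?A * ?A = ?A" using group_rep_mult[OF \<rho> one(1) one(1)] one(2) by simp
  have "?A \<in> Units (ring_mat TYPE(complex) ?n ())"
    using \<rho> one(1) by (auto simp: group_rep_def hom_def units_of_def)
  then obtain C where C: "?A \<in> carrier_mat ?n ?n" "C \<in> carrier_mat ?n ?n" "C * ?A = 1\<^sub>m ?n"
    unfolding Units_ring_mat by blast
  have "?A = (C * ?A) * ?A" using C by simp
  also have "\<dots> = C * (?A * ?A)" using C(2,1,1) by (rule assoc_mult_mat)
  finally show ?thesis using A C by simp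
qed

definition group_irreps where
  "group_irreps \<Delta> = {\<psi>. group_rep \<Delta> \<psi> \<and> irreducible_rep (carrier \<Delta>) \<psi>}"

definition iso_rel where
  "iso_rel Z S = {(\<rho>, \<sigma>). \<rho> \<in> S \<and> \<sigma> \<in> S \<and> rep_iso Z \<rho> \<sigma>}"

lemma equiv_group: "equiv (group_irreps \<Delta>) (iso_rel (carrier \<Delta>) (group_irreps \<Delta>))"
  unfolding iso_rel_def by (rule equiv_rep_iso) (simp add: group_irreps_def group_rep_square)

lemma Irr_group_eq: "Irr_group \<Delta> = group_irreps \<Delta> // iso_rel (carrier \<Delta>) (group_irreps \<Delta>)"
  by (simp add: Irr_group_def iso_classes_def group_irreps_def iso_rel_def)

lemma group_irrep_dim_one:
  assumes \<Delta>: "comm_group \<Delta>" and \<psi>: "\<psi> \<in> group_irreps \<Delta>"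
  shows "fst \<psi> = 1"
proof -
  have rep: "group_rep \<Delta> \<psi>" using \<psi> by (simp add: group_irreps_def)
  have "irreducible_rep (carrier \<Delta>) (fst \<psi>, snd \<psi>)" "square_rep (carrier \<Delta>) (fst \<psi>, snd \<psi>)"
    using \<psi> group_rep_square[OF rep] by (simp_all add: group_irreps_def)
  then show ?thesis
  proof (rule irreducible_rep_commuting_dim)
    fix x y assume xy: "x \<in> carrier \<Delta>" "y \<in> carrier \<Delta>"
    have "x \<otimes>\<^bsub>\<Delta>\<^esub> y = y \<otimes>\<^bsub>\<Delta>\<^esub> x"
      by (rule comm_monoid.m_comm[OF comm_group.axioms(1)[OF \<Delta>] xy])
    then show "snd \<psi> x * snd \<psi> y = snd \<psi> y * snd \<psi> x"
      using group_rep_mult[OF rep xy] group_rep_mult[OF rep xy(2,1)] by simp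
  qed
qed

text \<open>Translation by \<open>g\<close> permutes the summands. For a nontrivial scalar \<open>D g\<close> the sum therefore vanishes.\<close>

lemma msum_translate:
  assumes G: "group G" and K: "subgroup K G" and g: "g \<in> K"
    and D: "\<And>x. x \<in> K \<Longrightarrow> D x \<in> carrier_mat n n"
    and mult: "\<And>x. x \<in> K \<Longrightarrow> D (g \<otimes>\<^bsub>G\<^esub> x) = D g * D x"
  shows "D g * msum n D K = msum n D K"
proof -
  interpret G: group G by (rule G)
  have bij: "bij_betw (\<lambda>x. g \<otimes>\<^bsub>G\<^esub> x) K K"
  proof (rule bij_betwI[of _ _ _ "\<lambda>x. inv\<^bsub>G\<^esub> g \<otimes>\<^bsub>G\<^esub> x"])
    fix x assume x: "x \<in> K"
    have c: "x \<in> carrier G" "g \<in> carrier G" using K g x by (auto dest: subgroup.mem_carrier)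
    then show "inv\<^bsub>G\<^esub> g \<otimes>\<^bsub>G\<^esub> (g \<otimes>\<^bsub>G\<^esub> x) = x" "g \<otimes>\<^bsub>G\<^esub> (inv\<^bsub>G\<^esub> g \<otimes>\<^bsub>G\<^esub> x) = x"
      by (simp_all add: G.m_assoc[symmetric])
  qed (use K g in \<open>auto intro: subgroup.m_closed subgroup.m_inv_closed\<close>)
  have "D g * msum n D K = msum n (\<lambda>x. D g * D x) K" using D g by (simp add: mult_msum)
  also have "\<dots> = msum n (\<lambda>x. D (g \<otimes>\<^bsub>G\<^esub> x)) K" by (rule msum_cong) (simp_all add: mult)
  finally show ?thesis using msum_reindex[OF bij] by metis
qed

text \<open>The summands of a decomposition have positive dimension, so a one-dimensional sum has exactly one summand.\<close>

lemma sum_of_nontrivial_dim_one: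
  assumes \<psi>: "group_rep (G\<lparr>carrier := H\<rparr>) (1, \<psi>)"
  shows "sum_of_nontrivial G H (1, \<psi>) \<longleftrightarrow> (\<exists>h\<in>H. \<psi> h \<noteq> 1\<^sub>m 1)"
proof
  have sq: "square_rep H (1, \<psi>)" using group_rep_square[OF \<psi>] by simp
  have triv: "square_rep H trivial_rep" by (simp add: square_rep_def trivial_rep_def)
  {
    assume "\<exists>h\<in>H. \<psi> h \<noteq> 1\<^sub>m 1"
    then obtain h where h: "h \<in> H" "\<psi> h \<noteq> 1\<^sub>m 1" by blast
    have "\<not> rep_iso H (1, \<psi>) trivial_rep"
    proof
      assume "rep_iso H (1, \<psi>) trivial_rep"
      then obtain P Q where P: "P \<in> carrier_mat 1 1" "Q \<in> carrier_mat 1 1" "Q * P = 1\<^sub>m 1"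
        "P * \<psi> h = 1\<^sub>m 1 * P"
        using h by (auto simp: rep_iso_def Units_ring_mat trivial_rep_def)
      have \<psi>h: "\<psi> h \<in> carrier_mat 1 1" using sq h by (simp add: square_rep_def)
      have "\<psi> h = Q * (P * \<psi> h)" using P \<psi>h by (metis assoc_mult_mat left_mult_one_mat)
      also have "\<dots> = 1\<^sub>m 1" unfolding P(4) using P by simp
      finally show False using h by simp
    qed
    moreover have "rep_sum [(1, \<psi>)] = (1, \<psi>)"
      by (simp add: rep_sum_def del: diag_block_mat.simps)
    ultimately show "sum_of_nontrivial G H (1, \<psi>)"
      unfolding sum_of_nontrivial_def
      using \<psi> irreducible_rep_dim_one[of H \<psi>] rep_iso_refl[OF sq]
      by (intro exI[of _ "[(1, \<psi>)]"]) (simp only: list.set ball_simps insert_iff empty_iff, simp)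
  }
  assume "sum_of_nontrivial G H (1, \<psi>)"
  then obtain \<rho>s where \<rho>s: "\<And>\<rho>. \<rho> \<in> set \<rho>s \<Longrightarrow> group_rep (G\<lparr>carrier := H\<rparr>) \<rho> \<and> irreducible_rep H \<rho> \<and>
                          \<not> rep_iso H \<rho> trivial_rep" and iso: "rep_iso H (1, \<psi>) (rep_sum \<rho>s)"
    unfolding sum_of_nontrivial_def by blast
  have sum: "sum_list (map fst \<rho>s) = 1" using iso by (simp add: rep_iso_def rep_sum_def)
  obtain \<rho> \<rho>s' where \<rho>: "\<rho>s = \<rho> # \<rho>s'" using sum by (cases \<rho>s) auto
  have nz: "fst \<sigma> \<noteq> 0" if "\<sigma> \<in> set \<rho>s" for \<sigma> using \<rho>s[OF that] unfolding irreducible_rep_def by blast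
  have "\<rho>s' = []"
  proof (cases \<rho>s')
    case (Cons \<sigma> \<rho>s'')
    then show ?thesis using sum nz[of \<rho>] nz[of \<sigma>] unfolding \<rho> by auto
  qed
  then have "rep_sum \<rho>s = \<rho>" unfolding \<rho> rep_sum_def
    by (simp del: diag_block_mat.simps)
  with iso have iso: "rep_iso H (1, \<psi>) \<rho>" by simp
  have sq': "square_rep H \<rho>" using \<rho>s[of \<rho>] group_rep_square[of "G\<lparr>carrier := H\<rparr>" \<rho>] \<rho> by auto
  show "\<exists>h\<in>H. \<psi> h \<noteq> 1\<^sub>m 1"
  proof (rule ccontr)
    assume "\<not> ?thesis"
    then have "rep_iso H (1, \<psi>) trivial_rep"
      by (auto simp: rep_iso_def trivial_rep_def Units_ring_mat intro!: bexI[of _ "1\<^sub>m 1"])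
    then have "rep_iso H \<rho> trivial_rep"
      using rep_iso_sym[OF sq sq' iso] rep_iso_trans[OF sq' sq triv] by blast
    then show False using \<rho>s[of \<rho>] \<rho> by simp
  qed
qed

section \<open>The trace of a fusion ring\<close>

context fusion_ring
begin

lemma basis_closed [simp]: "b \<in> B \<Longrightarrow> b \<in> carrier R"
  using basis_subset by blast

lemma zcoord_inject:
  assumes "r \<in> carrier R" "s \<in> carrier R" "\<And>b. b \<in> B \<Longrightarrow> zcoord R B r b = zcoord R B s b"
  shows "r = s"
proof -
  have "zcoord R B r = zcoord R B s"
    using assms zcoord_outside by (metis ext)
  then show ?thesis using zcoord_expand[OF assms(1)] zcoord_expand[OF assms(2)] by metis
qed

text \<open>The coefficient at \<open>\<one>\<close> is a trace on \<open>R\<close>, and \<open>(r, s) \<mapsto> zcoord (r s\<^sup>*) \<one>\<close> is the inner product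
  for which \<open>B\<close> is orthonormal.\<close>

lemma trace_mult:
  assumes r: "r \<in> carrier R" and s: "s \<in> carrier R"
  shows "zcoord R B (r \<otimes> s) \<one> = (\<Sum>b\<in>B. zcoord R B r b * zcoord R B s (star b))"
proof -
  have "zcoord R B (r \<otimes> s) \<one> =
      (\<Sum>x\<in>B. \<Sum>y\<in>B. if y = star x then zcoord R B r x * zcoord R B s y else 0)"
    unfolding zcoord_mult[OF r s]
  proof (intro sum.cong refl)
    fix x y assume xy: "x \<in> B" "y \<in> B"
    then have "(x = star y) = (y = star x)" using star_star by metis
    then show "zcoord R B r x * zcoord R B s y * zcoord R B (x \<otimes> y) \<one> =
        (if y = star x then zcoord R B r x * zcoord R B s y else 0)"
      using structure_one[OF xy] by simp
  qed
  then show ?thesis using finite_basis star_closed by simp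
qed

lemma star_bij: "bij_betw star B B"
  by (rule bij_betwI[of _ _ _ star]) (use star_closed star_star in auto)

lemma trace_comm:
  assumes r: "r \<in> carrier R" and s: "s \<in> carrier R"
  shows "zcoord R B (r \<otimes> s) \<one> = zcoord R B (s \<otimes> r) \<one>"
proof -
  have "zcoord R B (s \<otimes> r) \<one> = (\<Sum>b\<in>B. zcoord R B s (star b) * zcoord R B r (star (star b)))"
    unfolding trace_mult[OF s r] by (rule sum.reindex_bij_betw[OF star_bij, symmetric])
  also have "\<dots> = zcoord R B (r \<otimes> s) \<one>"
    unfolding trace_mult[OF r s] by (rule sum.cong) (simp_all add: star_star mult.commute)
  finally show ?thesis by simp
qed

lemma star_lin_closed: "star_lin R B star r \<in> carrier R"
  unfolding star_lin_def by (rule finsum_closed) (use star_closed in auto)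

lemma zcoord_star_lin:
  assumes r: "r \<in> carrier R" and b: "b \<in> B"
  shows "zcoord R B (star_lin R B star r) (star b) = zcoord R B r b"
proof -
  have "zcoord R B (star_lin R B star r) (star b) =
      (\<Sum>x\<in>B. zcoord R B (add_pow R (zcoord R B r x) (star x)) (star b))"
    unfolding star_lin_def by (rule zcoord_finsum) (use finite_basis star_closed in auto)
  also have "\<dots> = (\<Sum>x\<in>B. if x = b then zcoord R B r x else 0)"
  proof (rule sum.cong[OF refl])
    fix x assume x: "x \<in> B"
    have "(star b = star x) = (x = b)" using x b star_star by metis
    then show "zcoord R B (add_pow R (zcoord R B r x) (star x)) (star b) = (if x = b then zcoord R B r x else 0)"
      using x star_closed by (simp add: zcoord_add_pow zcoord_basis)
  qed
  finally show ?thesis using b finite_basis by simp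
qed

lemma star_lin_basis: "b \<in> B \<Longrightarrow> star_lin R B star b = star b"
proof (rule zcoord_inject)
  fix c assume b: "b \<in> B" and c: "c \<in> B"
  have "zcoord R B (star_lin R B star b) (star (star c)) = zcoord R B b (star c)"
    using b c star_closed by (intro zcoord_star_lin) auto
  then show "zcoord R B (star_lin R B star b) c = zcoord R B (star b) c"
    using b c star_closed star_star by (auto simp: zcoord_basis)
qed (use star_lin_closed star_closed in auto)

lemma trace_norm:
  "r \<in> carrier R \<Longrightarrow> zcoord R B (r \<otimes> star_lin R B star r) \<one> = (\<Sum>b\<in>B. (zcoord R B r b)\<^sup>2)"
  by (simp add: trace_mult star_lin_closed zcoord_star_lin power2_eq_square)

text \<open>The squared norm is the sum of the squares of the integer coordinates, so norm one leaves a single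
  coordinate, and that one is \<open>1\<close> rather than \<open>-1\<close> by nonnegativity.\<close>

lemma norm_one_basis:
  assumes r: "r \<in> carrier R" and nonneg: "\<And>b. b \<in> B \<Longrightarrow> zcoord R B r b \<ge> 0"
    and norm: "zcoord R B (r \<otimes> star_lin R B star r) \<one> = 1"
  shows "r \<in> B"
proof -
  have sum: "(\<Sum>b\<in>B. (zcoord R B r b)\<^sup>2) = 1" using norm trace_norm[OF r] by simp
  then obtain b where b: "b \<in> B" "zcoord R B r b \<noteq> 0"
    by (metis (no_types, lifting) sum.neutral zero_neq_one zero_power2)
  have split: "(zcoord R B r b)\<^sup>2 + (\<Sum>c\<in>B - {b}. (zcoord R B r c)\<^sup>2) = 1"
    using sum.remove[OF finite_basis b(1), of "\<lambda>b. (zcoord R B r b)\<^sup>2"] sum by simp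
  have pos: "(\<Sum>c\<in>B - {b}. (zcoord R B r c)\<^sup>2) \<ge> 0" by (rule sum_nonneg) simp
  have "(zcoord R B r b)\<^sup>2 \<ge> 1" using b(2) by (smt (verit) zero_less_power2)
  with split pos have 0: "(\<Sum>c\<in>B - {b}. (zcoord R B r c)\<^sup>2) = 0" and 1: "(zcoord R B r b)\<^sup>2 = 1" by linarith+
  have z: "zcoord R B r c = 0" if "c \<in> B" "c \<noteq> b" for c
    using 0 that finite_basis by (simp add: sum_nonneg_eq_0_iff)
  have "zcoord R B r b = 1" using 1 nonneg[OF b(1)] by (simp add: power2_eq_1_iff)
  then have "r = b" using z b(1) r by (intro zcoord_inject) (auto simp: zcoord_basis)
  then show ?thesis using b by simp
qed

lemma inv_basisD:
  assumes "g \<in> inv_basis R B star"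
  shows "g \<in> B" "g \<in> carrier R" "star g \<in> carrier R" "g \<otimes> star g = \<one>" "star g \<otimes> g = \<one>" "star g \<in> inv_basis R B star"
  using assms star_closed star_star unfolding inv_basis_def by auto

text \<open>Multiplication by an invertible \<open>g\<close> preserves the norm: \<open>(g x)(g x)\<^sup>* = g x x\<^sup>* g\<^sup>*\<close> has the same trace as
  \<open>x x\<^sup>* g\<^sup>* g = x x\<^sup>*\<close>. Hence \<open>G\<close> acts on \<open>B\<close> by left multiplication.\<close>

lemma inv_basis_mult:
  assumes g: "g \<in> inv_basis R B star" and x: "x \<in> B"
  shows "g \<otimes> x \<in> B"
proof (rule norm_one_basis)
  note gD = inv_basisD[OF g]
  have c: "x \<in> carrier R" "star x \<in> carrier R" using x star_closed by auto
  show "g \<otimes> x \<in> carrier R" using gD c by simp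
  show "zcoord R B (g \<otimes> x) b \<ge> 0" if "b \<in> B" for b
    using structure_nonneg gD x that by simp
  have "(g \<otimes> x) \<otimes> star_lin R B star (g \<otimes> x) = g \<otimes> (x \<otimes> star x \<otimes> star g)"
    using star_anti[of g x] gD c x by (simp add: star_lin_basis m_assoc)
  moreover have "zcoord R B (g \<otimes> (x \<otimes> star x \<otimes> star g)) \<one> = zcoord R B ((x \<otimes> star x \<otimes> star g) \<otimes> g) \<one>"
    using gD c by (intro trace_comm) auto
  moreover have "(x \<otimes> star x \<otimes> star g) \<otimes> g = x \<otimes> star x"
    using gD c by (simp add: m_assoc)
  ultimately show "zcoord R B ((g \<otimes> x) \<otimes> star_lin R B star (g \<otimes> x)) \<one> = 1"
    using structure_one[OF x star_closed[OF x]] star_star[OF x] by simp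
qed

end

section \<open>Two orbits with self-dual non-invertible elements\<close>

locale self_dual_uniform_fusion_ring = fusion_ring +
  assumes two_orbits: "card (basis_orbits R B star) = 2"
    and comm_inv_group: "comm_group (inv_group R B star)"
    and uniform: "uniform R B star"
    and self_dual: "x \<in> noninv_basis R B star \<Longrightarrow> star x = x"
begin

abbreviation G where "G \<equiv> inv_group R B star"
abbreviation H where "H \<equiv> stab_group R B star"
abbreviation X where "X \<equiv> noninv_basis R B star"

sublocale G: comm_group G
  by (rule comm_inv_group)

lemma G_mult [simp]: "g \<otimes>\<^bsub>G\<^esub> h = g \<otimes> h"
  and G_one [simp]: "\<one>\<^bsub>G\<^esub> = \<one>"
  and carrier_G: "carrier G = inv_basis R B star"
  by (simp_all add: inv_group_def)

lemma basis_split: "B = carrier G \<union> X" "carrier G \<inter> X = {}"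
  by (auto simp: carrier_G inv_basis_def noninv_basis_def)

lemma X_not_G: "x \<in> X \<Longrightarrow> x \<notin> carrier G"
  by (auto simp: carrier_G noninv_basis_def)

lemma basis_cases: "b \<in> B \<Longrightarrow> b \<in> carrier G \<or> b \<in> X"
  by (auto simp: carrier_G noninv_basis_def)

lemma G_basis [simp]: "g \<in> carrier G \<Longrightarrow> g \<in> B"
  and X_basis [simp]: "x \<in> X \<Longrightarrow> x \<in> B"
  using basis_split by auto

lemma G_mult_closed [simp]: "g \<in> carrier G \<Longrightarrow> h \<in> carrier G \<Longrightarrow> g \<otimes> h \<in> carrier G"
  using G.m_closed by simp

lemma G_one_closed [simp]: "\<one> \<in> carrier G"
  using G.one_closed by simp

lemma G_comm: "g \<in> carrier G \<Longrightarrow> h \<in> carrier G \<Longrightarrow> g \<otimes> h = h \<otimes> g"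
  using G.m_comm by simp

lemma finite_G: "finite (carrier G)" and finite_X: "finite X"
  using finite_basis basis_split by (auto intro: finite_subset)

lemma G_inv: "g \<in> carrier G \<Longrightarrow> inv\<^bsub>G\<^esub> g = star g"
  using inv_basisD[of g] by (intro G.inv_equality) (auto simp: carrier_G)

lemma G_inv_mult [simp]:
  assumes "g \<in> carrier G"
  shows "inv\<^bsub>G\<^esub> g \<otimes> g = \<one>" "g \<otimes> inv\<^bsub>G\<^esub> g = \<one>"
  using G.l_inv[OF assms] G.r_inv[OF assms] by simp_all

lemma G_inv_cancel:
  assumes "g \<in> carrier G" "x \<in> carrier R"
  shows "inv\<^bsub>G\<^esub> g \<otimes> (g \<otimes> x) = x" "g \<otimes> (inv\<^bsub>G\<^esub> g \<otimes> x) = x"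
  using assms by (simp_all add: m_assoc[symmetric])

lemma act_X:
  assumes g: "g \<in> carrier G" and x: "x \<in> X"
  shows "g \<otimes> x \<in> X"
proof (rule ccontr)
  assume "g \<otimes> x \<notin> X"
  then have "g \<otimes> x \<in> carrier G"
    using inv_basis_mult[of g x] g x basis_split by (auto simp: carrier_G)
  then have "inv\<^bsub>G\<^esub> g \<otimes> (g \<otimes> x) \<in> carrier G" using g by simp
  then show False using g x basis_split by (auto simp: G_inv_cancel)
qed

text \<open>Self-duality of \<open>g\<^sup>-\<^sup>1 x\<close> says that \<open>x\<close> conjugates \<open>G\<close> by inversion.\<close>

lemma X_mult_G:
  assumes g: "g \<in> carrier G" and x: "x \<in> X"
  shows "x \<otimes> g = inv\<^bsub>G\<^esub> g \<otimes> x"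
proof -
  have i: "inv\<^bsub>G\<^esub> g \<in> carrier G" using g by simp
  have y: "inv\<^bsub>G\<^esub> g \<otimes> x \<in> X" using act_X[OF i x] .
  have "inv\<^bsub>G\<^esub> g \<otimes> x = star_lin R B star (inv\<^bsub>G\<^esub> g \<otimes> x)"
    using y self_dual by (simp add: star_lin_basis)
  also have "\<dots> = star_lin R B star x \<otimes> star_lin R B star (inv\<^bsub>G\<^esub> g)"
    using i x by (intro star_anti) auto
  also have "\<dots> = x \<otimes> g"
    using g i x self_dual G_inv[OF i] by (simp add: star_lin_basis)
  finally show ?thesis by simp
qed

lemma orbit_eq: "x \<in> B \<Longrightarrow> orbit G (left_action R B) x = {g \<otimes> x | g. g \<in> carrier G}"
  by (auto simp: orbit_def left_action_def)

lemma X_nonempty: "X \<noteq> {}"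
proof
  assume "X = {}"
  then have B: "B = carrier G" using basis_split by simp
  have "orbit G (left_action R B) x = carrier G" if x: "x \<in> B" for x
  proof -
    have xG: "x \<in> carrier G" using x B by simp
    have "y \<in> {g \<otimes> x | g. g \<in> carrier G}" if y: "y \<in> carrier G" for y
    proof -
      have "y = (y \<otimes> inv\<^bsub>G\<^esub> x) \<otimes> x" using xG y by (simp add: m_assoc)
      then show ?thesis using xG y by (intro CollectI exI[of _ "y \<otimes> inv\<^bsub>G\<^esub> x"]) simp
    qed
    then show ?thesis using xG unfolding orbit_eq[OF x] by auto
  qed
  then have "basis_orbits R B star \<subseteq> {carrier G}" by (auto simp: basis_orbits_def orbits_def)
  then have "card (basis_orbits R B star) \<le> card {carrier G}" by (rule card_mono[rotated]) simp
  then show False using two_orbits by simp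
qed

text \<open>One of the two orbits is \<open>G\<close> itself, the orbit of \<open>\<one>\<close>, and no element of \<open>X\<close> lies on it.\<close>

lemma X_transitive:
  assumes x: "x \<in> X" and y: "y \<in> X"
  obtains g where "g \<in> carrier G" "y = g \<otimes> x"
proof -
  let ?O = "orbit G (left_action R B)"
  have self: "z \<in> ?O z" if "z \<in> B" for z
    unfolding orbit_eq[OF that] using that by (intro CollectI exI[of _ \<one>]) simp
  have ne: "?O z \<noteq> ?O \<one>" if "z \<in> X" for z
  proof
    assume eq: "?O z = ?O \<one>"
    have "\<one> \<in> ?O z" unfolding eq by (rule self[OF one_in_basis])
    then have "\<one> \<in> {g \<otimes> z | g. g \<in> carrier G}"
      unfolding orbit_eq[OF X_basis[OF that]] .
    then obtain g where "g \<in> carrier G" "\<one> = g \<otimes> z" by blast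
    then have "\<one> \<in> X" using act_X[OF _ that] by metis
    then show False using X_not_G G_one_closed by metis
  qed
  have in_orb: "?O z \<in> basis_orbits R B star" if "z \<in> B" for z
    unfolding basis_orbits_def orbits_def using that by blast
  obtain P P' where P: "basis_orbits R B star = {P, P'}" using two_orbits by (auto simp: card_2_iff)
  have "?O x \<in> {P, P'}" "?O y \<in> {P, P'}" "?O \<one> \<in> {P, P'}"
    using in_orb[of x] in_orb[of y] in_orb[OF one_in_basis] x y unfolding P by simp_all
  then have "?O x = ?O y" using ne[OF x] ne[OF y] by (metis empty_iff insert_iff)
  then have "y \<in> ?O x" using self[of y] y by simp
  then show thesis using that x by (auto simp: orbit_eq)
qed

lemma stabilizer_eq:
  assumes x: "x \<in> X" and y: "y \<in> X" and g: "g \<in> carrier G" and gx: "g \<otimes> x = x"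
  shows "g \<otimes> y = y"
proof -
  obtain k where k: "k \<in> carrier G" "y = k \<otimes> x" using X_transitive[OF x y] .
  have "g \<otimes> y = k \<otimes> (g \<otimes> x)"
    using k g x by (simp add: m_assoc[symmetric] G_comm)
  then show ?thesis using gx k by simp
qed

text \<open>The elements of one orbit of an abelian group have the same stabilizer, so the description defining \<open>H\<close>
  is satisfied by the stabilizer of any \<open>x \<in> X\<close>.\<close>

lemma stab_group_eq: "x \<in> X \<Longrightarrow> H = {g \<in> carrier G. g \<otimes> x = x}"
proof -
  assume x: "x \<in> X"
  have st: "stabilizer G (left_action R B) y = {g \<in> carrier G. g \<otimes> x = x}" if "y \<in> X" for y
    using that x stabilizer_eq[OF x that] stabilizer_eq[OF that x]
    by (auto simp: stabilizer_def left_action_def)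
  show ?thesis unfolding stab_group_def
    by (rule the_equality) (use st x in auto)
qed

lemma H_fix: "h \<in> H \<Longrightarrow> x \<in> X \<Longrightarrow> h \<otimes> x = x"
  and H_G: "h \<in> H \<Longrightarrow> h \<in> carrier G"
  using stab_group_eq X_nonempty by auto

lemma H_subset: "H \<subseteq> carrier G"
  using H_G by blast

lemma H_iff: "x \<in> X \<Longrightarrow> h \<in> H \<longleftrightarrow> h \<in> carrier G \<and> h \<otimes> x = x"
  using stab_group_eq by blast

lemma finite_H: "finite H"
  using finite_subset[OF H_subset finite_G] .

lemma H_subgroup: "subgroup H G"
proof -
  obtain x where x: "x \<in> X" using X_nonempty by blast
  show ?thesis
  proof (rule G.subgroupI)
    show "H \<noteq> {}" using H_iff[OF x, of \<one>] x by auto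
    show "inv\<^bsub>G\<^esub> h \<in> H" if "h \<in> H" for h
      using that x G_inv_cancel(1)[of h x] by (simp add: H_iff[OF x])
    show "g \<otimes>\<^bsub>G\<^esub> h \<in> H" if "g \<in> H" "h \<in> H" for g h
      using that x by (simp add: H_iff[OF x] m_assoc)
  qed (rule H_subset)
qed

lemma H_normal: "H \<lhd> G"
  by (rule G.subgroup_imp_normal[OF H_subgroup])

definition x\<^sub>0 where "x\<^sub>0 = (SOME x. x \<in> X)"

lemma x0_X [simp]: "x\<^sub>0 \<in> X"
  unfolding x\<^sub>0_def using X_nonempty by (simp add: some_in_eq)

lemma X_eq: "X = (\<lambda>g. g \<otimes> x\<^sub>0) ` carrier G"
  using X_transitive[OF x0_X] act_X[OF _ x0_X] by blast

lemma X_cases: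
  assumes "y \<in> X" obtains g where "g \<in> carrier G" "y = g \<otimes> x\<^sub>0"
  using assms X_eq by auto

lemma act_x0_eq_iff:
  assumes g: "g \<in> carrier G" and g': "g' \<in> carrier G"
  shows "g \<otimes> x\<^sub>0 = g' \<otimes> x\<^sub>0 \<longleftrightarrow> inv\<^bsub>G\<^esub> g' \<otimes> g \<in> H"
proof -
  have "inv\<^bsub>G\<^esub> g' \<otimes> g \<in> H \<longleftrightarrow> inv\<^bsub>G\<^esub> g' \<otimes> (g \<otimes> x\<^sub>0) = x\<^sub>0"
    using g g' by (simp add: H_iff[OF x0_X] m_assoc)
  also have "\<dots> \<longleftrightarrow> g \<otimes> x\<^sub>0 = g' \<otimes> x\<^sub>0"
    using g g' G_inv_cancel by (metis X_basis basis_closed G_basis m_closed x0_X)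
  finally show ?thesis by simp
qed

text \<open>The fibre of \<open>g \<mapsto> g x\<^sub>0\<close> over \<open>k x\<^sub>0\<close> is the coset \<open>k H\<close>.\<close>

lemma card_fibre:
  assumes y: "y \<in> X"
  shows "card {g \<in> carrier G. g \<otimes> x\<^sub>0 = y} = card H"
proof -
  obtain k where k: "k \<in> carrier G" "y = k \<otimes> x\<^sub>0" using X_cases[OF y] .
  have "bij_betw (\<lambda>h. k \<otimes> h) H {g \<in> carrier G. g \<otimes> x\<^sub>0 = y}"
  proof (rule bij_betwI[of _ _ _ "\<lambda>g. inv\<^bsub>G\<^esub> k \<otimes> g"])
    show "(\<lambda>h. k \<otimes> h) \<in> H \<rightarrow> {g \<in> carrier G. g \<otimes> x\<^sub>0 = y}"
      using k by (auto simp: m_assoc H_fix H_G)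
    show "(\<lambda>g. inv\<^bsub>G\<^esub> k \<otimes> g) \<in> {g \<in> carrier G. g \<otimes> x\<^sub>0 = y} \<rightarrow> H"
      using k by (auto simp: act_x0_eq_iff)
  qed (use k G_inv_cancel H_G in auto)
  then show ?thesis by (simp add: bij_betw_same_card)
qed

lemma card_H_pos: "card H > 0"
  using finite_H subgroup.one_closed[OF H_subgroup] by (auto simp: card_gt_0_iff)

lemma sum_orbit: "(\<Sum>g\<in>carrier G. F (g \<otimes> x\<^sub>0)) = of_nat (card H) * (\<Sum>y\<in>X. F y :: complex)"
proof -
  have "(\<Sum>g\<in>carrier G. F (g \<otimes> x\<^sub>0)) = (\<Sum>y\<in>X. \<Sum>g | g \<in> carrier G \<and> g \<otimes> x\<^sub>0 = y. F (g \<otimes> x\<^sub>0))"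
    by (rule sum.group[symmetric]) (use finite_G finite_X act_X in auto)
  also have "\<dots> = (\<Sum>y\<in>X. of_nat (card H) * F y)"
    by (rule sum.cong) (simp_all add: card_fibre)
  finally show ?thesis by (simp add: sum_distrib_left)
qed

definition \<kappa> where "\<kappa> = (SOME k :: nat. \<forall>x \<in> X.
        x \<otimes> star x = (\<Oplus>g\<in>H. g) \<oplus> add_pow R k (\<Oplus>y\<in>X. y))"

text \<open>Uniformity, read for self-dual \<open>x\<close>.\<close>

lemma X_square:
  assumes "x \<in> X"
  shows "x \<otimes> x = (\<Oplus>g\<in>H. g) \<oplus> add_pow R \<kappa> (\<Oplus>y\<in>X. y)"
proof -
  have "\<exists>k :: nat. \<forall>x \<in> X. x \<otimes> star x = (\<Oplus>g\<in>H. g) \<oplus> add_pow R k (\<Oplus>y\<in>X. y)"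
    using uniform unfolding uniform_def by blast
  then have "\<forall>x \<in> X. x \<otimes> star x = (\<Oplus>g\<in>H. g) \<oplus> add_pow R \<kappa> (\<Oplus>y\<in>X. y)"
    unfolding \<kappa>_def by (rule someI_ex)
  then show ?thesis using assms self_dual by simp
qed

section \<open>The quotient group and its extension by inversion\<close>

abbreviation GH where "GH \<equiv> quot_group R B star"
abbreviation coset where "coset g \<equiv> H #>\<^bsub>G\<^esub> g"

lemma GH_mult: "g \<in> carrier G \<Longrightarrow> g' \<in> carrier G \<Longrightarrow> coset g \<otimes>\<^bsub>GH\<^esub> coset g' = coset (g \<otimes> g')"
  using normal.rcos_sum[OF H_normal, of g g'] by (simp add: quot_group_def)

lemma GH_one: "\<one>\<^bsub>GH\<^esub> = coset \<one>"
  using G.coset_mult_one[OF H_subset] by (simp add: quot_group_def)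

lemma GH_carrier: "carrier GH = coset ` carrier G"
  by (simp add: quot_group_def carrier_FactGroup)

lemma coset_eq_iff:
  assumes "g \<in> carrier G" "g' \<in> carrier G"
  shows "coset g = coset g' \<longleftrightarrow> inv\<^bsub>G\<^esub> g' \<otimes> g \<in> H"
proof
  assume "coset g = coset g'"
  then have "g \<in> coset g'" using G.rcos_self[OF assms(1) H_subgroup] by simp
  then have "g \<otimes>\<^bsub>G\<^esub> inv\<^bsub>G\<^esub> g' \<in> H"
    using assms subgroup.rcos_module_imp[OF H_subgroup G.group_axioms] by blast
  then show "inv\<^bsub>G\<^esub> g' \<otimes> g \<in> H" using assms by (simp add: G_comm)
next
  assume "inv\<^bsub>G\<^esub> g' \<otimes> g \<in> H"
  then have "g \<otimes>\<^bsub>G\<^esub> inv\<^bsub>G\<^esub> g' \<in> H" using assms by (simp add: G_comm)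
  then have "g \<in> coset g'"
    using assms subgroup.rcos_module_rev[OF H_subgroup G.group_axioms] by blast
  then show "coset g = coset g'" using G.repr_independence[OF _ assms(2) H_subgroup] by simp
qed

lemma l_coset_eq: "g \<in> carrier G \<Longrightarrow> g <#\<^bsub>G\<^esub> H = coset g"
  using normal.coset_eq[OF H_normal] by simp

lemma theta_at_eq:
  assumes x: "x \<in> X"
  shows "theta_at R B star x = (\<lambda>C\<in>carrier GH. THE D. \<exists>g\<in>carrier G. C = coset g \<and> D = coset (inv\<^bsub>G\<^esub> g))"
  unfolding theta_at_def
proof (rule restrict_ext)
  fix C assume "C \<in> carrier GH"
  have "(\<exists>g \<in> inv_basis R B star. \<exists>g' \<in> inv_basis R B star.
          C = g <#\<^bsub>G\<^esub> H \<and> D = g' <#\<^bsub>G\<^esub> H \<and> g' \<otimes> x = x \<otimes> g) \<longleftrightarrow>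
        (\<exists>g\<in>carrier G. C = coset g \<and> D = coset (inv\<^bsub>G\<^esub> g))" (is "?L \<longleftrightarrow> ?R") for D
  proof
    assume ?L
    then obtain g g' where g: "g \<in> carrier G" "g' \<in> carrier G" "C = coset g" "D = coset g'"
      "g' \<otimes> x = x \<otimes> g" by (auto simp: l_coset_eq carrier_G)
    have "inv\<^bsub>G\<^esub> (inv\<^bsub>G\<^esub> g) \<otimes> (g' \<otimes> x) = x"
      using g x G_inv_cancel(2)[of g x] by (simp add: X_mult_G)
    then have "inv\<^bsub>G\<^esub> (inv\<^bsub>G\<^esub> g) \<otimes> g' \<in> H"
      using g x by (simp add: H_iff[OF x] m_assoc)
    then have "coset g' = coset (inv\<^bsub>G\<^esub> g)" using g by (subst coset_eq_iff) auto
    then show ?R using g by auto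
  next
    assume ?R
    then obtain g where g: "g \<in> carrier G" "C = coset g" "D = coset (inv\<^bsub>G\<^esub> g)" by blast
    show ?L
      unfolding carrier_G[symmetric]
      by (rule bexI[of _ g], rule bexI[of _ "inv\<^bsub>G\<^esub> g"]) (use g x in \<open>simp_all add: l_coset_eq X_mult_G\<close>)
  qed
  then show "(THE D. \<exists>g \<in> inv_basis R B star. \<exists>g' \<in> inv_basis R B star.
          C = g <#\<^bsub>G\<^esub> H \<and> D = g' <#\<^bsub>G\<^esub> H \<and> g' \<otimes> x = x \<otimes> g) =
        (THE D. \<exists>g\<in>carrier G. C = coset g \<and> D = coset (inv\<^bsub>G\<^esub> g))" by simp
qed

text \<open>By \<open>X_mult_G\<close> the condition \<open>g' x = x g\<close> says \<open>g' x = g\<^sup>-\<^sup>1 x\<close>, that is, \<open>g' H = g\<^sup>-\<^sup>1 H\<close>.\<close>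

lemma theta_coset:
  assumes g: "g \<in> carrier G"
  shows "theta R B star (coset g) = coset (inv\<^bsub>G\<^esub> g)"
proof -
  have th: "theta R B star = theta_at R B star x\<^sub>0"
    unfolding theta_def by (rule the_equality) (simp_all add: theta_at_eq, metis x0_X theta_at_eq)
  have "theta R B star (coset g) = (THE D. \<exists>g'\<in>carrier G. coset g = coset g' \<and> D = coset (inv\<^bsub>G\<^esub> g'))"
    using g by (simp add: th theta_at_eq[OF x0_X] GH_carrier)
  also have "\<dots> = coset (inv\<^bsub>G\<^esub> g)"
  proof (rule the_equality)
    fix D assume "\<exists>g'\<in>carrier G. coset g = coset g' \<and> D = coset (inv\<^bsub>G\<^esub> g')"
    then obtain g' where g': "g' \<in> carrier G" "coset g = coset g'" "D = coset (inv\<^bsub>G\<^esub> g')" by blast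
    have "inv\<^bsub>G\<^esub> g' \<otimes> g \<in> H" using g g' coset_eq_iff by simp
    then have "inv\<^bsub>G\<^esub> (inv\<^bsub>G\<^esub> g) \<otimes> inv\<^bsub>G\<^esub> g' \<in> H" using g g' by (simp add: G_comm)
    then show "D = coset (inv\<^bsub>G\<^esub> g)" using g g' by (subst g'(3), subst coset_eq_iff) auto
  qed (use g in blast)
  finally show ?thesis .
qed

abbreviation \<Gamma> where "\<Gamma> \<equiv> semidirect_C2 GH (theta R B star)"

lemma carrier_\<Gamma>: "carrier \<Gamma> = carrier GH \<times> {0, 1}"
  by (auto simp: semidirect_C2_def semidirect_def carrier_integer_mod_group)

lemma \<Gamma>_one: "\<one>\<^bsub>\<Gamma>\<^esub> = (coset \<one>, 0)"
  by (simp add: semidirect_C2_def semidirect_def GH_one)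

lemma \<Gamma>_mult:
  assumes "g \<in> carrier G" "g' \<in> carrier G"
  shows "(coset g, 0) \<otimes>\<^bsub>\<Gamma>\<^esub> (coset g', c) = (coset (g \<otimes> g'), c mod 2)"
    "(coset g, 1) \<otimes>\<^bsub>\<Gamma>\<^esub> (coset g', c) = (coset (g \<otimes> inv\<^bsub>G\<^esub> g'), (1 + c) mod 2)"
  using assms by (simp_all add: semidirect_C2_def semidirect_def GH_mult theta_coset)

end

section \<open>Representations given on the basis\<close>

context fusion_ring
begin

abbreviation RC where "RC \<equiv> complexification R B"

text \<open>The \<open>\<int>\<close>-linear extension to \<open>R\<close> of a map on the basis. A map on \<open>B\<close> comes from a representation
  exactly if this extension is multiplicative on products of two basis elements; this is \<open>basis_rep\<close> below.\<close>

definition lin_ext :: "nat \<Rightarrow> ('a \<Rightarrow> complex mat) \<Rightarrow> 'a \<Rightarrow> complex mat" where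
  "lin_ext n M r = msum n (\<lambda>b. of_int (zcoord R B r b) \<cdot>\<^sub>m M b) B"

definition basis_rep :: "nat \<Rightarrow> ('a \<Rightarrow> complex mat) \<Rightarrow> bool" where
  "basis_rep n M \<longleftrightarrow> (\<forall>b\<in>B. M b \<in> carrier_mat n n) \<and> M \<one> = 1\<^sub>m n \<and>
     (\<forall>b\<in>B. \<forall>c\<in>B. M b * M c = lin_ext n M (b \<otimes> c))"

definition basis_values :: "('a \<Rightarrow> complex) rep \<Rightarrow> 'a \<Rightarrow> complex mat" where
  "basis_values \<rho> b = snd \<rho> (ptensor R B b 1)"

definition extension :: "nat \<Rightarrow> ('a \<Rightarrow> complex mat) \<Rightarrow> ('a \<Rightarrow> complex) \<Rightarrow> complex mat" where
  "extension n M f = msum n (\<lambda>b. f b \<cdot>\<^sub>m M b) B"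

lemma lin_ext_extension: "lin_ext n M r = extension n M (ptensor R B r 1)"
  by (simp add: lin_ext_def extension_def ptensor_def)

lemma extension_basis:
  assumes "b \<in> B" "M b \<in> carrier_mat n n" "\<And>c. c \<in> B \<Longrightarrow> M c \<in> carrier_mat n n"
  shows "extension n M (ptensor R B b 1) = M b"
proof -
  have "extension n M (ptensor R B b 1) = ptensor R B b 1 b \<cdot>\<^sub>m M b"
    unfolding extension_def
  proof (rule msum_single[OF finite_basis assms(1)])
    fix a assume "a \<in> B" "a \<noteq> b"
    then show "ptensor R B b 1 a \<cdot>\<^sub>m M a = 0\<^sub>m n n"
      using assms by (intro eq_matI) (simp_all add: ptensor_def zcoord_basis assms(3)[THEN carrier_matD(1)] assms(3)[THEN carrier_matD(2)])
  qed (use assms in simp)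
  also have "\<dots> = M b" by (rule eq_matI) (use assms(1) in \<open>simp_all add: ptensor_def zcoord_basis\<close>)
  finally show ?thesis .
qed

lemma lin_ext_basis:
  assumes "b \<in> B" "\<And>c. c \<in> B \<Longrightarrow> M c \<in> carrier_mat n n"
  shows "lin_ext n M b = M b"
  using assms extension_basis[of b M n] by (simp add: lin_ext_extension)

lemma lin_ext_add:
  assumes "r \<in> carrier R" "s \<in> carrier R" "\<And>c. c \<in> B \<Longrightarrow> M c \<in> carrier_mat n n"
  shows "lin_ext n M (r \<oplus> s) = lin_ext n M r + lin_ext n M s"
proof -
  have "lin_ext n M (r \<oplus> s) =
      msum n (\<lambda>b. of_int (zcoord R B r b) \<cdot>\<^sub>m M b + of_int (zcoord R B s b) \<cdot>\<^sub>m M b) B"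
    unfolding lin_ext_def
    by (rule msum_cong) (simp_all add: zcoord_add assms(1,2) add_smult_distrib_right_mat[OF assms(3)])
  also have "\<dots> = lin_ext n M r + lin_ext n M s"
    unfolding lin_ext_def by (rule msum_add) (simp_all add: assms(3))
  finally show ?thesis .
qed

lemma lin_ext_zero: "lin_ext n M \<zero> = 0\<^sub>m n n" if "\<And>c. c \<in> B \<Longrightarrow> M c \<in> carrier_mat n n"
proof -
  have "zcoord R B \<zero> b = 0" for b
    using zcoord_finsum[of "{}" "\<lambda>x. x" b] by simp
  then have "lin_ext n M \<zero> = msum n (\<lambda>b. 0 \<cdot>\<^sub>m M b) B"
    by (simp add: lin_ext_def)
  also have "\<dots> = 0 \<cdot>\<^sub>m msum n M B" by (rule msum_smult) (rule that)
  also have "\<dots> = 0\<^sub>m n n" by (rule eq_matI) auto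
  finally show ?thesis .
qed

lemma lin_ext_finsum:
  assumes "finite S" "f \<in> S \<rightarrow> carrier R" "\<And>c. c \<in> B \<Longrightarrow> M c \<in> carrier_mat n n"
  shows "lin_ext n M (\<Oplus>i\<in>S. f i) = msum n (\<lambda>i. lin_ext n M (f i)) S"
  using assms(1,2)
proof (induction S rule: finite_induct)
  case (insert i S)
  have f: "f i \<in> carrier R" "f \<in> S \<rightarrow> carrier R" using insert.prems by auto
  have "lin_ext n M (f i) \<in> carrier_mat n n" by (simp add: lin_ext_def)
  then show ?case
    using insert f by (simp add: lin_ext_add assms(3) finsum_closed msum_insert)
qed (simp add: lin_ext_zero assms(3))

lemma lin_ext_add_pow:
  assumes "r \<in> carrier R" "\<And>c. c \<in> B \<Longrightarrow> M c \<in> carrier_mat n n"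
  shows "lin_ext n M (add_pow R (m :: nat) r) = of_nat m \<cdot>\<^sub>m lin_ext n M r"
proof -
  have "zcoord R B (add_pow R m r) b = int m * zcoord R B r b" for b
    using zcoord_add_pow[OF assms(1), of "int m" b] by (simp add: add_pow_def int_pow_int)
  then have "lin_ext n M (add_pow R m r) = msum n (\<lambda>b. of_nat m \<cdot>\<^sub>m (of_int (zcoord R B r b) \<cdot>\<^sub>m M b)) B"
    unfolding lin_ext_def by (intro msum_cong) (auto intro!: eq_matI)
  also have "\<dots> = of_nat m \<cdot>\<^sub>m lin_ext n M r"
    unfolding lin_ext_def by (rule msum_smult) (simp add: assms(2))
  finally show ?thesis .
qed

lemma alg_repD:
  assumes "alg_rep RC (n, \<rho>)"
  shows "f \<in> carrier RC \<Longrightarrow> \<rho> f \<in> carrier_mat n n"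
    "\<rho> \<one>\<^bsub>RC\<^esub> = 1\<^sub>m n"
    "f \<in> carrier RC \<Longrightarrow> g \<in> carrier RC \<Longrightarrow> \<rho> (f \<oplus>\<^bsub>RC\<^esub> g) = \<rho> f + \<rho> g"
    "f \<in> carrier RC \<Longrightarrow> g \<in> carrier RC \<Longrightarrow> \<rho> (f \<otimes>\<^bsub>RC\<^esub> g) = \<rho> f * \<rho> g"
    "f \<in> carrier RC \<Longrightarrow> \<rho> (c \<odot>\<^bsub>RC\<^esub> f) = c \<cdot>\<^sub>m \<rho> f"
  using assms by (auto simp: alg_rep_def Ring.ring_hom_def ring_mat_def Pi_iff)

lemma alg_rep_square: "alg_rep RC \<rho> \<Longrightarrow> square_rep (carrier RC) \<rho>"
  using alg_repD(1)[of "fst \<rho>" "snd \<rho>"] by (simp add: square_rep_def)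

lemma alg_rep_expand:
  assumes rep: "alg_rep RC (n, \<rho>)" and f: "f \<in> carrier RC"
  shows "\<rho> f = extension n (basis_values (n, \<rho>)) f"
proof -
  have c: "ptensor R B b 1 \<in> carrier RC" if "b \<in> B" for b
    using ptensor_closed that by simp
  have "\<rho> f = msum n (\<lambda>b. f b \<cdot>\<^sub>m \<rho> (ptensor R B b 1)) S"
    if "finite S" "S \<subseteq> B" "\<forall>b. b \<notin> S \<longrightarrow> f b = 0" for S f
    using that
  proof (induction S arbitrary: f rule: finite_induct)
    case empty
    then have "f = 0 \<odot>\<^bsub>RC\<^esub> f" "f \<in> carrier RC" by (auto simp: complexification_def)
    then have "\<rho> f = 0 \<cdot>\<^sub>m \<rho> f" "\<rho> f \<in> carrier_mat n n" using alg_repD[OF rep] by metis+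
    then show ?case by (auto intro!: eq_matI) (metis carrier_matD index_smult_mat(1) mult_zero_left)
  next
    case (insert b S)
    let ?g = "f(b := 0)" and ?h = "f b \<odot>\<^bsub>RC\<^esub> ptensor R B b 1"
    have b: "b \<in> B" using insert.prems by simp
    have gh: "?g \<in> carrier RC" "?h \<in> carrier RC"
      using insert.prems c[OF b] by (auto simp: complexification_def)
    have "f = ?h \<oplus>\<^bsub>RC\<^esub> ?g"
      using b by (auto simp: ptensor_def complexification_def zcoord_basis)
    then have "\<rho> f = \<rho> ?h + \<rho> ?g" using alg_repD(3)[OF rep gh(2,1)] by simp
    also have "\<rho> ?h = f b \<cdot>\<^sub>m \<rho> (ptensor R B b 1)" using alg_repD(5)[OF rep c[OF b]] .
    also have "\<rho> ?g = msum n (\<lambda>b. ?g b \<cdot>\<^sub>m \<rho> (ptensor R B b 1)) S"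
      by (rule insert.IH) (use insert.prems in auto)
    also have "\<dots> = msum n (\<lambda>b. f b \<cdot>\<^sub>m \<rho> (ptensor R B b 1)) S"
      by (rule msum_cong) (use insert.hyps in auto)
    finally show ?case
      using insert.hyps alg_repD(1)[OF rep c[OF b]] by (simp add: msum_insert)
  qed
  from this[OF finite_basis subset_refl, of f] f show ?thesis
    by (simp add: extension_def basis_values_def complexification_def)
qed

lemma basis_rep_of_alg_rep:
  assumes rep: "alg_rep RC (n, \<rho>)"
  shows "basis_rep n (basis_values (n, \<rho>))"
  unfolding basis_rep_def
proof (intro conjI ballI)
  have c: "ptensor R B r 1 \<in> carrier RC" if "r \<in> carrier R" for r
    using ptensor_closed that by simp
  show "basis_values (n, \<rho>) b \<in> carrier_mat n n" if "b \<in> B" for b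
    using that alg_repD(1)[OF rep c] by (simp add: basis_values_def)
  show "basis_values (n, \<rho>) \<one> = 1\<^sub>m n"
    using alg_repD(2)[OF rep] by (simp add: basis_values_def ptensor_one)
  fix b d assume b: "b \<in> B" "d \<in> B"
  have "basis_values (n, \<rho>) b * basis_values (n, \<rho>) d = \<rho> (ptensor R B b 1 \<otimes>\<^bsub>RC\<^esub> ptensor R B d 1)"
    using alg_repD(4)[OF rep c c] b by (simp add: basis_values_def)
  also have "\<dots> = \<rho> (ptensor R B (b \<otimes> d) 1)" using b by (simp add: ptensor_mult)
  also have "\<dots> = lin_ext n (basis_values (n, \<rho>)) (b \<otimes> d)"
    unfolding lin_ext_extension by (rule alg_rep_expand[OF rep]) (use b c in simp)
  finally show "basis_values (n, \<rho>) b * basis_values (n, \<rho>) d = lin_ext n (basis_values (n, \<rho>)) (b \<otimes> d)" .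
qed

lemma alg_rep_of_basis_rep:
  assumes M: "basis_rep n M"
  shows "alg_rep RC (n, extension n M)"
proof -
  have Mc: "M b \<in> carrier_mat n n" if "b \<in> B" for b using M that by (simp add: basis_rep_def)
  have Md: "dim_row (M b) = n" "dim_col (M b) = n" if "b \<in> B" for b
    using Mc[OF that] by auto
  have add: "extension n M (f \<oplus>\<^bsub>RC\<^esub> g) = extension n M f + extension n M g" for f g
  proof -
    have "extension n M (f \<oplus>\<^bsub>RC\<^esub> g) = msum n (\<lambda>b. f b \<cdot>\<^sub>m M b + g b \<cdot>\<^sub>m M b) B"
      unfolding extension_def
      by (rule msum_cong) (simp_all add: complexification_def add_smult_distrib_right_mat[OF Mc])
    also have "\<dots> = extension n M f + extension n M g"
      unfolding extension_def by (rule msum_add) (simp_all add: Mc)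
    finally show ?thesis .
  qed
  have smult: "extension n M (c \<odot>\<^bsub>RC\<^esub> f) = c \<cdot>\<^sub>m extension n M f" for c f
  proof -
    have "extension n M (c \<odot>\<^bsub>RC\<^esub> f) = msum n (\<lambda>b. c \<cdot>\<^sub>m (f b \<cdot>\<^sub>m M b)) B"
      unfolding extension_def by (rule msum_cong) (auto simp: complexification_def intro!: eq_matI)
    also have "\<dots> = c \<cdot>\<^sub>m extension n M f"
      unfolding extension_def by (rule msum_smult) (simp add: Mc)
    finally show ?thesis .
  qed
  have mult: "extension n M (f \<otimes>\<^bsub>RC\<^esub> g) = extension n M f * extension n M g" for f g
  proof (rule eq_matI)
    fix i j assume "i < dim_row (extension n M f * extension n M g)" "j < dim_col (extension n M f * extension n M g)"
    then have ij: "i < n" "j < n" by (auto simp: extension_def)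
    have "extension n M f * extension n M g = msum n (\<lambda>x. (f x \<cdot>\<^sub>m M x) * extension n M g) B"
      unfolding extension_def by (rule msum_mult) (simp_all add: Mc)
    also have "\<dots> = msum n (\<lambda>x. msum n (\<lambda>y. (f x \<cdot>\<^sub>m M x) * (g y \<cdot>\<^sub>m M y)) B) B"
      unfolding extension_def by (intro msum_cong refl mult_msum) (simp_all add: Mc)
    also have "\<dots> = msum n (\<lambda>x. msum n (\<lambda>y. (f x * g y) \<cdot>\<^sub>m lin_ext n M (x \<otimes> y)) B) B"
    proof (intro msum_cong refl)
      fix x y assume xy: "x \<in> B" "y \<in> B"
      have "(f x \<cdot>\<^sub>m M x) * (g y \<cdot>\<^sub>m M y) = (f x * g y) \<cdot>\<^sub>m (M x * M y)"
        using Mc[OF xy(1)] Mc[OF xy(2)]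
        by (simp add: mult_smult_assoc_mat[of _ n n _ n] mult_smult_distrib[of _ n n _ n] smult_smult_mat mult.commute)
      then show "(f x \<cdot>\<^sub>m M x) * (g y \<cdot>\<^sub>m M y) = (f x * g y) \<cdot>\<^sub>m lin_ext n M (x \<otimes> y)"
        using M xy by (simp add: basis_rep_def)
    qed
    finally have "(extension n M f * extension n M g) $$ (i, j) =
        (\<Sum>x\<in>B. \<Sum>y\<in>B. (f x * g y) * (\<Sum>b\<in>B. of_int (zcoord R B (x \<otimes> y) b) * M b $$ (i, j)))"
      using ij by (simp add: msum_index lin_ext_def Md cong: sum.cong)
    also have "\<dots> = (\<Sum>x\<in>B. \<Sum>y\<in>B. \<Sum>b\<in>B. f x * g y * of_int (zcoord R B (x \<otimes> y) b) * M b $$ (i, j))"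
      by (simp add: sum_distrib_left mult.assoc)
    also have "\<dots> = (\<Sum>x\<in>B. \<Sum>b\<in>B. \<Sum>y\<in>B. f x * g y * of_int (zcoord R B (x \<otimes> y) b) * M b $$ (i, j))"
      by (intro sum.cong refl sum.swap)
    also have "\<dots> = (\<Sum>b\<in>B. \<Sum>x\<in>B. \<Sum>y\<in>B. f x * g y * of_int (zcoord R B (x \<otimes> y) b) * M b $$ (i, j))"
      by (rule sum.swap)
    also have "\<dots> = extension n M (f \<otimes>\<^bsub>RC\<^esub> g) $$ (i, j)"
      using ij by (simp add: extension_def msum_index complexification_def Md sum_distrib_right cong: sum.cong)
    finally show "extension n M (f \<otimes>\<^bsub>RC\<^esub> g) $$ (i, j) = (extension n M f * extension n M g) $$ (i, j)" by simp
  qed (simp_all add: extension_def)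
  have one: "extension n M \<one>\<^bsub>RC\<^esub> = 1\<^sub>m n"
    using M extension_basis[OF one_in_basis, of M n] Mc one_in_basis by (simp add: ptensor_one basis_rep_def)
  show ?thesis
    unfolding alg_rep_def Ring.ring_hom_def
    by (auto simp: add smult mult one ring_mat_def) (simp add: extension_def)
qed

lemma basis_values_extension:
  assumes "basis_rep n M" "b \<in> B"
  shows "basis_values (n, extension n M) b = M b"
  using assms extension_basis[of b M n] by (simp add: basis_values_def basis_rep_def)

text \<open>By linearity an algebra representation generates the same subalgebras as its values on the basis.\<close>

lemma subalgebra_rel_basis_values:
  assumes \<rho>: "alg_rep RC (n, \<rho>)" and \<sigma>: "alg_rep RC (n, \<sigma>)" and Q: "subalgebra_rel n Q"
  shows "(\<forall>f\<in>carrier RC. Q (\<rho> f) (\<sigma> f)) \<longleftrightarrow>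
    (\<forall>b\<in>B. Q (basis_values (n, \<rho>) b) (basis_values (n, \<sigma>) b))"
proof
  assume L: "\<forall>f\<in>carrier RC. Q (\<rho> f) (\<sigma> f)"
  show "\<forall>b\<in>B. Q (basis_values (n, \<rho>) b) (basis_values (n, \<sigma>) b)"
    using L ptensor_closed by (simp add: basis_values_def)
next
  assume *: "\<forall>b\<in>B. Q (basis_values (n, \<rho>) b) (basis_values (n, \<sigma>) b)"
  have c: "basis_values (n, \<rho>) b \<in> carrier_mat n n" "basis_values (n, \<sigma>) b \<in> carrier_mat n n" if "b \<in> B" for b
    using that basis_rep_of_alg_rep[OF \<rho>] basis_rep_of_alg_rep[OF \<sigma>] by (simp_all add: basis_rep_def)
  show "\<forall>f\<in>carrier RC. Q (\<rho> f) (\<sigma> f)"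
  proof
    fix f assume f: "f \<in> carrier RC"
    have "Q (extension n (basis_values (n, \<rho>)) f) (extension n (basis_values (n, \<sigma>)) f)"
      unfolding extension_def
      by (rule subalgebra_rel_msum[OF Q finite_basis]) (use c * subalgebra_rel_smult[OF Q] in auto)
    then show "Q (\<rho> f) (\<sigma> f)"
      using alg_rep_expand[OF \<rho> f] alg_rep_expand[OF \<sigma> f] by simp
  qed
qed

end

section \<open>Representations given on the group and one further element\<close>

context self_dual_uniform_fusion_ring
begin

text \<open>A representation in terms of the matrices \<open>D g\<close> of \<open>g \<in> G\<close> and the matrix \<open>Y\<close> of \<open>x\<^sub>0\<close>. In
  the last relation \<open>\<Sum>\<^sub>y M y\<close> over \<open>X\<close> is written as \<open>|H|\<^sup>-\<^sup>1 \<Sum>\<^sub>g D g Y\<close>.\<close>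

definition orbit_rep :: "nat \<Rightarrow> ('a \<Rightarrow> complex mat) \<Rightarrow> complex mat \<Rightarrow> bool" where
  "orbit_rep n D Y \<longleftrightarrow> Y \<in> carrier_mat n n \<and> (\<forall>g\<in>carrier G. D g \<in> carrier_mat n n) \<and> D \<one> = 1\<^sub>m n \<and>
     (\<forall>g\<in>carrier G. \<forall>g'\<in>carrier G. D (g \<otimes> g') = D g * D g') \<and>
     (\<forall>g\<in>carrier G. Y * D g = D (inv\<^bsub>G\<^esub> g) * Y) \<and> (\<forall>h\<in>H. D h * Y = Y) \<and>
     Y * Y = msum n D H + (of_nat \<kappa> / of_nat (card H)) \<cdot>\<^sub>m (msum n D (carrier G) * Y)"

lemma orbit_repD:
  assumes "orbit_rep n D Y"
  shows "Y \<in> carrier_mat n n" "g \<in> carrier G \<Longrightarrow> D g \<in> carrier_mat n n" "D \<one> = 1\<^sub>m n"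
    "g \<in> carrier G \<Longrightarrow> g' \<in> carrier G \<Longrightarrow> D (g \<otimes> g') = D g * D g'"
    "g \<in> carrier G \<Longrightarrow> Y * D g = D (inv\<^bsub>G\<^esub> g) * Y" "h \<in> H \<Longrightarrow> D h * Y = Y"
    "Y * Y = msum n D H + (of_nat \<kappa> / of_nat (card H)) \<cdot>\<^sub>m (msum n D (carrier G) * Y)"
  using assms by (simp_all add: orbit_rep_def)

lemma msum_orbit:
  assumes "\<And>y. y \<in> X \<Longrightarrow> M y \<in> carrier_mat n n"
  shows "msum n (\<lambda>g. M (g \<otimes> x\<^sub>0)) (carrier G) = of_nat (card H) \<cdot>\<^sub>m msum n M X"
  by (rule eq_matI) (simp_all add: msum_index sum_orbit[of "\<lambda>y. M y $$ _"])

lemma basis_rep_act: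
  assumes M: "basis_rep n M" and g: "g \<in> carrier G" and b: "b \<in> B"
  shows "M (g \<otimes> b) = M g * M b"
proof -
  have gb: "g \<otimes> b \<in> B" using inv_basis_mult[of g b] g b by (simp add: carrier_G)
  have "M g * M b = lin_ext n M (g \<otimes> b)" using M g b by (simp add: basis_rep_def)
  also have "\<dots> = M (g \<otimes> b)" using gb M by (intro lin_ext_basis) (simp_all add: basis_rep_def)
  finally show ?thesis by simp
qed

lemma orbit_rep_of_basis_rep:
  assumes M: "basis_rep n M"
  shows "orbit_rep n M (M x\<^sub>0)"
proof -
  have Mc: "M b \<in> carrier_mat n n" if "b \<in> B" for b using M that by (simp add: basis_rep_def)
  have eq: "M b * M c = lin_ext n M (b \<otimes> c)" if "b \<in> B" "c \<in> B" for b c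
    using M that by (simp add: basis_rep_def)
  have 1: "M x\<^sub>0 * M g = M (inv\<^bsub>G\<^esub> g) * M x\<^sub>0" if g: "g \<in> carrier G" for g
  proof -
    have "M x\<^sub>0 * M g = lin_ext n M (inv\<^bsub>G\<^esub> g \<otimes> x\<^sub>0)" using g by (simp add: eq X_mult_G)
    also have "\<dots> = M (inv\<^bsub>G\<^esub> g) * M x\<^sub>0" using g by (simp add: eq)
    finally show ?thesis .
  qed
  have T: "msum n M (carrier G) * M x\<^sub>0 = of_nat (card H) \<cdot>\<^sub>m msum n M X"
  proof -
    have "msum n M (carrier G) * M x\<^sub>0 = msum n (\<lambda>g. M g * M x\<^sub>0) (carrier G)"
      by (rule msum_mult) (simp_all add: Mc)
    also have "\<dots> = msum n (\<lambda>g. M (g \<otimes> x\<^sub>0)) (carrier G)"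
      by (rule msum_cong) (simp_all add: basis_rep_act[OF M])
    finally show ?thesis using msum_orbit[of M n] Mc by simp
  qed
  have "M x\<^sub>0 * M x\<^sub>0 = lin_ext n M ((\<Oplus>g\<in>H. g) \<oplus> add_pow R \<kappa> (\<Oplus>y\<in>X. y))"
    unfolding X_square[OF x0_X, symmetric] by (rule eq) simp_all
  also have "\<dots> = msum n (lin_ext n M) H + of_nat \<kappa> \<cdot>\<^sub>m msum n (lin_ext n M) X"
    using H_G finite_H finite_X Mc
    by (simp add: lin_ext_add lin_ext_add_pow lin_ext_finsum finsum_closed Pi_iff)
  also have "msum n (lin_ext n M) H = msum n M H"
    by (rule msum_cong) (simp_all add: lin_ext_basis Mc H_G)
  also have "msum n (lin_ext n M) X = msum n M X"
    by (rule msum_cong) (simp_all add: lin_ext_basis Mc)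
  also have "of_nat \<kappa> \<cdot>\<^sub>m msum n M X = (of_nat \<kappa> / of_nat (card H)) \<cdot>\<^sub>m (msum n M (carrier G) * M x\<^sub>0)"
    unfolding T using card_H_pos by (simp add: smult_smult_mat)
  finally have 2: "M x\<^sub>0 * M x\<^sub>0 = msum n M H + (of_nat \<kappa> / of_nat (card H)) \<cdot>\<^sub>m (msum n M (carrier G) * M x\<^sub>0)" .
  have 3: "M h * M x\<^sub>0 = M x\<^sub>0" if "h \<in> H" for h
    using basis_rep_act[OF M H_G[OF that], of x\<^sub>0] H_fix[OF that x0_X] by simp
  show ?thesis
    unfolding orbit_rep_def
  proof (intro conjI ballI)
    show "M \<one> = 1\<^sub>m n" using M by (simp add: basis_rep_def)
  qed (use 1 2 3 Mc in \<open>simp_all add: basis_rep_act[OF M]\<close>)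
qed

text \<open>Conversely \<open>D\<close> and \<open>Y\<close> determine a representation: \<open>g x\<^sub>0\<close> acts by \<open>D g Y\<close>, which does not depend
  on the choice of \<open>g\<close> because \<open>D h Y = Y\<close> for \<open>h \<in> H\<close>.\<close>

definition glue :: "('a \<Rightarrow> complex mat) \<Rightarrow> complex mat \<Rightarrow> 'a \<Rightarrow> complex mat" where
  "glue D Y b = (if b \<in> carrier G then D b else D (SOME g. g \<in> carrier G \<and> b = g \<otimes> x\<^sub>0) * Y)"

lemma glue_G [simp]: "g \<in> carrier G \<Longrightarrow> glue D Y g = D g"
  by (simp add: glue_def)

lemma glue_X:
  assumes P: "orbit_rep n D Y" and g: "g \<in> carrier G"
  shows "glue D Y (g \<otimes> x\<^sub>0) = D g * Y"
proof -
  note PD = orbit_repD[OF P]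
  define k where "k = (SOME k. k \<in> carrier G \<and> g \<otimes> x\<^sub>0 = k \<otimes> x\<^sub>0)"
  have k: "k \<in> carrier G" "g \<otimes> x\<^sub>0 = k \<otimes> x\<^sub>0"
    unfolding k_def by (metis (mono_tags, lifting) g someI_ex)+
  have h: "inv\<^bsub>G\<^esub> k \<otimes> g \<in> H" using act_x0_eq_iff[OF g k(1)] k(2) by simp
  have "k \<otimes> (inv\<^bsub>G\<^esub> k \<otimes> g) = g" using g k(1) by (simp add: G_inv_cancel)
  then have "D g * Y = D k * D (inv\<^bsub>G\<^esub> k \<otimes> g) * Y"
    using PD(4)[OF k(1) H_G[OF h]] by simp
  also have "\<dots> = D k * Y"
    using PD(6)[OF h] sq_assoc[OF PD(2)[OF k(1)] PD(2)[OF H_G[OF h]] PD(1)] by simp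
  finally show ?thesis
    using X_not_G[OF act_X[OF g x0_X]] by (simp add: glue_def k_def)
qed

text \<open>The only product that does not stay in \<open>B\<close> is \<open>(g x\<^sub>0)(g' x\<^sub>0) = u x\<^sub>0\<^sup>2\<close> with \<open>u = g g'\<^sup>-\<^sup>1\<close>. There uniformity
  gives \<open>\<Sum>\<^sub>h u h + k \<Sum>\<^sub>y u y\<close>, and translation by \<open>u\<close> permutes \<open>X\<close>.\<close>

lemma basis_rep_glue:
  assumes P: "orbit_rep n D Y"
  shows "basis_rep n (glue D Y)" "glue D Y x\<^sub>0 = Y"
proof -
  note PD = orbit_repD[OF P]
  let ?M = "glue D Y"
  note MX = glue_X[OF P]
  have x0: "?M x\<^sub>0 = Y" using MX[OF G_one_closed] PD(1,3) by simp
  then show "glue D Y x\<^sub>0 = Y" .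
  have Mc: "?M b \<in> carrier_mat n n" if "b \<in> B" for b
  proof (cases "b \<in> carrier G")
    case False
    then have "b \<in> X" using basis_cases[OF that] by blast
    then obtain g where "g \<in> carrier G" "b = g \<otimes> x\<^sub>0" by (rule X_cases)
    then show ?thesis using MX PD(1,2) by simp
  qed (use PD(2) in simp)
  have on_basis: "lin_ext n ?M b = ?M b" if "b \<in> B" for b
    using that Mc by (rule lin_ext_basis)
  have XX: "?M (g \<otimes> x\<^sub>0) * ?M (g' \<otimes> x\<^sub>0) = lin_ext n ?M ((g \<otimes> x\<^sub>0) \<otimes> (g' \<otimes> x\<^sub>0))"
    if g: "g \<in> carrier G" "g' \<in> carrier G" for g g'
  proof -
    \<comment> \<open>\<open>x\<^sub>0\<close> moves past \<open>g'\<close> at the price of an inverse, so the product is \<open>u x\<^sub>0\<^sup>2\<close>.\<close>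
    define u where "u = g \<otimes> inv\<^bsub>G\<^esub> g'"
    have u: "u \<in> carrier G" using g by (simp add: u_def)
    have uX: "bij_betw (\<lambda>y. u \<otimes> y) X X"
      by (rule bij_betwI[of _ _ _ "\<lambda>y. inv\<^bsub>G\<^esub> u \<otimes> y"]) (use u act_X in \<open>auto simp: G_inv_cancel\<close>)
    have "x\<^sub>0 \<otimes> (g' \<otimes> x\<^sub>0) = inv\<^bsub>G\<^esub> g' \<otimes> (x\<^sub>0 \<otimes> x\<^sub>0)"
      using g X_mult_G[OF g(2) x0_X] by (simp add: m_assoc[symmetric])
    then have "(g \<otimes> x\<^sub>0) \<otimes> (g' \<otimes> x\<^sub>0) = u \<otimes> (x\<^sub>0 \<otimes> x\<^sub>0)"
      using g by (simp add: u_def m_assoc)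
    also have "\<dots> = u \<otimes> (\<Oplus>g\<in>H. g) \<oplus> add_pow R \<kappa> (u \<otimes> (\<Oplus>y\<in>X. y))"
      using u H_G by (simp add: X_square r_distr finsum_closed Pi_iff add_pow_rdistr)
    also have "u \<otimes> (\<Oplus>g\<in>H. g) = (\<Oplus>g\<in>H. u \<otimes> g)"
      using u H_G finite_H by (intro finsum_rdistr) auto
    also have "u \<otimes> (\<Oplus>y\<in>X. y) = (\<Oplus>y\<in>X. u \<otimes> y)"
      using u finite_X by (intro finsum_rdistr) auto
    finally have "lin_ext n ?M ((g \<otimes> x\<^sub>0) \<otimes> (g' \<otimes> x\<^sub>0)) =
        msum n (\<lambda>h. lin_ext n ?M (u \<otimes> h)) H + of_nat \<kappa> \<cdot>\<^sub>m msum n (\<lambda>y. lin_ext n ?M (u \<otimes> y)) X"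
      using u H_G finite_H finite_X Mc
      by (simp add: lin_ext_add lin_ext_add_pow lin_ext_finsum finsum_closed Pi_iff)
    also have "msum n (\<lambda>h. lin_ext n ?M (u \<otimes> h)) H = msum n (\<lambda>h. D u * D h) H"
      by (rule msum_cong) (use u H_G PD(4) in \<open>simp_all add: on_basis\<close>)
    also have "\<dots> = D u * msum n D H"
      by (rule mult_msum[symmetric]) (use u H_G PD(2) in auto)
    also have "msum n (\<lambda>y. lin_ext n ?M (u \<otimes> y)) X = msum n (\<lambda>y. ?M (u \<otimes> y)) X"
      by (rule msum_cong) (use u act_X in \<open>simp_all add: on_basis\<close>)
    also have "\<dots> = msum n ?M X" by (rule msum_reindex[OF uX])
    also have "of_nat \<kappa> \<cdot>\<^sub>m msum n ?M X = (of_nat \<kappa> / of_nat (card H)) \<cdot>\<^sub>m (of_nat (card H) \<cdot>\<^sub>m msum n ?M X)"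
      using card_H_pos by (simp add: smult_smult_mat)
    also have "of_nat (card H) \<cdot>\<^sub>m msum n ?M X = msum n (\<lambda>g. ?M (g \<otimes> x\<^sub>0)) (carrier G)"
      by (rule msum_orbit[symmetric]) (simp add: Mc)
    also have "\<dots> = msum n (\<lambda>g. D g * Y) (carrier G)"
      by (rule msum_cong) (simp_all add: MX)
    also have "\<dots> = msum n D (carrier G) * Y"
      by (rule msum_mult[symmetric]) (use PD in auto)
    also have "msum n D (carrier G) = D u * msum n D (carrier G)"
      by (rule msum_translate[OF G.group_axioms G.subgroup_self u, symmetric]) (use PD u in auto)
    also have "D u * msum n D H + (of_nat \<kappa> / of_nat (card H)) \<cdot>\<^sub>m (D u * msum n D (carrier G) * Y) =
        D u * (Y * Y)"
      unfolding PD(7) using PD(1) PD(2)[OF u]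
      by (simp add: mult_add_distrib_mat[of _ n n _ n] mult_smult_distrib[of _ n n _ n] sq_assoc[of _ n])
    also have "\<dots> = D g * Y * (D g' * Y)"
    proof -
      have c: "D g \<in> carrier_mat n n" "D g' \<in> carrier_mat n n" "D (inv\<^bsub>G\<^esub> g') \<in> carrier_mat n n"
        using g PD(2) by auto
      have "D g * Y * (D g' * Y) = D g * ((Y * D g') * Y)"
        using c PD(1) by (simp add: sq_assoc[of _ n])
      also have "\<dots> = D u * (Y * Y)"
        unfolding PD(5)[OF g(2)] u_def using c PD(1) g by (simp add: sq_assoc[of _ n] PD(4))
      finally show ?thesis by simp
    qed
    finally show ?thesis using MX g by simp
  qed
  show "basis_rep n ?M"
    unfolding basis_rep_def
  proof (intro conjI ballI)
    show "?M \<one> = 1\<^sub>m n" using PD(3) by simp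
    fix b c assume b: "b \<in> B" "c \<in> B"
    consider "b \<in> carrier G" "c \<in> carrier G" | "b \<in> carrier G" "c \<in> X" | "b \<in> X" "c \<in> carrier G" | "b \<in> X" "c \<in> X"
      using basis_cases[OF b(1)] basis_cases[OF b(2)] by blast
    then show "?M b * ?M c = lin_ext n ?M (b \<otimes> c)"
    proof cases
      case 1
      then show ?thesis using PD(4) by (simp add: on_basis)
    next
      case 2
      from 2(2) obtain g where g: "g \<in> carrier G" "c = g \<otimes> x\<^sub>0" by (rule X_cases)
      have bc: "b \<otimes> c = (b \<otimes> g) \<otimes> x\<^sub>0" using 2 g by (simp add: m_assoc)
      have "(b \<otimes> g) \<otimes> x\<^sub>0 \<in> B" using 2 g act_X by simp
      then show ?thesis unfolding bc using g 2 PD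
        by (simp add: on_basis MX sq_assoc[of _ n])
    next
      case 3
      from 3(1) obtain g where g: "g \<in> carrier G" "b = g \<otimes> x\<^sub>0" by (rule X_cases)
      have "b \<otimes> c = g \<otimes> (x\<^sub>0 \<otimes> c)" using 3 g by (simp add: m_assoc)
      then have bc: "b \<otimes> c = (g \<otimes> inv\<^bsub>G\<^esub> c) \<otimes> x\<^sub>0" unfolding X_mult_G[OF 3(2) x0_X] using 3(2) g(1) by (simp add: m_assoc)
      have "(g \<otimes> inv\<^bsub>G\<^esub> c) \<otimes> x\<^sub>0 \<in> B" using 3 g act_X by simp
      then show ?thesis unfolding bc using g 3 PD
        by (simp add: on_basis MX sq_assoc[of _ n])
    next
      case 4
      from 4(1) obtain g where g: "g \<in> carrier G" "b = g \<otimes> x\<^sub>0" by (rule X_cases)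
      from 4(2) obtain g' where g': "g' \<in> carrier G" "c = g' \<otimes> x\<^sub>0" by (rule X_cases)
      show ?thesis using XX[OF g(1) g'(1)] g g' by simp
    qed
  qed (rule Mc)
qed

lemma subalgebra_rel_orbit:
  assumes M: "basis_rep n M" and M': "basis_rep n M'" and Q: "subalgebra_rel n Q"
  shows "(\<forall>b\<in>B. Q (M b) (M' b)) \<longleftrightarrow> (\<forall>g\<in>carrier G. Q (M g) (M' g)) \<and> Q (M x\<^sub>0) (M' x\<^sub>0)"
proof
  assume "\<forall>b\<in>B. Q (M b) (M' b)"
  then show "(\<forall>g\<in>carrier G. Q (M g) (M' g)) \<and> Q (M x\<^sub>0) (M' x\<^sub>0)" by simp
next
  assume *: "(\<forall>g\<in>carrier G. Q (M g) (M' g)) \<and> Q (M x\<^sub>0) (M' x\<^sub>0)"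
  show "\<forall>b\<in>B. Q (M b) (M' b)"
  proof
    fix b assume b: "b \<in> B"
    show "Q (M b) (M' b)"
    proof (cases "b \<in> carrier G")
      case False
      then have "b \<in> X" using basis_cases[OF b] by blast
      then obtain g where g: "g \<in> carrier G" "b = g \<otimes> x\<^sub>0" by (rule X_cases)
      show ?thesis
        unfolding g(2) basis_rep_act[OF M g(1) X_basis[OF x0_X]] basis_rep_act[OF M' g(1) X_basis[OF x0_X]]
        by (rule subalgebra_rel_mult[OF Q]) (use M M' g * in \<open>simp_all add: basis_rep_def\<close>)
    qed (use * in simp)
  qed
qed

end

section \<open>Completing the square\<close>

definition affine :: "nat \<Rightarrow> complex \<Rightarrow> complex \<Rightarrow> complex mat \<Rightarrow> complex mat" where
  "affine n a c Y = a \<cdot>\<^sub>m (Y + c \<cdot>\<^sub>m 1\<^sub>m n)"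

lemma affine_carrier [simp]: "Y \<in> carrier_mat n n \<Longrightarrow> affine n a c Y \<in> carrier_mat n n"
  by (simp add: affine_def)

lemma affine_square:
  assumes Y: "Y \<in> carrier_mat n n" and Y2: "Y * Y = p \<cdot>\<^sub>m 1\<^sub>m n + q \<cdot>\<^sub>m Y"
  shows "affine n a c Y * affine n a c Y =
    (a * a * (p + c * c)) \<cdot>\<^sub>m 1\<^sub>m n + (a * a * (q + 2 * c)) \<cdot>\<^sub>m Y"
proof -
  have "affine n a c Y * affine n a c Y = (a * a) \<cdot>\<^sub>m ((Y + c \<cdot>\<^sub>m 1\<^sub>m n) * (Y + c \<cdot>\<^sub>m 1\<^sub>m n))"
    unfolding affine_def using Y
    by (simp add: mult_smult_assoc_mat[of _ n n _ n] mult_smult_distrib[of _ n n _ n] smult_smult_mat)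
  also have "(Y + c \<cdot>\<^sub>m 1\<^sub>m n) * (Y + c \<cdot>\<^sub>m 1\<^sub>m n) = Y * Y + c \<cdot>\<^sub>m Y + (c \<cdot>\<^sub>m Y + (c * c) \<cdot>\<^sub>m 1\<^sub>m n)"
    using Y by (simp add: mult_add_distrib_mat[of _ n n _ n] add_mult_distrib_mat[of _ n n _ _ n] add_smult_distrib_left_mat[of _ n n] smult_smult_mat)
  also have "(a * a) \<cdot>\<^sub>m (Y * Y + c \<cdot>\<^sub>m Y + (c \<cdot>\<^sub>m Y + (c * c) \<cdot>\<^sub>m 1\<^sub>m n)) =
      (a * a * (p + c * c)) \<cdot>\<^sub>m 1\<^sub>m n + (a * a * (q + 2 * c)) \<cdot>\<^sub>m Y"
    unfolding Y2 by (rule eq_matI) (use Y in \<open>auto simp: algebra_simps\<close>)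
  finally show ?thesis .
qed

lemma affine_commute:
  assumes "Y \<in> carrier_mat n n" "A \<in> carrier_mat n n" "A' \<in> carrier_mat n n" "Y * A = A' * Y" "c \<cdot>\<^sub>m A = c \<cdot>\<^sub>m A'"
  shows "affine n a c Y * A = A' * affine n a c Y"
  using assms unfolding affine_def
  by (simp add: mult_smult_assoc_mat[of _ n n _ n] mult_smult_distrib[of _ n n _ n]
      mult_add_distrib_mat[of _ n n _ n] add_mult_distrib_mat[of _ n n _ _ n])

text \<open>The inverse of \<open>Y \<mapsto> a (Y + c)\<close> is \<open>S \<mapsto> a\<^sup>-\<^sup>1 (S - c a)\<close>.\<close>

lemma affine_inverse:
  assumes "Y \<in> carrier_mat n n" "a * b = 1" "d = - c * a"
  shows "affine n b d (affine n a c Y) = Y"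
proof (rule eq_matI)
  fix i j assume "i < dim_row Y" "j < dim_col Y"
  then have ij: "i < n" "j < n" using assms by auto
  have "b * (a * (y + c * e) + d * e) = y" for y e
  proof -
    have "b * (a * (y + c * e) + d * e) = (a * b) * y" unfolding assms(3) by (simp add: algebra_simps)
    then show ?thesis by (simp add: assms(2))
  qed
  then show "affine n b d (affine n a c Y) $$ (i, j) = Y $$ (i, j)"
    using ij assms(1) by (simp add: affine_def)
qed (use assms in \<open>auto simp: affine_def\<close>)

lemma subalgebra_rel_affine:
  assumes "subalgebra_rel n Q" "Y \<in> carrier_mat n n" "Y' \<in> carrier_mat n n" "Q Y Y'"
  shows "Q (affine n a c Y) (affine n a c Y')"
  unfolding affine_def
  by (intro subalgebra_rel_smult[OF assms(1)] subalgebra_rel_add[OF assms(1)] subalgebra_rel_one[OF assms(1)])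
    (use assms in auto)

context self_dual_uniform_fusion_ring
begin

text \<open>For a representation \<open>D\<close> of \<open>G\<close> the sum over \<open>G\<close> is \<open>|G|\<close> times the projection onto the invariants. The two
  alternatives are what Schur's lemma leaves when this sum commutes with an irreducible representation.\<close>

definition trivial_or_no_invariants :: "nat \<Rightarrow> ('a \<Rightarrow> complex mat) \<Rightarrow> bool" where
  "trivial_or_no_invariants n D \<longleftrightarrow> (\<forall>g\<in>carrier G. D g = 1\<^sub>m n) \<or> msum n D (carrier G) = 0\<^sub>m n n"

text \<open>The scalar by which \<open>k |H|\<^sup>-\<^sup>1 \<Sum>\<^sub>g D g\<close> acts, see \<open>scaled_msum_G\<close>.\<close>

definition \<mu> :: "nat \<Rightarrow> ('a \<Rightarrow> complex mat) \<Rightarrow> complex" where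
  "\<mu> n D = (if \<forall>g\<in>carrier G. D g = 1\<^sub>m n
     then of_nat \<kappa> / of_nat (card H) * of_nat (card (carrier G)) else 0)"

text \<open>Half the difference of the two roots of \<open>t\<^sup>2 = |H| + \<mu> t\<close>.\<close>

definition half_gap where "half_gap n D = csqrt (of_nat (card H) + (\<mu> n D / 2) * (\<mu> n D / 2))"

lemma half_gap_nonzero: "half_gap n D \<noteq> 0"
proof -
  define m :: real where "m = (if \<forall>g\<in>carrier G. D g = 1\<^sub>m n
     then of_nat \<kappa> / of_nat (card H) * of_nat (card (carrier G)) else 0)"
  have m: "\<mu> n D = of_real m" by (simp add: \<mu>_def m_def)
  have "real (card H) + m / 2 * (m / 2) > 0"
    using card_H_pos by (intro add_pos_nonneg) auto
  then have "complex_of_real (real (card H) + m / 2 * (m / 2)) \<noteq> 0"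
    by (metis less_irrefl of_real_eq_0_iff)
  moreover have "complex_of_real (real (card H) + m / 2 * (m / 2)) = of_nat (card H) + (\<mu> n D / 2) * (\<mu> n D / 2)"
    by (simp add: m)
  ultimately have "of_nat (card H) + (\<mu> n D / 2) * (\<mu> n D / 2) \<noteq> 0" by metis
  then show ?thesis by (simp add: half_gap_def)
qed

lemma half_gap_square: "half_gap n D * half_gap n D = of_nat (card H) + (\<mu> n D / 2) * (\<mu> n D / 2)"
  unfolding half_gap_def power2_eq_square[symmetric] power2_csqrt ..

lemma scaled_msum_G:
  assumes "trivial_or_no_invariants n D"
  shows "(of_nat \<kappa> / of_nat (card H)) \<cdot>\<^sub>m msum n D (carrier G) = \<mu> n D \<cdot>\<^sub>m 1\<^sub>m n"
proof (cases "\<forall>g\<in>carrier G. D g = 1\<^sub>m n")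
  case True
  then have "msum n D (carrier G) = msum n (\<lambda>_. 1\<^sub>m n) (carrier G)" by (intro msum_cong) auto
  then show ?thesis using True by (simp add: msum_const \<mu>_def smult_smult_mat)
next
  case False
  then have "msum n D (carrier G) = 0\<^sub>m n n" using assms unfolding trivial_or_no_invariants_def by blast
  then show ?thesis using False by (auto simp: \<mu>_def intro!: eq_matI)
qed

text \<open>If \<open>\<mu> \<noteq> 0\<close> then \<open>D\<close> is trivial.\<close>

lemma \<mu>_smult:
  assumes "g \<in> carrier G" "D g \<in> carrier_mat n n"
  shows "\<mu> n D \<cdot>\<^sub>m D g = \<mu> n D \<cdot>\<^sub>m 1\<^sub>m n"
proof (cases "\<forall>g\<in>carrier G. D g = 1\<^sub>m n")
  case False
  then show ?thesis using assms by (auto simp: \<mu>_def intro!: eq_matI)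
qed (use assms in simp)

lemma inv_bij: "bij_betw (\<lambda>g. inv\<^bsub>G\<^esub> g) (carrier G) (carrier G)"
  by (rule bij_betwI[of _ _ _ "\<lambda>g. inv\<^bsub>G\<^esub> g"]) auto

text \<open>Moving \<open>Y\<close> past the sum inverts the summation variable.\<close>

lemma msum_commute_Y:
  assumes D: "\<And>g. g \<in> carrier G \<Longrightarrow> D g \<in> carrier_mat n n" and Y: "Y \<in> carrier_mat n n"
    and YD: "\<And>g. g \<in> carrier G \<Longrightarrow> Y * D g = D (inv\<^bsub>G\<^esub> g) * Y"
  shows "msum n D (carrier G) * Y = Y * msum n D (carrier G)"
proof -
  have "Y * msum n D (carrier G) = msum n (\<lambda>g. Y * D g) (carrier G)"
    by (rule mult_msum) (use D Y in auto)
  also have "\<dots> = msum n (\<lambda>g. D (inv\<^bsub>G\<^esub> g) * Y) (carrier G)"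
    by (rule msum_cong) (use YD in auto)
  also have "\<dots> = msum n (\<lambda>g. D g * Y) (carrier G)" by (rule msum_reindex[OF inv_bij])
  also have "\<dots> = msum n D (carrier G) * Y" by (rule msum_mult[symmetric]) (use D Y in auto)
  finally show ?thesis by simp
qed

lemma msum_absorb:
  assumes D: "\<And>g. g \<in> carrier G \<Longrightarrow> D g \<in> carrier_mat n n"
    and mult: "\<And>g g'. g \<in> carrier G \<Longrightarrow> g' \<in> carrier G \<Longrightarrow> D (g \<otimes> g') = D g * D g'" and g: "g \<in> carrier G"
  shows "D g * msum n D (carrier G) = msum n D (carrier G)" "msum n D (carrier G) * D g = msum n D (carrier G)"
proof -
  show 1: "D g * msum n D (carrier G) = msum n D (carrier G)"
    by (rule msum_translate[OF G.group_axioms G.subgroup_self g]) (use D g mult in auto)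
  have "msum n D (carrier G) * D g = msum n (\<lambda>x. D x * D g) (carrier G)"
    by (rule msum_mult) (use D g in auto)
  also have "\<dots> = msum n (\<lambda>x. D g * D x) (carrier G)"
    by (rule msum_cong) (use g G_comm mult in metis)+
  also have "\<dots> = D g * msum n D (carrier G)" by (rule mult_msum[symmetric]) (use D g in auto)
  finally show "msum n D (carrier G) * D g = msum n D (carrier G)" using 1 by simp
qed

lemma trivial_or_no_invariants_of_scalar:
  assumes D: "\<And>g. g \<in> carrier G \<Longrightarrow> D g \<in> carrier_mat n n"
    and mult: "\<And>g g'. g \<in> carrier G \<Longrightarrow> g' \<in> carrier G \<Longrightarrow> D (g \<otimes> g') = D g * D g'"
    and c: "msum n D (carrier G) = c \<cdot>\<^sub>m 1\<^sub>m n"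
  shows "trivial_or_no_invariants n D"
proof (cases "c = 0")
  case True
  have "msum n D (carrier G) = 0\<^sub>m n n" unfolding c True by (rule eq_matI) auto
  then show ?thesis by (simp add: trivial_or_no_invariants_def)
next
  case False
  have "D g = 1\<^sub>m n" if g: "g \<in> carrier G" for g
    using msum_absorb(1)[OF D mult g] D[OF g] False unfolding c by (intro smult_diff_one[of _ n c]) auto
  then show ?thesis by (simp add: trivial_or_no_invariants_def)
qed

section \<open>Representations of the generalized dihedral group\<close>

text \<open>A representation of \<open>\<Gamma>\<close> by the matrices \<open>D g\<close> of the cosets of \<open>g \<in> G\<close> and the matrix \<open>S\<close> of the generator
  of \<open>C\<^sub>2\<close>.\<close>

definition dihedral_rep :: "nat \<Rightarrow> ('a \<Rightarrow> complex mat) \<Rightarrow> complex mat \<Rightarrow> bool" where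
  "dihedral_rep n D S \<longleftrightarrow> S \<in> carrier_mat n n \<and> (\<forall>g\<in>carrier G. D g \<in> carrier_mat n n) \<and> D \<one> = 1\<^sub>m n \<and>
     (\<forall>g\<in>carrier G. \<forall>g'\<in>carrier G. D (g \<otimes> g') = D g * D g') \<and>
     (\<forall>g\<in>carrier G. S * D g = D (inv\<^bsub>G\<^esub> g) * S) \<and> (\<forall>h\<in>H. D h = 1\<^sub>m n) \<and> S * S = 1\<^sub>m n"

lemma dihedral_repD:
  assumes "dihedral_rep n D S"
  shows "S \<in> carrier_mat n n" "g \<in> carrier G \<Longrightarrow> D g \<in> carrier_mat n n" "D \<one> = 1\<^sub>m n"
    "g \<in> carrier G \<Longrightarrow> g' \<in> carrier G \<Longrightarrow> D (g \<otimes> g') = D g * D g'"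
    "g \<in> carrier G \<Longrightarrow> S * D g = D (inv\<^bsub>G\<^esub> g) * S" "h \<in> H \<Longrightarrow> D h = 1\<^sub>m n" "S * S = 1\<^sub>m n"
  using assms by (simp_all add: dihedral_rep_def)

text \<open>On eigenvalues this sends the two roots \<open>\<mu>/2 \<plusminus> half_gap\<close> of \<open>t\<^sup>2 = |H| + \<mu> t\<close> to \<open>\<plusminus> 1\<close>.\<close>

definition reflection where
  "reflection n D Y = affine n (1 / half_gap n D) (- (\<mu> n D / 2)) Y"

definition unreflection where
  "unreflection n D S = affine n (half_gap n D) (\<mu> n D / 2 / half_gap n D) S"

lemma unreflection_reflection:
  "Y \<in> carrier_mat n n \<Longrightarrow> unreflection n D (reflection n D Y) = Y"
  unfolding unreflection_def reflection_def using half_gap_nonzero[of n D] by (intro affine_inverse) auto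

lemma reflection_unreflection:
  "S \<in> carrier_mat n n \<Longrightarrow> reflection n D (unreflection n D S) = S"
  unfolding unreflection_def reflection_def using half_gap_nonzero[of n D] by (intro affine_inverse) auto

lemma \<mu>_half_smult:
  assumes "g \<in> carrier G" "D g \<in> carrier_mat n n" "g' \<in> carrier G" "D g' \<in> carrier_mat n n"
  shows "(\<mu> n D * t) \<cdot>\<^sub>m D g = (\<mu> n D * t) \<cdot>\<^sub>m D g'"
proof -
  have "t \<cdot>\<^sub>m (\<mu> n D \<cdot>\<^sub>m D g) = t \<cdot>\<^sub>m (\<mu> n D \<cdot>\<^sub>m D g')" using assms by (simp add: \<mu>_smult)
  then show ?thesis by (simp add: smult_smult_mat mult.commute)
qed

text \<open>With \<open>Y\<^sup>2 = |H| + \<mu> Y\<close> the square of \<open>Y - \<mu>/2\<close> is the scalar \<open>|H| + \<mu>\<^sup>2/4\<close>. Subtracting \<open>\<mu>/2\<close> does not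
  disturb the commutation with \<open>D g\<close>, because \<open>\<mu> D g\<close> does not depend on \<open>g\<close>.\<close>

lemma dihedral_rep_reflection:
  assumes P: "orbit_rep n D Y" and H1: "\<And>h. h \<in> H \<Longrightarrow> D h = 1\<^sub>m n" and iso: "trivial_or_no_invariants n D"
  shows "dihedral_rep n D (reflection n D Y)"
proof -
  note PD = orbit_repD[OF P]
  have Y2: "Y * Y = of_nat (card H) \<cdot>\<^sub>m 1\<^sub>m n + \<mu> n D \<cdot>\<^sub>m Y"
  proof -
    have "msum n D H = msum n (\<lambda>_. 1\<^sub>m n) H" by (intro msum_cong) (auto simp: H1)
    then have h: "msum n D H = of_nat (card H) \<cdot>\<^sub>m 1\<^sub>m n" by (simp add: msum_const)
    have "(of_nat \<kappa> / of_nat (card H)) \<cdot>\<^sub>m (msum n D (carrier G) * Y) = (\<mu> n D \<cdot>\<^sub>m 1\<^sub>m n) * Y"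
      unfolding scaled_msum_G[OF iso, symmetric] using PD(1)
      by (simp add: mult_smult_assoc_mat[of _ n n _ n])
    then show ?thesis using PD(7) h PD(1) by simp
  qed
  have "reflection n D Y * reflection n D Y = 1\<^sub>m n"
  proof -
    have "(1 / half_gap n D) * (1 / half_gap n D) * (of_nat (card H) + (- (\<mu> n D / 2)) * (- (\<mu> n D / 2))) = 1"
      unfolding minus_mult_minus half_gap_square[symmetric] using half_gap_nonzero[of n D] by simp
    then have "reflection n D Y * reflection n D Y = 1 \<cdot>\<^sub>m 1\<^sub>m n + 0 \<cdot>\<^sub>m Y"
      unfolding reflection_def affine_square[OF PD(1) Y2] by simp
    also have "\<dots> = 1\<^sub>m n" by (rule eq_matI) (use PD(1) in auto)
    finally show ?thesis .
  qed
  moreover have "reflection n D Y * D g = D (inv\<^bsub>G\<^esub> g) * reflection n D Y" if g: "g \<in> carrier G" for g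
    unfolding reflection_def using \<mu>_half_smult[of g D n "inv\<^bsub>G\<^esub> g" "- (1 / 2)"] g PD
    by (intro affine_commute) simp_all
  moreover have "reflection n D Y \<in> carrier_mat n n" using PD(1) by (simp add: reflection_def)
  ultimately show ?thesis using PD H1 by (simp add: dihedral_rep_def)
qed

lemma orbit_rep_unreflection:
  assumes P: "dihedral_rep n D S" and iso: "trivial_or_no_invariants n D"
  shows "orbit_rep n D (unreflection n D S)"
proof -
  note PD = dihedral_repD[OF P]
  let ?Y = "unreflection n D S"
  have Y: "?Y \<in> carrier_mat n n" using PD(1) by (simp add: unreflection_def)
  have S2: "S * S = 1 \<cdot>\<^sub>m 1\<^sub>m n + 0 \<cdot>\<^sub>m S" unfolding PD(7) by (rule eq_matI) (use PD(1) in auto)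
  let ?r = "half_gap n D" and ?m = "\<mu> n D"
  have Y2: "?Y * ?Y = of_nat (card H) \<cdot>\<^sub>m 1\<^sub>m n + ?m \<cdot>\<^sub>m ?Y"
  proof -
    have 1: "?r * ?r * (1 + ?m / 2 / ?r * (?m / 2 / ?r)) = of_nat (card H) + ?m * (?r * (?m / 2 / ?r))"
    proof -
      have "?r * ?r * (1 + ?m / 2 / ?r * (?m / 2 / ?r)) = ?r * ?r + ?m / 2 * (?m / 2)"
        using half_gap_nonzero[of n D] by (simp add: field_simps)
      moreover have "?r * (?m / 2 / ?r) = ?m / 2" using half_gap_nonzero[of n D] by simp
      ultimately show ?thesis unfolding half_gap_square by simp
    qed
    have 2: "?r * ?r * (0 + 2 * (?m / 2 / ?r)) = ?m * ?r"
      using half_gap_nonzero[of n D] by (simp add: field_simps)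
    have "?Y * ?Y = (of_nat (card H) + ?m * (?r * (?m / 2 / ?r))) \<cdot>\<^sub>m 1\<^sub>m n + (?m * ?r) \<cdot>\<^sub>m S"
      unfolding unreflection_def affine_square[OF PD(1) S2] 1 2 ..
    also have "\<dots> = of_nat (card H) \<cdot>\<^sub>m 1\<^sub>m n + ?m \<cdot>\<^sub>m ?Y"
      unfolding unreflection_def affine_def by (rule eq_matI) (use PD(1) in \<open>auto simp: algebra_simps\<close>)
    finally show ?thesis .
  qed
  have "msum n D H = msum n (\<lambda>_. 1\<^sub>m n) H" by (intro msum_cong) (auto simp: PD(6))
  then have h: "msum n D H = of_nat (card H) \<cdot>\<^sub>m 1\<^sub>m n" by (simp add: msum_const)
  have "(of_nat \<kappa> / of_nat (card H)) \<cdot>\<^sub>m (msum n D (carrier G) * ?Y) = (?m \<cdot>\<^sub>m 1\<^sub>m n) * ?Y"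
    unfolding scaled_msum_G[OF iso, symmetric] using Y
    by (simp add: mult_smult_assoc_mat[of _ n n _ n])
  then have "?Y * ?Y = msum n D H + (of_nat \<kappa> / of_nat (card H)) \<cdot>\<^sub>m (msum n D (carrier G) * ?Y)"
    using Y2 h Y by simp
  moreover have "?Y * D g = D (inv\<^bsub>G\<^esub> g) * ?Y" if g: "g \<in> carrier G" for g
    unfolding unreflection_def using \<mu>_half_smult[of g D n "inv\<^bsub>G\<^esub> g" "1 / 2 / ?r"] g PD
    by (intro affine_commute) simp_all
  ultimately show ?thesis using PD Y by (simp add: orbit_rep_def)
qed

definition dihedral_map :: "nat \<Rightarrow> ('a \<Rightarrow> complex mat) \<Rightarrow> complex mat \<Rightarrow> 'a set \<times> int \<Rightarrow> complex mat" where
  "dihedral_map n D S = (\<lambda>(C, c). D (SOME g. g \<in> carrier G \<and> C = coset g) * (if c = 0 then 1\<^sub>m n else S))"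

lemma \<Gamma>_cases:
  assumes "\<gamma> \<in> carrier \<Gamma>"
  obtains g where "g \<in> carrier G" "\<gamma> = (coset g, 0)" | g where "g \<in> carrier G" "\<gamma> = (coset g, 1)"
  using assms by (auto simp: carrier_\<Gamma> GH_carrier)

lemma coset_\<Gamma>: "g \<in> carrier G \<Longrightarrow> (coset g, 0) \<in> carrier \<Gamma>" "g \<in> carrier G \<Longrightarrow> (coset g, 1) \<in> carrier \<Gamma>"
  by (auto simp: carrier_\<Gamma> GH_carrier)

text \<open>Since \<open>D\<close> is trivial on \<open>H\<close>, the representative chosen in \<open>dihedral_map\<close> does not matter.\<close>

lemma dihedral_map_coset:
  assumes P: "dihedral_rep n D S" and g: "g \<in> carrier G"
  shows "dihedral_map n D S (coset g, 0) = D g" "dihedral_map n D S (coset g, 1) = D g * S"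
proof -
  note PD = dihedral_repD[OF P]
  define k where "k = (SOME k. k \<in> carrier G \<and> coset g = coset k)"
  have k: "k \<in> carrier G" "coset g = coset k"
    unfolding k_def by (metis (mono_tags, lifting) g someI_ex)+
  have h: "inv\<^bsub>G\<^esub> k \<otimes> g \<in> H" using coset_eq_iff[OF g k(1)] k(2) by simp
  have "k \<otimes> (inv\<^bsub>G\<^esub> k \<otimes> g) = g" using g k(1) by (simp add: G_inv_cancel)
  then have "D g = D k * D (inv\<^bsub>G\<^esub> k \<otimes> g)"
    using PD(4)[OF k(1) H_G[OF h]] by simp
  also have "\<dots> = D k" unfolding PD(6)[OF h] using PD(2)[OF k(1)] by simp
  finally have "D k = D g" by simp
  then show "dihedral_map n D S (coset g, 0) = D g" "dihedral_map n D S (coset g, 1) = D g * S"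
    using PD(2)[OF g] by (simp_all add: dihedral_map_def k_def)
qed

lemma group_rep_dihedral_map:
  assumes P: "dihedral_rep n D S"
  shows "group_rep \<Gamma> (n, dihedral_map n D S)"
proof (rule group_repI)
  note PD = dihedral_repD[OF P]
  note map = dihedral_map_coset[OF P]
  show "dihedral_map n D S \<gamma> \<in> carrier_mat n n" if "\<gamma> \<in> carrier \<Gamma>" for \<gamma>
    using that by (rule \<Gamma>_cases) (use PD in \<open>simp_all add: map\<close>)
  show "dihedral_map n D S \<one>\<^bsub>\<Gamma>\<^esub> = 1\<^sub>m n" by (simp add: \<Gamma>_one map PD(3))
  fix x assume x: "x \<in> carrier \<Gamma>"
  show "\<exists>y\<in>carrier \<Gamma>. y \<otimes>\<^bsub>\<Gamma>\<^esub> x = \<one>\<^bsub>\<Gamma>\<^esub> \<and> x \<otimes>\<^bsub>\<Gamma>\<^esub> y = \<one>\<^bsub>\<Gamma>\<^esub>"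
    using x
  proof (rule \<Gamma>_cases)
    fix g assume "g \<in> carrier G" "x = (coset g, 0)"
    then show ?thesis
      by (intro bexI[of _ "(coset (inv\<^bsub>G\<^esub> g), 0)"]) (simp_all add: \<Gamma>_mult \<Gamma>_one coset_\<Gamma>)
  next
    fix g assume "g \<in> carrier G" "x = (coset g, 1)"
    then show ?thesis
      by (intro bexI[of _ "(coset g, 1)"]) (simp_all add: \<Gamma>_mult \<Gamma>_one coset_\<Gamma>)
  qed
  fix y assume y: "y \<in> carrier \<Gamma>"
  show "dihedral_map n D S (x \<otimes>\<^bsub>\<Gamma>\<^esub> y) = dihedral_map n D S x * dihedral_map n D S y"
    using x
  proof (rule \<Gamma>_cases)
    fix g assume g: "g \<in> carrier G" "x = (coset g, 0)"
    show ?thesis using y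
      by (rule \<Gamma>_cases) (use g PD in \<open>simp_all add: \<Gamma>_mult map sq_assoc[of _ n]\<close>)
  next
    fix g assume g: "g \<in> carrier G" "x = (coset g, 1)"
    show ?thesis using y
    proof (rule \<Gamma>_cases)
      fix g' assume g': "g' \<in> carrier G" "y = (coset g', 0)"
      show ?thesis using g g' PD by (simp add: \<Gamma>_mult map sq_assoc[of _ n])
    next
      fix g' assume g': "g' \<in> carrier G" "y = (coset g', 1)"
      have i: "inv\<^bsub>G\<^esub> g' \<in> carrier G" using g' by simp
      have "D g * S * (D g' * S) = D g * ((S * D g') * S)"
        using PD(1) PD(2)[OF g(1)] PD(2)[OF g'(1)] by (simp add: sq_assoc[of _ n])
      also have "\<dots> = D g * D (inv\<^bsub>G\<^esub> g')"
        unfolding PD(5)[OF g'(1)] using PD(1,7) PD(2)[OF g(1)] PD(2)[OF i] by (simp add: sq_assoc[of _ n])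
      finally show ?thesis using g g' i by (simp add: \<Gamma>_mult map PD(4))
    qed
  qed
qed

lemma dihedral_rep_of_group_rep:
  assumes \<sigma>: "group_rep \<Gamma> (n, \<sigma>)"
  defines "D \<equiv> \<lambda>g. \<sigma> (coset g, 0)" and "S \<equiv> \<sigma> (coset \<one>, 1)"
  shows "dihedral_rep n D S" "\<gamma> \<in> carrier \<Gamma> \<Longrightarrow> dihedral_map n D S \<gamma> = \<sigma> \<gamma>"
proof -
  have mult: "\<sigma> (x \<otimes>\<^bsub>\<Gamma>\<^esub> y) = \<sigma> x * \<sigma> y" if "x \<in> carrier \<Gamma>" "y \<in> carrier \<Gamma>" for x y
    using group_rep_mult[OF \<sigma> that] by simp
  have c: "\<sigma> x \<in> carrier_mat n n" if "x \<in> carrier \<Gamma>" for x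
    using group_rep_square[OF \<sigma>] that by (simp add: square_rep_def)
  note one = coset_\<Gamma>(1)[OF G_one_closed] coset_\<Gamma>(2)[OF G_one_closed]
  have D1: "D \<one> = 1\<^sub>m n"
    using group_rep_one[OF \<sigma>] one \<Gamma>_mult(1)[OF G_one_closed G_one_closed, of 0] by (simp add: \<Gamma>_one D_def)
  have DS: "\<sigma> (coset g, 1) = D g * S" if g: "g \<in> carrier G" for g
    using mult[OF coset_\<Gamma>(1)[OF g] one(2)] \<Gamma>_mult(1)[OF g G_one_closed, of 1] g by (simp add: D_def S_def)
  have SD: "S * D g = \<sigma> (coset (inv\<^bsub>G\<^esub> g), 1)" if g: "g \<in> carrier G" for g
    using mult[OF one(2) coset_\<Gamma>(1)[OF g]] \<Gamma>_mult(2)[OF G_one_closed g, of 0] g by (simp add: D_def S_def)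
  have SS: "S * S = 1\<^sub>m n"
    using mult[OF one(2) one(2)] \<Gamma>_mult(2)[OF G_one_closed G_one_closed, of 1] D1 by (simp add: D_def S_def)
  have Dm: "D (g \<otimes> g') = D g * D g'" if "g \<in> carrier G" "g' \<in> carrier G" for g g'
    using mult[OF coset_\<Gamma>(1)[OF that(1)] coset_\<Gamma>(1)[OF that(2)]] \<Gamma>_mult(1)[OF that, of 0] by (simp add: D_def)
  have DH: "D h = 1\<^sub>m n" if h: "h \<in> H" for h
  proof -
    have "coset h = coset \<one>" using coset_eq_iff[OF H_G[OF h] G_one_closed] G.inv_one H_G[OF h] h by simp
    then show ?thesis using D1 by (simp add: D_def)
  qed
  show P: "dihedral_rep n D S"
    unfolding dihedral_rep_def
  proof (intro conjI ballI)
    show "S \<in> carrier_mat n n" unfolding S_def by (rule c[OF one(2)])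
    show "D g \<in> carrier_mat n n" if "g \<in> carrier G" for g unfolding D_def by (rule c[OF coset_\<Gamma>(1)[OF that]])
    show "S * D g = D (inv\<^bsub>G\<^esub> g) * S" if "g \<in> carrier G" for g using SD[OF that] DS[of "inv\<^bsub>G\<^esub> g"] that by simp
  qed (use D1 Dm DH SS in auto)
  show "dihedral_map n D S \<gamma> = \<sigma> \<gamma>" if "\<gamma> \<in> carrier \<Gamma>"
    using that
  proof (rule \<Gamma>_cases)
    fix g assume g: "g \<in> carrier G" "\<gamma> = (coset g, 0)"
    show ?thesis unfolding g(2) dihedral_map_coset(1)[OF P g(1)] by (simp add: D_def)
  next
    fix g assume g: "g \<in> carrier G" "\<gamma> = (coset g, 1)"
    show ?thesis unfolding g(2) dihedral_map_coset(2)[OF P g(1)] DS[OF g(1)] ..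
  qed
qed

lemma subalgebra_rel_dihedral_map:
  assumes P: "dihedral_rep n D S" and P': "dihedral_rep n D' S'" and Q: "subalgebra_rel n Q"
  shows "(\<forall>\<gamma>\<in>carrier \<Gamma>. Q (dihedral_map n D S \<gamma>) (dihedral_map n D' S' \<gamma>)) \<longleftrightarrow>
    (\<forall>g\<in>carrier G. Q (D g) (D' g)) \<and> Q S S'"
proof
  note m = dihedral_map_coset[OF P] and m' = dihedral_map_coset[OF P']
  note PD = dihedral_repD[OF P] and PD' = dihedral_repD[OF P']
  {
    assume *: "\<forall>\<gamma>\<in>carrier \<Gamma>. Q (dihedral_map n D S \<gamma>) (dihedral_map n D' S' \<gamma>)"
    have "Q (D g) (D' g)" if "g \<in> carrier G" for g
      using bspec[OF * coset_\<Gamma>(1)[OF that]] unfolding m(1)[OF that] m'(1)[OF that] .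
    moreover have "Q (D \<one> * S) (D' \<one> * S')"
      using bspec[OF * coset_\<Gamma>(2)[OF G_one_closed]] unfolding m(2)[OF G_one_closed] m'(2)[OF G_one_closed] .
    ultimately show "(\<forall>g\<in>carrier G. Q (D g) (D' g)) \<and> Q S S'"
      using PD(1,3) PD'(1,3) by simp
  }
  assume *: "(\<forall>g\<in>carrier G. Q (D g) (D' g)) \<and> Q S S'"
  show "\<forall>\<gamma>\<in>carrier \<Gamma>. Q (dihedral_map n D S \<gamma>) (dihedral_map n D' S' \<gamma>)"
  proof
    fix \<gamma> assume "\<gamma> \<in> carrier \<Gamma>"
    then show "Q (dihedral_map n D S \<gamma>) (dihedral_map n D' S' \<gamma>)"
    proof (rule \<Gamma>_cases)
      fix g assume g: "g \<in> carrier G" "\<gamma> = (coset g, 0)"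
      show ?thesis unfolding g(2) m(1)[OF g(1)] m'(1)[OF g(1)] using * g(1) by blast
    next
      fix g assume g: "g \<in> carrier G" "\<gamma> = (coset g, 1)"
      show ?thesis unfolding g(2) m(2)[OF g(1)] m'(2)[OF g(1)]
        by (rule subalgebra_rel_mult[OF Q]) (use * g PD PD' in simp_all)
    qed
  qed
qed

lemma subalgebra_rel_reflection:
  assumes Q: "subalgebra_rel n Q" and Y: "Y \<in> carrier_mat n n" "Y' \<in> carrier_mat n n" and m: "\<mu> n D = \<mu> n D'"
  shows "Q (reflection n D Y) (reflection n D' Y') \<longleftrightarrow> Q Y Y'"
proof
  have r: "half_gap n D = half_gap n D'" using m by (simp add: half_gap_def)
  show "Q (reflection n D Y) (reflection n D' Y')" if "Q Y Y'"
    unfolding reflection_def m r by (rule subalgebra_rel_affine[OF Q Y that])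
  assume "Q (reflection n D Y) (reflection n D' Y')"
  then have "Q (unreflection n D (reflection n D Y)) (unreflection n D' (reflection n D' Y'))"
    unfolding unreflection_def m r
    by (rule subalgebra_rel_affine[OF Q, rotated 2]) (use Y in \<open>simp_all add: reflection_def\<close>)
  then show "Q Y Y'" using unreflection_reflection Y by simp
qed

section \<open>The two kinds of irreducible representations\<close>

definition H_trivial :: "('a \<Rightarrow> complex) rep \<Rightarrow> bool" where
  "H_trivial \<rho> \<longleftrightarrow> (\<forall>h\<in>H. basis_values \<rho> h = 1\<^sub>m (fst \<rho>))"

definition group_part :: "('a \<Rightarrow> complex) rep \<Rightarrow> 'a rep" where
  "group_part \<rho> = (fst \<rho>, basis_values \<rho>)"

definition dihedral_part :: "('a \<Rightarrow> complex) rep \<Rightarrow> ('a set \<times> int) rep" where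
  "dihedral_part \<rho> = (fst \<rho>, dihedral_map (fst \<rho>) (basis_values \<rho>)
     (reflection (fst \<rho>) (basis_values \<rho>) (basis_values \<rho> x\<^sub>0)))"

lemma orbit_rep_of_alg_rep:
  assumes "alg_rep RC (n, \<rho>)"
  shows "orbit_rep n (basis_values (n, \<rho>)) (basis_values (n, \<rho>) x\<^sub>0)"
  by (rule orbit_rep_of_basis_rep[OF basis_rep_of_alg_rep[OF assms]])

lemma group_rep_G:
  assumes D: "\<And>g. g \<in> carrier G \<Longrightarrow> D g \<in> carrier_mat n n" and one: "D \<one> = 1\<^sub>m n"
    and mult: "\<And>g g'. g \<in> carrier G \<Longrightarrow> g' \<in> carrier G \<Longrightarrow> D (g \<otimes> g') = D g * D g'"
  shows "group_rep G (n, D)"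
proof (rule group_repI)
  fix x assume "x \<in> carrier G"
  then show "\<exists>y\<in>carrier G. y \<otimes>\<^bsub>G\<^esub> x = \<one>\<^bsub>G\<^esub> \<and> x \<otimes>\<^bsub>G\<^esub> y = \<one>\<^bsub>G\<^esub>"
    by (intro bexI[of _ "inv\<^bsub>G\<^esub> x"]) simp_all
qed (use assms in simp_all)

lemma group_rep_group_part:
  assumes "alg_rep RC \<rho>"
  shows "group_rep G (group_part \<rho>)"
proof -
  obtain n r where \<rho>: "\<rho> = (n, r)" by (cases \<rho>)
  note P = orbit_repD[OF orbit_rep_of_alg_rep[OF assms[unfolded \<rho>]]]
  show ?thesis unfolding \<rho> group_part_def fst_conv by (rule group_rep_G) (fact P(2) P(3) P(4))+
qed

text \<open>The matrices commuting with all \<open>D g\<close> and with \<open>Y\<close> commute with the whole representation, so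
  they are scalars if it is irreducible.\<close>

lemma schur_alg:
  assumes \<rho>: "alg_rep RC (n, \<rho>)" and irr: "irreducible_rep (carrier RC) (n, \<rho>)"
    and Z: "Z \<in> carrier_mat n n"
    and comm: "\<And>g. g \<in> carrier G \<Longrightarrow> Z * basis_values (n, \<rho>) g = basis_values (n, \<rho>) g * Z"
      "Z * basis_values (n, \<rho>) x\<^sub>0 = basis_values (n, \<rho>) x\<^sub>0 * Z"
  obtains c where "Z = c \<cdot>\<^sub>m 1\<^sub>m n"
proof -
  note Q = subalgebra_rel_intertwiner[OF Z]
  note M = basis_rep_of_alg_rep[OF \<rho>]
  have "\<forall>f\<in>carrier RC. Z * \<rho> f = \<rho> f * Z"
    unfolding subalgebra_rel_basis_values[OF \<rho> \<rho> Q] subalgebra_rel_orbit[OF M M Q] using comm by blast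
  then show thesis using schur[OF irr alg_rep_square[OF \<rho>] Z] that by blast
qed

text \<open>The sum of all \<open>D g\<close> commutes with the representation.\<close>

lemma trivial_or_no_invariants_basis_values:
  assumes \<rho>: "alg_rep RC (n, \<rho>)" and irr: "irreducible_rep (carrier RC) (n, \<rho>)"
  shows "trivial_or_no_invariants n (basis_values (n, \<rho>))"
proof -
  note P = orbit_repD[OF orbit_rep_of_alg_rep[OF \<rho>]]
  let ?M = "basis_values (n, \<rho>)"
  note absorb = msum_absorb[of ?M n, OF P(2) P(4)]
  obtain c where c: "msum n ?M (carrier G) = c \<cdot>\<^sub>m 1\<^sub>m n"
  proof (rule schur_alg[OF \<rho> irr msum_carrier])
    show "msum n ?M (carrier G) * ?M g = ?M g * msum n ?M (carrier G)" if "g \<in> carrier G" for g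
      using absorb[OF _ _ _ that] by simp
    show "msum n ?M (carrier G) * ?M x\<^sub>0 = ?M x\<^sub>0 * msum n ?M (carrier G)"
      by (rule msum_commute_Y[of ?M n, OF P(2) P(1) P(5)])
  qed
  show ?thesis by (rule trivial_or_no_invariants_of_scalar[OF P(2) P(4) c])
qed

text \<open>For \<open>h \<in> H\<close> the matrix \<open>D h\<close> commutes with everything, hence is a scalar; since \<open>D h Y = Y\<close>, a
  scalar other than \<open>1\<close> forces \<open>Y = 0\<close>.\<close>

lemma x0_zero:
  assumes \<rho>: "alg_rep RC (n, \<rho>)" and irr: "irreducible_rep (carrier RC) (n, \<rho>)" and H: "\<not> H_trivial (n, \<rho>)"
  shows "basis_values (n, \<rho>) x\<^sub>0 = 0\<^sub>m n n"
proof -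
  note P = orbit_repD[OF orbit_rep_of_alg_rep[OF \<rho>]]
  let ?M = "basis_values (n, \<rho>)"
  obtain h where h: "h \<in> H" "?M h \<noteq> 1\<^sub>m n" using H by (auto simp: H_trivial_def)
  have ih: "inv\<^bsub>G\<^esub> h \<in> H" using subgroup.m_inv_closed[OF H_subgroup h(1)] .
  obtain c where c: "?M h = c \<cdot>\<^sub>m 1\<^sub>m n"
  proof (rule schur_alg[OF \<rho> irr P(2)[OF H_G[OF h(1)]]])
    show "?M h * ?M g = ?M g * ?M h" if "g \<in> carrier G" for g
      using P(4)[OF that H_G[OF h(1)]] P(4)[OF H_G[OF h(1)] that] G_comm[OF that H_G[OF h(1)]] by simp
    show "?M h * ?M x\<^sub>0 = ?M x\<^sub>0 * ?M h"
      using P(5)[OF H_G[OF h(1)]] P(6)[OF h(1)] P(6)[OF ih] by simp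
  qed
  have "c \<noteq> 1"
  proof
    assume "c = 1"
    then have "?M h = 1\<^sub>m n" unfolding c by (intro eq_matI) auto
    then show False using h by simp
  qed
  moreover have "c \<cdot>\<^sub>m ?M x\<^sub>0 = 1 \<cdot>\<^sub>m ?M x\<^sub>0"
  proof -
    have "c \<cdot>\<^sub>m ?M x\<^sub>0 = ?M h * ?M x\<^sub>0" unfolding c using P(1) by simp
    also have "\<dots> = ?M x\<^sub>0" by (rule P(6)[OF h(1)])
    also have "\<dots> = 1 \<cdot>\<^sub>m ?M x\<^sub>0" by (rule eq_matI) auto
    finally show ?thesis .
  qed
  ultimately show ?thesis using smult_eq_cancel[OF P(1)] by blast
qed

lemma dihedral_rep_basis_values:
  assumes \<rho>: "alg_rep RC (n, \<rho>)" and iso: "trivial_or_no_invariants n (basis_values (n, \<rho>))" and H: "H_trivial (n, \<rho>)"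
  shows "dihedral_rep n (basis_values (n, \<rho>)) (reflection n (basis_values (n, \<rho>)) (basis_values (n, \<rho>) x\<^sub>0))"
  by (rule dihedral_rep_reflection[OF orbit_rep_of_alg_rep[OF \<rho>] _ iso]) (use H in \<open>simp add: H_trivial_def\<close>)

lemma group_rep_dihedral_part:
  assumes \<rho>: "alg_rep RC (n, \<rho>)" and iso: "trivial_or_no_invariants n (basis_values (n, \<rho>))" and H: "H_trivial (n, \<rho>)"
  shows "group_rep \<Gamma> (dihedral_part (n, \<rho>))"
  unfolding dihedral_part_def fst_conv
  by (rule group_rep_dihedral_map[OF dihedral_rep_basis_values[OF assms]])

lemma subalgebra_rel_group_part:
  assumes \<rho>: "alg_rep RC (n, \<rho>)" and \<sigma>: "alg_rep RC (n, \<sigma>)" and Q: "subalgebra_rel n Q"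
    and Y: "basis_values (n, \<rho>) x\<^sub>0 = 0\<^sub>m n n" "basis_values (n, \<sigma>) x\<^sub>0 = 0\<^sub>m n n"
  shows "(\<forall>f\<in>carrier RC. Q (\<rho> f) (\<sigma> f)) \<longleftrightarrow>
    (\<forall>g\<in>carrier G. Q (basis_values (n, \<rho>) g) (basis_values (n, \<sigma>) g))"
  unfolding subalgebra_rel_basis_values[OF \<rho> \<sigma> Q]
    subalgebra_rel_orbit[OF basis_rep_of_alg_rep[OF \<rho>] basis_rep_of_alg_rep[OF \<sigma>] Q] Y
  using subalgebra_rel_zero[OF Q] by blast

lemma subalgebra_rel_dihedral_part:
  assumes \<rho>: "alg_rep RC (n, \<rho>)" and \<sigma>: "alg_rep RC (n, \<sigma>)" and Q: "subalgebra_rel n Q"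
    and iso: "trivial_or_no_invariants n (basis_values (n, \<rho>))" "trivial_or_no_invariants n (basis_values (n, \<sigma>))"
    and H: "H_trivial (n, \<rho>)" "H_trivial (n, \<sigma>)"
    and m: "\<mu> n (basis_values (n, \<rho>)) = \<mu> n (basis_values (n, \<sigma>))"
  shows "(\<forall>f\<in>carrier RC. Q (\<rho> f) (\<sigma> f)) \<longleftrightarrow>
    (\<forall>\<gamma>\<in>carrier \<Gamma>. Q (snd (dihedral_part (n, \<rho>)) \<gamma>) (snd (dihedral_part (n, \<sigma>)) \<gamma>))"
  unfolding dihedral_part_def fst_conv snd_conv
    subalgebra_rel_dihedral_map[OF dihedral_rep_basis_values[OF \<rho> iso(1) H(1)] dihedral_rep_basis_values[OF \<sigma> iso(2) H(2)] Q]
    subalgebra_rel_basis_values[OF \<rho> \<sigma> Q]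
    subalgebra_rel_orbit[OF basis_rep_of_alg_rep[OF \<rho>] basis_rep_of_alg_rep[OF \<sigma>] Q]
    subalgebra_rel_reflection[OF Q orbit_repD(1)[OF orbit_rep_of_alg_rep[OF \<rho>]] orbit_repD(1)[OF orbit_rep_of_alg_rep[OF \<sigma>]] m]
  ..

definition alg_irreps where
  "alg_irreps = {\<rho>. alg_rep RC \<rho> \<and> irreducible_rep (carrier RC) \<rho>}"

lemma equiv_alg: "equiv alg_irreps (iso_rel (carrier RC) alg_irreps)"
  unfolding iso_rel_def by (rule equiv_rep_iso) (simp add: alg_irreps_def alg_rep_square)

lemma Irr_fusion_eq: "Irr_fusion R B = alg_irreps // iso_rel (carrier RC) alg_irreps"
  by (simp add: Irr_fusion_def Irr_alg_def iso_classes_def alg_irreps_def iso_rel_def)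

lemma group_part_irrep:
  assumes "\<rho> \<in> alg_irreps" "\<not> H_trivial \<rho>"
  shows "group_part \<rho> \<in> group_irreps G"
proof -
  obtain n r where \<rho>: "\<rho> = (n, r)" by (cases \<rho>)
  have a: "alg_rep RC (n, r)" "irreducible_rep (carrier RC) (n, r)" using assms(1) by (simp_all add: alg_irreps_def \<rho>)
  note Y = x0_zero[OF a assms(2)[unfolded \<rho>]]
  have "irreducible_rep (carrier RC) (n, r) \<longleftrightarrow> irreducible_rep (carrier G) (group_part (n, r))"
    unfolding group_part_def fst_conv
    by (rule irreducible_rep_transfer) (rule subalgebra_rel_group_part[OF a(1) a(1) _ Y Y])
  then show ?thesis using a(2) group_rep_group_part[OF a(1)] by (simp add: group_irreps_def \<rho>)
qed

lemma dihedral_part_irrep_iff: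
  assumes \<rho>: "alg_rep RC (n, \<rho>)" and iso: "trivial_or_no_invariants n (basis_values (n, \<rho>))" and H: "H_trivial (n, \<rho>)"
  shows "irreducible_rep (carrier RC) (n, \<rho>) \<longleftrightarrow> irreducible_rep (carrier \<Gamma>) (dihedral_part (n, \<rho>))"
proof -
  have "irreducible_rep (carrier RC) (n, \<rho>) \<longleftrightarrow>
      irreducible_rep (carrier \<Gamma>) (n, snd (dihedral_part (n, \<rho>)))"
    by (rule irreducible_rep_transfer) (rule subalgebra_rel_dihedral_part[OF \<rho> \<rho> _ iso iso H H refl])
  then show ?thesis by (simp add: dihedral_part_def)
qed

lemma dihedral_part_irrep:
  assumes "\<rho> \<in> alg_irreps" "H_trivial \<rho>"
  shows "dihedral_part \<rho> \<in> group_irreps \<Gamma>"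
proof -
  obtain n r where \<rho>: "\<rho> = (n, r)" by (cases \<rho>)
  have a: "alg_rep RC (n, r)" "irreducible_rep (carrier RC) (n, r)" using assms(1) by (simp_all add: alg_irreps_def \<rho>)
  note iso = trivial_or_no_invariants_basis_values[OF a] and H = assms(2)[unfolded \<rho>]
  show ?thesis
    using group_rep_dihedral_part[OF a(1) iso H] dihedral_part_irrep_iff[OF a(1) iso H] a(2)
    by (simp add: group_irreps_def \<rho>)
qed

text \<open>Together with the next two lemmas: the case distinction and the associated representation depend only on
  the isomorphism class, and determine it.\<close>

lemma H_trivial_iso:
  assumes "alg_rep RC \<rho>" "alg_rep RC \<sigma>" "rep_iso (carrier RC) \<rho> \<sigma>"
  shows "H_trivial \<rho> \<longleftrightarrow> H_trivial \<sigma>"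
proof -
  have "basis_values \<rho> h = 1\<^sub>m (fst \<rho>) \<longleftrightarrow> basis_values \<sigma> h = 1\<^sub>m (fst \<sigma>)" if "h \<in> H" for h
    unfolding basis_values_def
    by (rule rep_iso_trivial_iff[OF assms(3) ptensor_closed alg_rep_square[OF assms(1)] alg_rep_square[OF assms(2)]])
      (use H_G[OF that] in simp)
  then show ?thesis by (simp add: H_trivial_def)
qed

lemma group_part_iso_iff:
  assumes \<rho>: "\<rho> \<in> alg_irreps" "\<not> H_trivial \<rho>" and \<sigma>: "\<sigma> \<in> alg_irreps" "\<not> H_trivial \<sigma>"
  shows "rep_iso (carrier RC) \<rho> \<sigma> \<longleftrightarrow> rep_iso (carrier G) (group_part \<rho>) (group_part \<sigma>)"
proof (cases "fst \<rho> = fst \<sigma>")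
  case True
  then obtain n r s where \<rho>\<sigma>: "\<rho> = (n, r)" "\<sigma> = (n, s)" by (metis prod.collapse)
  have a: "alg_rep RC (n, r)" "irreducible_rep (carrier RC) (n, r)"
    "alg_rep RC (n, s)" "irreducible_rep (carrier RC) (n, s)"
    using \<rho>(1) \<sigma>(1) by (simp_all add: alg_irreps_def \<rho>\<sigma>)
  show ?thesis
    unfolding \<rho>\<sigma> group_part_def fst_conv
    by (rule rep_iso_transfer) (rule subalgebra_rel_group_part[OF a(1,3) _ x0_zero[OF a(1,2)] x0_zero[OF a(3,4)]],
      use \<rho>(2) \<sigma>(2) \<rho>\<sigma> in simp_all)
qed (simp add: rep_iso_def group_part_def)

text \<open>The passage from \<open>Y\<close> to \<open>S\<close> uses the same constants for both representations only if their \<open>\<mu>\<close> agree.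
  An isomorphism on either side ensures this, since \<open>\<mu>\<close> depends only on whether \<open>D\<close> is trivial on \<open>G\<close>.\<close>

lemma dihedral_part_iso_iff:
  assumes \<rho>: "\<rho> \<in> alg_irreps" "H_trivial \<rho>" and \<sigma>: "\<sigma> \<in> alg_irreps" "H_trivial \<sigma>"
  shows "rep_iso (carrier RC) \<rho> \<sigma> \<longleftrightarrow> rep_iso (carrier \<Gamma>) (dihedral_part \<rho>) (dihedral_part \<sigma>)"
proof (cases "fst \<rho> = fst \<sigma>")
  case True
  then obtain n r s where \<rho>\<sigma>: "\<rho> = (n, r)" "\<sigma> = (n, s)" by (metis prod.collapse)
  have a: "alg_rep RC (n, r)" "irreducible_rep (carrier RC) (n, r)"
    "alg_rep RC (n, s)" "irreducible_rep (carrier RC) (n, s)"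
    using \<rho>(1) \<sigma>(1) by (simp_all add: alg_irreps_def \<rho>\<sigma>)
  note iso = trivial_or_no_invariants_basis_values[OF a(1,2)] trivial_or_no_invariants_basis_values[OF a(3,4)]
  have H: "H_trivial (n, r)" "H_trivial (n, s)" using \<rho>(2) \<sigma>(2) \<rho>\<sigma> by simp_all
  let ?M = "basis_values (n, r)" and ?N = "basis_values (n, s)"
  note dr = dihedral_rep_basis_values[OF a(1) iso(1) H(1)] and ds = dihedral_rep_basis_values[OF a(3) iso(2) H(2)]
  have \<mu>_cong: "\<mu> n ?M = \<mu> n ?N" if "\<And>g. g \<in> carrier G \<Longrightarrow> ?M g = 1\<^sub>m n \<longleftrightarrow> ?N g = 1\<^sub>m n"
    using that by (simp add: \<mu>_def)
  have transfer: "rep_iso (carrier RC) (n, r) (n, s) \<longleftrightarrow>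
      rep_iso (carrier \<Gamma>) (dihedral_part (n, r)) (dihedral_part (n, s))" if m: "\<mu> n ?M = \<mu> n ?N"
  proof -
    have "rep_iso (carrier RC) (n, r) (n, s) \<longleftrightarrow>
        rep_iso (carrier \<Gamma>) (n, snd (dihedral_part (n, r))) (n, snd (dihedral_part (n, s)))"
      by (rule rep_iso_transfer) (rule subalgebra_rel_dihedral_part[OF a(1,3) _ iso H m])
    then show ?thesis by (simp add: dihedral_part_def)
  qed
  have 1: "\<mu> n ?M = \<mu> n ?N" if "rep_iso (carrier RC) (n, r) (n, s)"
  proof (rule \<mu>_cong)
    fix g assume g: "g \<in> carrier G"
    show "?M g = 1\<^sub>m n \<longleftrightarrow> ?N g = 1\<^sub>m n"
      using rep_iso_trivial_iff[OF that ptensor_closed alg_rep_square[OF a(1)] alg_rep_square[OF a(3)], of g 1] g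
      by (simp add: basis_values_def)
  qed
  have 2: "\<mu> n ?M = \<mu> n ?N" if "rep_iso (carrier \<Gamma>) (dihedral_part (n, r)) (dihedral_part (n, s))"
  proof (rule \<mu>_cong)
    fix g assume g: "g \<in> carrier G"
    show "?M g = 1\<^sub>m n \<longleftrightarrow> ?N g = 1\<^sub>m n"
      using rep_iso_trivial_iff[OF that coset_\<Gamma>(1)[OF g]
          group_rep_square[OF group_rep_dihedral_part[OF a(1) iso(1) H(1)]]
          group_rep_square[OF group_rep_dihedral_part[OF a(3) iso(2) H(2)]]]
      by (simp add: dihedral_part_def dihedral_map_coset(1)[OF dr g] dihedral_map_coset(1)[OF ds g])
  qed
  show ?thesis unfolding \<rho>\<sigma> using transfer 1 2 by blast
qed (simp add: rep_iso_def dihedral_part_def)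

section \<open>Every class is reached\<close>

lemma alg_rep_of_orbit_rep:
  assumes P: "orbit_rep n D Y"
  obtains \<rho> where "alg_rep RC (n, \<rho>)" "\<And>g. g \<in> carrier G \<Longrightarrow> basis_values (n, \<rho>) g = D g"
    "basis_values (n, \<rho>) x\<^sub>0 = Y"
proof (rule that)
  note M = basis_rep_glue[OF P]
  show "alg_rep RC (n, extension n (glue D Y))" by (rule alg_rep_of_basis_rep[OF M(1)])
  show "basis_values (n, extension n (glue D Y)) g = D g" if "g \<in> carrier G" for g
    using basis_values_extension[OF M(1) G_basis[OF that]] that by simp
  show "basis_values (n, extension n (glue D Y)) x\<^sub>0 = Y"
    using basis_values_extension[OF M(1) X_basis[OF x0_X]] M(2) by simp
qed

lemma group_irrep_nontrivial_iff:
  assumes \<psi>: "\<psi> \<in> group_irreps G"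
  shows "sum_of_nontrivial G H \<psi> \<longleftrightarrow> (\<exists>h\<in>H. snd \<psi> h \<noteq> 1\<^sub>m (fst \<psi>))"
proof -
  obtain p where p: "\<psi> = (1, p)" using group_irrep_dim_one[OF comm_inv_group \<psi>] by (metis prod.collapse)
  have g: "group_rep G (1, p)" using \<psi> p by (simp add: group_irreps_def)
  have "group_rep (G\<lparr>carrier := H\<rparr>) (1, p)"
    using g H_G by (auto simp: group_rep_def hom_def)
  then show ?thesis using sum_of_nontrivial_dim_one p by simp
qed

text \<open>The relation \<open>Y\<^sup>2 = \<Sum>\<^sub>h D h + \<dots> Y\<close> holds for \<open>Y = 0\<close> because \<open>\<Sum>\<^sub>h D h\<close> is fixed by a scalar \<open>D h \<noteq> 1\<close> and
  hence zero.\<close>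

lemma group_part_surj:
  assumes \<psi>: "\<psi> \<in> group_irreps G" and nontriv: "sum_of_nontrivial G H \<psi>"
  obtains \<rho> where "\<rho> \<in> alg_irreps" "\<not> H_trivial \<rho>" "rep_iso (carrier G) (group_part \<rho>) \<psi>"
proof -
  obtain n D where \<psi>_eq: "\<psi> = (n, D)" by (cases \<psi>)
  have n: "n = 1" using group_irrep_dim_one[OF comm_inv_group \<psi>] \<psi>_eq by simp
  have rep: "group_rep G (n, D)" and irr: "irreducible_rep (carrier G) (n, D)"
    using \<psi> \<psi>_eq by (simp_all add: group_irreps_def)
  have D: "D g \<in> carrier_mat n n" if "g \<in> carrier G" for g
    using group_rep_square[OF rep] that by (simp add: square_rep_def)
  have mult: "D (g \<otimes> g') = D g * D g'" if "g \<in> carrier G" "g' \<in> carrier G" for g g'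
    using group_rep_mult[OF rep that] by simp
  have one: "D \<one> = 1\<^sub>m n" using group_rep_one[OF rep] by simp
  obtain h where h: "h \<in> H" "D h \<noteq> 1\<^sub>m n"
    using nontriv group_irrep_nontrivial_iff[OF \<psi>] \<psi>_eq by auto
  obtain c where c: "D h = c \<cdot>\<^sub>m 1\<^sub>m n"
  proof (rule schur[OF irr group_rep_square[OF rep, simplified] D[OF H_G[OF h(1)]]])
    fix g assume g: "g \<in> carrier G"
    show "D h * D g = D g * D h"
      using mult[OF g H_G[OF h(1)]] mult[OF H_G[OF h(1)] g] G_comm[OF g H_G[OF h(1)]] by simp
  qed
  have sum: "msum n D H = 0\<^sub>m n n"
  proof (rule smult_eq_cancel)
    have "D h * msum n D H = msum n D H"
      by (rule msum_translate[OF G.group_axioms H_subgroup h(1)]) (use D mult H_G h(1) in auto)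
    then show "c \<cdot>\<^sub>m msum n D H = 1 \<cdot>\<^sub>m msum n D H" unfolding c by (simp, intro eq_matI) auto
    show "c \<noteq> 1"
    proof
      assume "c = 1"
      then have "D h = 1\<^sub>m n" unfolding c by (intro eq_matI) auto
      then show False using h by simp
    qed
  qed simp
  have P: "orbit_rep n D (0\<^sub>m n n)"
    unfolding orbit_rep_def
  proof (intro conjI ballI)
    have "t \<cdot>\<^sub>m (msum n D (carrier G) * 0\<^sub>m n n) = 0\<^sub>m n n" for t
      by (rule eq_matI) (simp_all add: right_mult_zero_mat[of _ n n])
    then show "0\<^sub>m n n * 0\<^sub>m n n = msum n D H + of_nat \<kappa> / of_nat (card H) \<cdot>\<^sub>m (msum n D (carrier G) * 0\<^sub>m n n)"
      by (simp add: sum)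
  qed (use D mult one H_G in \<open>simp_all add: left_mult_zero_mat[of _ n n] right_mult_zero_mat[of _ n n]\<close>)
  obtain \<rho> where \<rho>: "alg_rep RC (n, \<rho>)" "\<And>g. g \<in> carrier G \<Longrightarrow> basis_values (n, \<rho>) g = D g"
    "basis_values (n, \<rho>) x\<^sub>0 = 0\<^sub>m n n"
    using alg_rep_of_orbit_rep[OF P] by blast
  have "irreducible_rep (carrier RC) (n, \<rho>)" unfolding n by (rule irreducible_rep_dim_one)
  moreover have "\<not> H_trivial (n, \<rho>)" using h \<rho>(2)[OF H_G[OF h(1)]] by (auto simp: H_trivial_def)
  moreover have "rep_iso (carrier G) (group_part (n, \<rho>)) \<psi>"
    unfolding \<psi>_eq group_part_def fst_conv rep_iso_def snd_conv
    by (intro conjI refl bexI[of _ "1\<^sub>m n"] ballI) (simp add: \<rho>(2), auto simp: Units_ring_mat dest: D)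
  ultimately show thesis using that \<rho>(1) by (simp add: alg_irreps_def)
qed

text \<open>The constants \<open>\<mu>\<close> and \<open>half_gap\<close> can be read off from the restriction to \<open>G\<close>, so \<open>Y\<close> can be
  reconstructed from \<open>S\<close> and is sent back to \<open>S\<close>.\<close>

lemma dihedral_part_surj:
  assumes \<sigma>: "\<sigma> \<in> group_irreps \<Gamma>"
  obtains \<rho> where "\<rho> \<in> alg_irreps" "H_trivial \<rho>" "rep_iso (carrier \<Gamma>) (dihedral_part \<rho>) \<sigma>"
proof -
  obtain n s where \<sigma>_eq: "\<sigma> = (n, s)" by (cases \<sigma>)
  have rep: "group_rep \<Gamma> (n, s)" and irr: "irreducible_rep (carrier \<Gamma>) (n, s)"
    using \<sigma> \<sigma>_eq by (simp_all add: group_irreps_def)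
  define D where "D = (\<lambda>g. s (coset g, 0))"
  define S where "S = s (coset \<one>, 1)"
  have P: "dihedral_rep n D S" unfolding D_def S_def by (rule dihedral_rep_of_group_rep(1)[OF rep])
  have s: "s \<gamma> = dihedral_map n D S \<gamma>" if "\<gamma> \<in> carrier \<Gamma>" for \<gamma>
    unfolding D_def S_def using dihedral_rep_of_group_rep(2)[OF rep that] by simp
  note PD = dihedral_repD[OF P]
  let ?Z = "msum n D (carrier G)"
  obtain c where c: "?Z = c \<cdot>\<^sub>m 1\<^sub>m n"
  proof (rule schur[OF irr group_rep_square[OF rep] msum_carrier])
    have "(\<forall>\<gamma>\<in>carrier \<Gamma>. ?Z * dihedral_map n D S \<gamma> = dihedral_map n D S \<gamma> * ?Z)"
      unfolding subalgebra_rel_dihedral_map[OF P P subalgebra_rel_intertwiner[OF msum_carrier]]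
    proof (intro conjI ballI)
      show "?Z * D g = D g * ?Z" if "g \<in> carrier G" for g
        using msum_absorb[of D n g, OF PD(2) PD(4) that] by simp
      show "?Z * S = S * ?Z" by (rule msum_commute_Y[of D n, OF PD(2) PD(1) PD(5)])
    qed
    then show "?Z * s x = s x * ?Z" if "x \<in> carrier \<Gamma>" for x using that s by simp
  qed
  have iso: "trivial_or_no_invariants n D" by (rule trivial_or_no_invariants_of_scalar[OF PD(2) PD(4) c])
  obtain \<rho> where \<rho>: "alg_rep RC (n, \<rho>)" "\<And>g. g \<in> carrier G \<Longrightarrow> basis_values (n, \<rho>) g = D g"
    "basis_values (n, \<rho>) x\<^sub>0 = unreflection n D S"
    using alg_rep_of_orbit_rep[OF orbit_rep_unreflection[OF P iso]] by blast
  let ?M = "basis_values (n, \<rho>)"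
  have sumM: "msum n ?M (carrier G) = ?Z" by (rule msum_cong) (simp_all add: \<rho>(2))
  have isoM: "trivial_or_no_invariants n ?M" using iso unfolding trivial_or_no_invariants_def sumM using \<rho>(2) by simp
  have H: "H_trivial (n, \<rho>)" using \<rho>(2) H_G PD(6) by (simp add: H_trivial_def)
  have "\<mu> n ?M = \<mu> n D" using \<rho>(2) by (simp add: \<mu>_def)
  then have "reflection n ?M (?M x\<^sub>0) = reflection n D (unreflection n D S)"
    by (simp add: reflection_def half_gap_def \<rho>(3))
  then have refl: "reflection n ?M (?M x\<^sub>0) = S" using reflection_unreflection[OF PD(1)] by simp
  note dM = dihedral_rep_basis_values[OF \<rho>(1) isoM H]
  have eq: "snd (dihedral_part (n, \<rho>)) \<gamma> = s \<gamma>" if "\<gamma> \<in> carrier \<Gamma>" for \<gamma>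
    using that
  proof (rule \<Gamma>_cases)
    fix g assume g: "g \<in> carrier G" "\<gamma> = (coset g, 0)"
    then show ?thesis
      using dihedral_map_coset(1)[OF dM g(1)] dihedral_map_coset(1)[OF P g(1)] s[OF that] \<rho>(2)
      by (simp add: dihedral_part_def)
  next
    fix g assume g: "g \<in> carrier G" "\<gamma> = (coset g, 1)"
    then show ?thesis
      using dihedral_map_coset(2)[OF dM g(1)] dihedral_map_coset(2)[OF P g(1)] s[OF that] \<rho>(2) refl
      by (simp add: dihedral_part_def)
  qed
  have fst: "fst (dihedral_part (n, \<rho>)) = n" by (simp add: dihedral_part_def)
  have sq: "s \<gamma> \<in> carrier_mat n n" if "\<gamma> \<in> carrier \<Gamma>" for \<gamma>
    using group_rep_square[OF rep] that by (simp add: square_rep_def)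
  have "irreducible_rep (carrier \<Gamma>) (dihedral_part (n, \<rho>))"
    using irr fst eq unfolding irreducible_rep_def fst_conv snd_conv by simp
  then have "(n, \<rho>) \<in> alg_irreps"
    using dihedral_part_irrep_iff[OF \<rho>(1) isoM H] \<rho>(1) by (simp add: alg_irreps_def)
  moreover have "rep_iso (carrier \<Gamma>) (dihedral_part (n, \<rho>)) \<sigma>"
    unfolding \<sigma>_eq rep_iso_def fst fst_conv snd_conv
  proof (intro conjI bexI[of _ "1\<^sub>m n"] ballI)
    show "1\<^sub>m n * snd (dihedral_part (n, \<rho>)) \<gamma> = s \<gamma> * 1\<^sub>m n" if "\<gamma> \<in> carrier \<Gamma>" for \<gamma>
      using sq[OF that] by (simp add: eq[OF that])
    show "1\<^sub>m n \<in> Units (ring_mat TYPE(complex) n ())" by (auto simp: Units_ring_mat)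
  qed simp
  ultimately show thesis using that H by blast
qed

section \<open>The bijection\<close>

definition class_map where
  "class_map \<rho> = (if H_trivial \<rho> then Inr (iso_rel (carrier \<Gamma>) (group_irreps \<Gamma>) `` {dihedral_part \<rho>})
     else Inl (iso_rel (carrier G) (group_irreps G) `` {group_part \<rho>}))"

lemma class_map_eq_iff:
  assumes \<rho>: "\<rho> \<in> alg_irreps" and \<sigma>: "\<sigma> \<in> alg_irreps"
  shows "class_map \<rho> = class_map \<sigma> \<longleftrightarrow> (\<rho>, \<sigma>) \<in> iso_rel (carrier RC) alg_irreps"
proof -
  have a: "alg_rep RC \<rho>" "alg_rep RC \<sigma>" using \<rho> \<sigma> by (simp_all add: alg_irreps_def)
  consider "H_trivial \<rho>" "H_trivial \<sigma>" | "\<not> H_trivial \<rho>" "\<not> H_trivial \<sigma>" | "H_trivial \<rho> \<noteq> H_trivial \<sigma>" by blast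
  then show ?thesis
  proof cases
    case 1
    then show ?thesis
      using eq_equiv_class_iff[OF equiv_group dihedral_part_irrep[OF \<rho> 1(1)] dihedral_part_irrep[OF \<sigma> 1(2)]]
        dihedral_part_iso_iff[OF \<rho> 1(1) \<sigma> 1(2)] dihedral_part_irrep[OF \<rho> 1(1)] dihedral_part_irrep[OF \<sigma> 1(2)] \<rho> \<sigma>
      by (simp add: class_map_def iso_rel_def)
  next
    case 2
    then show ?thesis
      using eq_equiv_class_iff[OF equiv_group group_part_irrep[OF \<rho> 2(1)] group_part_irrep[OF \<sigma> 2(2)]]
        group_part_iso_iff[OF \<rho> 2(1) \<sigma> 2(2)] group_part_irrep[OF \<rho> 2(1)] group_part_irrep[OF \<sigma> 2(2)] \<rho> \<sigma>
      by (simp add: class_map_def iso_rel_def)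
  next
    case 3
    then show ?thesis using H_trivial_iso[OF a] by (auto simp: class_map_def iso_rel_def)
  qed
qed

lemma class_map_image: "class_map ` alg_irreps = Irr_rel G H <+> Irr_group \<Gamma>"
proof (intro equalityI subsetI)
  fix c assume "c \<in> class_map ` alg_irreps"
  then obtain \<rho> where \<rho>: "\<rho> \<in> alg_irreps" "c = class_map \<rho>" by blast
  show "c \<in> Irr_rel G H <+> Irr_group \<Gamma>"
  proof (cases "H_trivial \<rho>")
    case True
    have "iso_rel (carrier \<Gamma>) (group_irreps \<Gamma>) `` {dihedral_part \<rho>} \<in> Irr_group \<Gamma>"
      unfolding Irr_group_eq by (rule quotientI[OF dihedral_part_irrep[OF \<rho>(1) True]])
    then show ?thesis using True \<rho>(2) by (simp add: class_map_def InrI)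
  next
    case False
    note irr = group_part_irrep[OF \<rho>(1) False]
    let ?\<Psi> = "iso_rel (carrier G) (group_irreps G) `` {group_part \<rho>}"
    have "sum_of_nontrivial G H \<psi>" if "\<psi> \<in> ?\<Psi>" for \<psi>
    proof -
      have \<psi>: "\<psi> \<in> group_irreps G" "rep_iso (carrier G) (group_part \<rho>) \<psi>"
        using that by (auto simp: iso_rel_def)
      obtain h where h: "h \<in> H" "basis_values \<rho> h \<noteq> 1\<^sub>m (fst \<rho>)" using False by (auto simp: H_trivial_def)
      have sq: "square_rep (carrier G) (group_part \<rho>)" "square_rep (carrier G) \<psi>"
        using irr \<psi>(1) unfolding group_irreps_def by (blast intro: group_rep_square)+
      have "snd \<psi> h \<noteq> 1\<^sub>m (fst \<psi>)"
        using rep_iso_trivial_iff[OF \<psi>(2) H_G[OF h(1)] sq] h(2) by (simp add: group_part_def)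
      then show ?thesis using group_irrep_nontrivial_iff[OF \<psi>(1)] h(1) by blast
    qed
    then have "?\<Psi> \<in> Irr_rel G H"
      unfolding Irr_rel_def Irr_group_eq using quotientI[OF irr] by blast
    then show ?thesis using False \<rho>(2) by (simp add: class_map_def InlI)
  qed
next
  fix c assume "c \<in> Irr_rel G H <+> Irr_group \<Gamma>"
  then consider \<Psi> where "\<Psi> \<in> Irr_rel G H" "c = Inl \<Psi>" | \<Psi> where "\<Psi> \<in> Irr_group \<Gamma>" "c = Inr \<Psi>"
    by (elim PlusE) blast+
  then show "c \<in> class_map ` alg_irreps"
  proof cases
    case 1
    then obtain \<psi> where \<psi>: "\<psi> \<in> group_irreps G" "\<Psi> = iso_rel (carrier G) (group_irreps G) `` {\<psi>}"
      unfolding Irr_rel_def Irr_group_eq by (auto elim: quotientE)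
    have "\<psi> \<in> \<Psi>" unfolding \<psi>(2) by (rule equiv_class_self[OF equiv_group \<psi>(1)])
    then have "sum_of_nontrivial G H \<psi>" using 1(1) by (simp add: Irr_rel_def)
    with \<psi>(1) obtain \<rho> where \<rho>: "\<rho> \<in> alg_irreps" "\<not> H_trivial \<rho>" "rep_iso (carrier G) (group_part \<rho>) \<psi>"
      by (rule group_part_surj)
    have rel: "(group_part \<rho>, \<psi>) \<in> iso_rel (carrier G) (group_irreps G)"
      using group_part_irrep[OF \<rho>(1,2)] \<psi>(1) \<rho>(3) by (simp add: iso_rel_def)
    have "c = class_map \<rho>"
      unfolding 1(2) \<psi>(2) class_map_def equiv_class_eq[OF equiv_group rel] using \<rho>(2) by simp
    then show ?thesis using \<rho>(1) by blast
  next
    case 2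
    then obtain \<sigma> where \<sigma>: "\<sigma> \<in> group_irreps \<Gamma>" "\<Psi> = iso_rel (carrier \<Gamma>) (group_irreps \<Gamma>) `` {\<sigma>}"
      unfolding Irr_group_eq by (auto elim: quotientE)
    from \<sigma>(1) obtain \<rho> where \<rho>: "\<rho> \<in> alg_irreps" "H_trivial \<rho>" "rep_iso (carrier \<Gamma>) (dihedral_part \<rho>) \<sigma>"
      by (rule dihedral_part_surj)
    have rel: "(dihedral_part \<rho>, \<sigma>) \<in> iso_rel (carrier \<Gamma>) (group_irreps \<Gamma>)"
      using dihedral_part_irrep[OF \<rho>(1,2)] \<sigma>(1) \<rho>(3) by (simp add: iso_rel_def)
    have "c = class_map \<rho>"
      unfolding 2(2) \<sigma>(2) class_map_def equiv_class_eq[OF equiv_group rel] using \<rho>(2) by simp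
    then show ?thesis using \<rho>(1) by blast
  qed
qed

lemma Irr_fusion_bij: "\<exists>f. bij_betw f (Irr_fusion R B) (Irr_rel G H <+> Irr_group \<Gamma>)"
  unfolding Irr_fusion_eq class_map_image[symmetric]
  by (rule bij_betw_quotient_image[OF equiv_alg class_map_eq_iff])

end

theorem proposition2p16:
  fixes R :: "('a, 'm) ring_scheme"
    and B :: "'a set"
    and star :: "'a \<Rightarrow> 'a"
  assumes "fusion_ring R B star"
    and "card (basis_orbits R B star) = 2"
    and "comm_group (inv_group R B star)"
    and "uniform R B star"
    and "\<forall>x \<in> noninv_basis R B star. star x = x"
  shows "\<exists>f. bij_betw f (Irr_fusion R B)
           (Irr_rel (inv_group R B star) (stab_group R B star) <+>
            Irr_group (semidirect_C2 (quot_group R B star) (theta R B star)))"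
proof -
  interpret self_dual_uniform_fusion_ring R B star
    using assms by (intro self_dual_uniform_fusion_ring.intro self_dual_uniform_fusion_ring_axioms.intro) auto
  show ?thesis by (rule Irr_fusion_bij)
qed

end
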